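(* Fix $d\in\mathbb{N}$ and let $\operatorname{Diag}_d$ be the multivalued mapping on the space of real symmetric $d\times d$ matrices defined by $$\operatorname{Diag}_d(A):=\{(\vec w_1,\ldots,\vec w_d): (\vec w_1,\ldots,\vec w_d)\text{ is a basis of }\mathbb{R}^d\text{ consisting of eigenvectors of }A\}.$$ Then $\mathfrak{C}_{\rm t}(\operatorname{Diag}_d)=\mathfrak{C}_{\rm c}(\operatorname{Diag}_d,\rho^{d(d+1)/2},\rho^{d\times d})=d$.
   Context: Real symmetric $d\times d$ matrices are identified with $\mathbb{R}^{d(d+1)/2}$ (their upper triangular entries), with the Euclidean topology, and represented via $\rho^{d(d+1)/2}$; a $d$-tuple of vectors of $\mathbb{R}^d$ is represented via $\rho^{d\times d}$. Here $\rho$ is the Cauchy representation of $\mathbb{R}$ (a name of $x$ encodes rationals $q_k$ with $|x-q_k|\le2^{-k}$) and $\rho^k$ its componentwise extension. For a multivalued $f:\subseteq X\rightrightarrows Y$ (with $\operatorname{dom}(f)=\{x:f(x)\ne\emptyset\}$), $f$ is continuous at $x$ if there is $y\in f(x)$ such that for every open $V\ni y$ there is a neighbourhood $U$ of $x$ with $f(z)\cap V\neq\emptyset$ for all $z\in U\cap\operatorname{dom}(f)$; $f$ is continuous if continuous at every point of its domain. $\mathfrak{C}_{\rm t}(f)$ is the least cardinality of a partition $\Delta$ of $\operatorname{dom}(f)$ with $f|_D$ continuous for all $D\in\Delta$. $\mathfrak{C}_{\rm c}(f,\alpha,\beta)$ is the least cardinality $k$ of an (at most countable) partition $\Delta$ of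 $\operatorname{dom}(f)$ for which there is a notation $\delta$ of $\Delta$ and a Type-2 machine that, given an $\alpha$-name of $a$ and a $\delta$-name of the $D\in\Delta$ containing $a$, outputs a $\beta$-name of some element of $f(a)$. *)

theory Defs
  imports
    "HOL-Analysis.Analysis"
    "HOL-Library.Disjoint_Sets"
    "HOL-Library.Extended_Nat"
    "HOL-Library.Countable_Set"
begin

section \<open>Multivalued mappings and the topological cardinal of discontinuity\<close>

text \<open>A multivalued partial mapping is a set-valued function; it is undefined where its value is
  the empty set.\<close>

type_synonym ('a, 'b) multimap = "'a \<Rightarrow> 'b set"

definition mdom :: "('a, 'b) multimap \<Rightarrow> 'a set" where
  "mdom f = {x. f x \<noteq> {}}"

definition mrestrict :: "('a, 'b) multimap \<Rightarrow> 'a set \<Rightarrow> ('a, 'b) multimap" where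
  "mrestrict f D = (\<lambda>x. if x \<in> D then f x else {})"

definition mcontinuous_at ::
  "('a::topological_space, 'b::topological_space) multimap \<Rightarrow> 'a \<Rightarrow> bool" where
  "mcontinuous_at f x \<longleftrightarrow>
     (\<exists>y\<in>f x. \<forall>V. open V \<and> y \<in> V \<longrightarrow>
        (\<exists>U. open U \<and> x \<in> U \<and> (\<forall>z\<in>U \<inter> mdom f. f z \<inter> V \<noteq> {})))"

definition mcontinuous ::
  "('a::topological_space, 'b::topological_space) multimap \<Rightarrow> bool" where
  "mcontinuous f \<longleftrightarrow> (\<forall>x\<in>mdom f. mcontinuous_at f x)"

text \<open>All infinite cardinalities are identified with \<open>\<infinity>\<close>, which is also the value of an infimum
  over no partition at all.\<close>

definition ecard :: "'a set \<Rightarrow> enat" where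
  "ecard A = (if finite A then enat (card A) else \<infinity>)"

definition Ct :: "('a::topological_space, 'b::topological_space) multimap \<Rightarrow> enat" where
  "Ct f = (INF \<Delta>\<in>{\<Delta>. partition_on (mdom f) \<Delta> \<and> (\<forall>D\<in>\<Delta>. mcontinuous (mrestrict f D))}. ecard \<Delta>)"


section \<open>Type-2 Turing machines\<close>

text \<open>The alphabet is \<open>{False, True}\<close>; a tape cell holds a letter or, for \<^term>\<open>None\<close>, the blank.
  A machine is a flowchart with finitely many read-only one-way input tapes, finitely many
  read-write work tapes, infinite in both directions, and one write-only one-way output tape.
  Tapes are numbered; since a program is a finite list, it addresses only finitely many of them.
  Leaving the program halts the machine.\<close>

type_synonym inf_word = "nat \<Rightarrow> bool"
type_synonym cell = "bool option"

datatype instr =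
    In_Right nat              \<comment> \<open>move the head of an input tape\<close>
  | In_Branch nat cell nat    \<comment> \<open>jump if the head of an input tape scans the given symbol\<close>
  | Work_Left nat
  | Work_Right nat
  | Work_Write nat cell
  | Work_Branch nat cell nat
  | Output bool               \<comment> \<open>append a letter to the output tape\<close>
  | Jump nat

type_synonym machine = "instr list"

record config =
  pc :: nat
  in_pos :: "nat \<Rightarrow> nat"
  work_pos :: "nat \<Rightarrow> int"
  work :: "nat \<Rightarrow> int \<Rightarrow> cell"
  out :: "bool list"

definition init_config :: config where
  "init_config = \<lparr>pc = 0, in_pos = (\<lambda>_. 0), work_pos = (\<lambda>_. 0), work = (\<lambda>_ _. None), out = []\<rparr>"

fun exec :: "(nat \<Rightarrow> nat \<Rightarrow> cell) \<Rightarrow> instr \<Rightarrow> config \<Rightarrow> config" where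
  "exec inp (In_Right t) c =
     c\<lparr>pc := Suc (pc c), in_pos := (in_pos c)(t := Suc (in_pos c t))\<rparr>"
| "exec inp (In_Branch t s l) c =
     c\<lparr>pc := (if inp t (in_pos c t) = s then l else Suc (pc c))\<rparr>"
| "exec inp (Work_Left t) c =
     c\<lparr>pc := Suc (pc c), work_pos := (work_pos c)(t := work_pos c t - 1)\<rparr>"
| "exec inp (Work_Right t) c =
     c\<lparr>pc := Suc (pc c), work_pos := (work_pos c)(t := work_pos c t + 1)\<rparr>"
| "exec inp (Work_Write t s) c =
     c\<lparr>pc := Suc (pc c), work := (work c)(t := (work c t)(work_pos c t := s))\<rparr>"
| "exec inp (Work_Branch t s l) c =
     c\<lparr>pc := (if work c t (work_pos c t) = s then l else Suc (pc c))\<rparr>"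
| "exec inp (Output b) c =
     c\<lparr>pc := Suc (pc c), out := out c @ [b]\<rparr>"
| "exec inp (Jump l) c = c\<lparr>pc := l\<rparr>"

definition step :: "machine \<Rightarrow> (nat \<Rightarrow> nat \<Rightarrow> cell) \<Rightarrow> config \<Rightarrow> config" where
  "step M inp c = (if pc c < length M then exec inp (M ! pc c) c else c)"

definition run :: "machine \<Rightarrow> (nat \<Rightarrow> nat \<Rightarrow> cell) \<Rightarrow> nat \<Rightarrow> config" where
  "run M inp n = (step M inp ^^ n) init_config"

definition inf_tape :: "inf_word \<Rightarrow> nat \<Rightarrow> cell" where
  "inf_tape p i = Some (p i)"

definition fin_tape :: "bool list \<Rightarrow> nat \<Rightarrow> cell" where
  "fin_tape w i = (if i < length w then Some (w ! i) else None)"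

text \<open>\<open>M\<close>, run on the infinite word \<open>p\<close> (input tape 0) and the finite word \<open>w\<close> (input tape 1),
  writes exactly the infinite word \<open>q\<close>.\<close>

definition outputs :: "machine \<Rightarrow> inf_word \<Rightarrow> bool list \<Rightarrow> inf_word \<Rightarrow> bool" where
  "outputs M p w q \<longleftrightarrow>
     (let inp = (\<lambda>t. if t = 0 then inf_tape p else if t = 1 then fin_tape w else (\<lambda>_. None)) in
       (\<forall>n. \<forall>i<length (out (run M inp n)). out (run M inp n) ! i = q i) \<and>
       (\<forall>m. \<exists>n. m \<le> length (out (run M inp n))))"


section \<open>Representations and nonuniform computability\<close>

text \<open>A representation is given by its graph: \<open>\<alpha> p x\<close> means that \<open>p\<close> is an \<open>\<alpha>\<close>-name of \<open>x\<close>.\<close>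

type_synonym 'a representation = "inf_word \<Rightarrow> 'a \<Rightarrow> bool"

text \<open>A notation of \<open>\<Delta>\<close> is a partial map from the finite words onto \<open>\<Delta>\<close>. No effectivity is
  required of it, and an element of \<open>\<Delta>\<close> may have several names.\<close>

definition computable_with_advice ::
  "('a, 'b) multimap \<Rightarrow> 'a representation \<Rightarrow> 'b representation \<Rightarrow> 'a set set \<Rightarrow> bool" where
  "computable_with_advice f \<alpha> \<beta> \<Delta> \<longleftrightarrow>
     (\<exists>(\<delta> :: bool list \<rightharpoonup> 'a set) M. ran \<delta> = \<Delta> \<and>
        (\<forall>D\<in>\<Delta>. \<forall>a\<in>D. \<forall>p w. \<alpha> p a \<and> \<delta> w = Some D \<longrightarrow>
           (\<exists>q. outputs M p w q \<and> (\<exists>b\<in>f a. \<beta> q b))))"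

definition Cc :: "('a, 'b) multimap \<Rightarrow> 'a representation \<Rightarrow> 'b representation \<Rightarrow> enat" where
  "Cc f \<alpha> \<beta> =
     (INF \<Delta>\<in>{\<Delta>. partition_on (mdom f) \<Delta> \<and> countable \<Delta> \<and> computable_with_advice f \<alpha> \<beta> \<Delta>}.
        ecard \<Delta>)"

text \<open>The sequence \<open>n\<close> is encoded in unary: \<open>n 0\<close> times \<^term>\<open>True\<close>, then \<^term>\<open>False\<close>,
  then \<open>n 1\<close> times \<^term>\<open>True\<close>, then \<^term>\<open>False\<close>, and so on.\<close>

definition encodes_seq :: "inf_word \<Rightarrow> (nat \<Rightarrow> nat) \<Rightarrow> bool" where
  "encodes_seq p n \<longleftrightarrow>
     (\<forall>k. (\<forall>i<n k. p ((\<Sum>j<k. Suc (n j)) + i)) \<and> \<not> p ((\<Sum>j<k. Suc (n j)) + n k))"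

definition rat_of_triple :: "nat \<Rightarrow> nat \<Rightarrow> nat \<Rightarrow> rat" where
  "rat_of_triple a b c = (of_nat a - of_nat b) / of_nat (Suc c)"

text \<open>The Cauchy representation: three consecutive numbers encode one rational.\<close>

definition rho :: "real representation" where
  "rho p x \<longleftrightarrow>
     (\<exists>n. encodes_seq p n \<and>
        (\<forall>k. \<bar>x - of_rat (rat_of_triple (n (3*k)) (n (3*k+1)) (n (3*k+2)))\<bar> \<le> 1 / 2 ^ k))"

text \<open>Tuples of length \<open>k\<close> are represented by interleaving \<open>k\<close> names; only the values of \<open>x\<close>
  below \<open>k\<close> matter.\<close>

definition rho_pow :: "nat \<Rightarrow> (nat \<Rightarrow> real) representation" where
  "rho_pow k p x \<longleftrightarrow> (\<forall>i<k. rho (\<lambda>m. p (k * m + i)) (x i))"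


section \<open>Symmetric matrices and bases of eigenvectors\<close>

text \<open>The \<open>i\<close>-th vector of a tuple \<open>w\<close> is \<open>w $ i\<close>.\<close>

type_synonym 'n sq_matrix = "real^'n^'n"
type_synonym 'n vec_tuple = "(real^'n)^'n"

definition rank_of :: "'n::{finite,linorder} \<Rightarrow> nat" where
  "rank_of i = card {..<i}"

text \<open>The entries \<open>(i, j)\<close> with \<open>i \<le> j\<close> are enumerated column by column.\<close>

definition upper_index :: "'n::{finite,linorder} \<Rightarrow> 'n \<Rightarrow> nat" where
  "upper_index i j = rank_of j * (rank_of j + 1) div 2 + rank_of i"

definition sym_matrix_rep :: "'n::{finite,linorder} sq_matrix representation" where
  "sym_matrix_rep p A \<longleftrightarrow>
     transpose A = A \<and>
     (\<exists>x. rho_pow (CARD('n) * (CARD('n) + 1) div 2) p x \<and>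
          (\<forall>i j. i \<le> j \<longrightarrow> A $ i $ j = x (upper_index i j)))"

definition tuple_rep :: "'n::{finite,linorder} vec_tuple representation" where
  "tuple_rep p w \<longleftrightarrow>
     (\<exists>x. rho_pow (CARD('n) * CARD('n)) p x \<and>
          (\<forall>i j. w $ i $ j = x (CARD('n) * rank_of i + rank_of j)))"

definition eigenvector :: "'n::finite sq_matrix \<Rightarrow> real^'n \<Rightarrow> bool" where
  "eigenvector A v \<longleftrightarrow> v \<noteq> 0 \<and> (\<exists>c. A *v v = c *\<^sub>R v)"

definition basis_tuple :: "'n::finite vec_tuple \<Rightarrow> bool" where
  "basis_tuple w \<longleftrightarrow>
     inj (\<lambda>i. w $ i) \<and> independent (range (\<lambda>i. w $ i)) \<and> span (range (\<lambda>i. w $ i)) = UNIV"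

definition Diag :: "('n::finite sq_matrix, 'n vec_tuple) multimap" where
  "Diag A = (if transpose A = A then {w. basis_tuple w \<and> (\<forall>i. eigenvector A (w $ i))} else {})"


section \<open>Well-definedness of the representations\<close>

lemma rank_of_bij: "bij_betw rank_of (UNIV :: 'n::{finite,linorder} set) {..<CARD('n)}"
proof -
  have mono: "rank_of i < rank_of j" if "i < j" for i j :: 'n
    unfolding rank_of_def by (rule psubset_card_mono) (use that in auto)
  have inj: "inj (rank_of :: 'n \<Rightarrow> nat)"
    by (rule injI) (metis mono less_irrefl linorder_neqE)
  have "rank_of i < CARD('n)" for i :: 'n
    unfolding rank_of_def by (rule psubset_card_mono) auto
  then have "range (rank_of :: 'n \<Rightarrow> nat) \<subseteq> {..<CARD('n)}" by auto
  moreover have "card (range (rank_of :: 'n \<Rightarrow> nat)) = CARD('n)"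
    using inj by (simp add: card_image)
  ultimately have "range (rank_of :: 'n \<Rightarrow> nat) = {..<CARD('n)}"
    by (simp add: card_subset_eq)
  with inj show ?thesis by (simp add: bij_betw_def)
qed

lemma rank_of_less_iff: "rank_of i < rank_of j \<longleftrightarrow> i < (j :: 'n::{finite,linorder})"
proof -
  have mono: "rank_of i < rank_of j" if "i < j" for i j :: 'n
    unfolding rank_of_def by (rule psubset_card_mono) (use that in auto)
  show ?thesis
    by (metis mono less_asym less_irrefl linorder_neqE)
qed

lemma triangular_mono: "a < b \<Longrightarrow> a * (a + 1) div 2 + a < b * (b + 1) div (2::nat)"
proof (induction b)
  case (Suc b)
  have "Suc b * (Suc b + 1) div 2 = b * (b + 1) div 2 + Suc b"
  proof -
    have "Suc b * (Suc b + 1) = b * (b + 1) + 2 * Suc b" by simp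
    then show ?thesis by simp
  qed
  with Suc show ?case by (cases "a = b") auto
qed simp

lemma upper_index_bij:
  "bij_betw (\<lambda>(i, j). upper_index i j) {(i, j). i \<le> (j :: 'n::{finite,linorder})}
     {..<CARD('n) * (CARD('n) + 1) div 2}"
proof -
  let ?r = "rank_of :: 'n \<Rightarrow> nat"
  let ?f = "\<lambda>(i, j). upper_index i (j::'n)"
  let ?U = "{(i, j). i \<le> (j::'n)}"
  have le: "?r i \<le> ?r j" if "i \<le> j" for i j
    using that rank_of_less_iff[of j i] by (meson not_le)
  have lt: "upper_index i j < upper_index k l" if "i \<le> j" "j < l" for i j k l :: 'n
    using triangular_mono[of "?r j" "?r l"] le[OF that(1)] that(2)
    by (simp add: upper_index_def rank_of_less_iff)
  have rinj: "i = k" if "?r i = ?r k" for i k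
    using that rank_of_bij by (metis bij_betw_def injD)
  have inj: "inj_on ?f ?U"
  proof (rule inj_onI, clarify)
    fix i j k l :: 'n
    assume a: "i \<le> j" "k \<le> l" "upper_index i j = upper_index k l"
    then have "j = l" using lt[of i j l k] lt[of k l j i] by (metis less_irrefl linorder_neqE)
    with a show "i = k \<and> j = l" using rinj by (simp add: upper_index_def)
  qed
  have "?f ` ?U \<subseteq> {..<CARD('n) * (CARD('n) + 1) div 2}"
  proof clarify
    fix i j :: 'n assume "i \<le> j"
    moreover have "?r j < CARD('n)" using rank_of_bij[where 'n='n] by (auto simp: bij_betw_def)
    ultimately show "upper_index i j < CARD('n) * (CARD('n) + 1) div 2"
      using triangular_mono[of "?r j" "CARD('n)"] le[of i j] by (simp add: upper_index_def)
  qed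
  moreover have "card ?U = CARD('n) * (CARD('n) + 1) div 2"
  proof -
    have "?U = (SIGMA j:UNIV. {..j})\<inverse>" by auto
    then have "card ?U = card (SIGMA j:(UNIV::'n set). {..j})"
      by (metis card_inverse)
    also have "\<dots> = (\<Sum>j::'n\<in>UNIV. card {..j})" by simp
    also have "\<dots> = (\<Sum>j::'n\<in>UNIV. Suc (?r j))"
    proof (rule sum.cong)
      fix j :: 'n
      have "{..j} = insert j {..<j}" by auto
      then show "card {..j} = Suc (?r j)" by (simp add: rank_of_def)
    qed simp
    also have "\<dots> = (\<Sum>k<CARD('n). Suc k)"
      using sum.reindex_bij_betw[OF rank_of_bij[where 'n='n], of Suc] by simp
    also have "\<dots> = CARD('n) * (CARD('n) + 1) div 2"
    proof -
      have "(\<Sum>k<m. Suc k) = m * (m + 1) div 2" for m :: nat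
      proof (induction m)
        case (Suc m)
        have "Suc m * (Suc m + 1) = m * (m + 1) + 2 * Suc m" by simp
        with Suc show ?case by simp
      qed simp
      then show ?thesis .
    qed
    finally show ?thesis .
  qed
  then have "card (?f ` ?U) = card {..<CARD('n) * (CARD('n) + 1) div 2}"
    using card_image[OF inj] by simp
  ultimately have "?f ` ?U = {..<CARD('n) * (CARD('n) + 1) div 2}"
    by (intro card_subset_eq) auto
  with inj show ?thesis by (simp add: bij_betw_def)
qed

lemma encodes_seq_unique:
  assumes "encodes_seq p n" "encodes_seq p m"
  shows "n = m"
proof
  fix k show "n k = m k"
  proof (induction k rule: less_induct)
    case (less k)
    then have s: "(\<Sum>j<k. Suc (n j)) = (\<Sum>j<k. Suc (m j))" by simp
    show ?case
      using assms unfolding encodes_seq_def by (metis s linorder_neqE_nat)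
  qed
qed

lemma rho_unique:
  assumes "rho p x" "rho p y"
  shows "x = y"
proof -
  from assms obtain n where n: "encodes_seq p n"
    "\<And>k. \<bar>x - of_rat (rat_of_triple (n (3*k)) (n (3*k+1)) (n (3*k+2)))\<bar> \<le> 1 / 2 ^ k"
    "\<And>k. \<bar>y - of_rat (rat_of_triple (n (3*k)) (n (3*k+1)) (n (3*k+2)))\<bar> \<le> 1 / 2 ^ k"
    unfolding rho_def using encodes_seq_unique by metis
  have b: "\<bar>x - y\<bar> \<le> 2 * (1/2) ^ k" for k
    using n(2,3)[of k] by (simp add: power_one_over)
  have "(\<lambda>k. 2 * (1/2::real) ^ k) \<longlonglongrightarrow> 2 * 0"
    by (intro tendsto_mult tendsto_const LIMSEQ_power_zero) simp
  then have "\<bar>x - y\<bar> \<le> 2 * 0"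
    by (rule LIMSEQ_le_const) (use b in blast)
  then show ?thesis by simp
qed

lemma sym_matrix_rep_unique:
  assumes "sym_matrix_rep p A" "sym_matrix_rep p B"
  shows "A = B"
proof -
  have *: "A $ i $ j = B $ i $ j" if "i \<le> j" for i j
  proof -
    have "upper_index i j < CARD('a) * (CARD('a) + 1) div 2"
      using upper_index_bij[where 'n='a] that unfolding bij_betw_def by fastforce
    with assms that show ?thesis
      unfolding sym_matrix_rep_def rho_pow_def by (metis rho_unique)
  qed
  have sym: "A $ i $ j = A $ j $ i" "B $ i $ j = B $ j $ i" for i j
    using assms unfolding sym_matrix_rep_def by (metis transpose_def vec_lambda_beta)+
  show ?thesis
    unfolding vec_eq_iff using * sym by (metis linear)
qed

lemma encodes_seq_exists: "\<exists>p. encodes_seq p n"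
proof -
  define s where "s k = (\<Sum>j<k. Suc (n j))" for k
  have suc: "s (Suc k) = s k + n k + 1" for k by (simp add: s_def)
  have mono: "s k \<le> s l" if "k \<le> l" for k l
    unfolding s_def by (rule sum_mono2) (use that in auto)
  define p where "p i \<longleftrightarrow> (\<exists>k. s k \<le> i \<and> i < s k + n k)" for i
  have "\<not> p (s k + n k)" for k
  proof
    assume "p (s k + n k)"
    then obtain l where l: "s l \<le> s k + n k" "s k + n k < s l + n l" unfolding p_def by blast
    have "l \<noteq> k" using l by auto
    then consider "Suc l \<le> k" | "Suc k \<le> l" by linarith
    then show False
      using mono[of "Suc l" k] mono[of "Suc k" l] suc[of l] suc[of k] l by cases auto
  qed
  moreover have "p (s k + i)" if "i < n k" for k i
    unfolding p_def using that by (intro exI[of _ k]) auto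
  ultimately show ?thesis unfolding encodes_seq_def s_def by blast
qed

lemma rat_of_triple_surj: "\<exists>a b c. rat_of_triple a b c = q"
proof -
  obtain u v where q: "q = Fract u v" "v > 0" by (cases q) auto
  have "rat_of_triple (nat u) (nat (- u)) (nat v - 1) = q"
  proof (cases "u \<ge> 0")
    case True
    then show ?thesis using q by (simp add: rat_of_triple_def Fract_of_int_quotient)
  next
    case False
    then show ?thesis using q by (simp add: rat_of_triple_def Fract_of_int_quotient)
  qed
  then show ?thesis by blast
qed

lemma rho_surj: "\<exists>p. rho p x"
proof -
  have "\<exists>t :: nat \<times> nat \<times> nat.
      \<bar>x - of_rat (case t of (a, b, c) \<Rightarrow> rat_of_triple a b c)\<bar> \<le> 1 / 2 ^ k" for k :: nat
  proof -
    have "x < x + 1 / 2 ^ k" by simp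
    then obtain q where q: "x < of_rat q" "of_rat q < x + 1 / 2 ^ k"
      using of_rat_dense by blast
    obtain a b c where "rat_of_triple a b c = q" using rat_of_triple_surj by blast
    with q show ?thesis by (intro exI[of _ "(a, b, c)"]) auto
  qed
  then obtain t :: "nat \<Rightarrow> nat \<times> nat \<times> nat" where
    t: "\<And>k. \<bar>x - of_rat (case t k of (a, b, c) \<Rightarrow> rat_of_triple a b c)\<bar> \<le> 1 / 2 ^ k"
    by metis
  define n where "n m = (let (a, b, c) = t (m div 3) in
    if m mod 3 = 0 then a else if m mod 3 = 1 then b else c)" for m
  have d: "(3 * k + 2) mod 3 = (2::nat)" "(3 * k + 2) div 3 = k" for k :: nat by presburger+
  have d1: "(3 * k + 1) mod 3 = (1::nat)" "(3 * k + 1) div 3 = k" for k :: nat by presburger+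
  have "rat_of_triple (n (3*k)) (n (3*k+1)) (n (3*k+2)) =
      (case t k of (a, b, c) \<Rightarrow> rat_of_triple a b c)" for k
    unfolding n_def d d1 by (cases "t k") simp
  moreover obtain p where "encodes_seq p n" using encodes_seq_exists by blast
  ultimately have "rho p x" unfolding rho_def using t by metis
  then show ?thesis by blast
qed

lemma rho_pow_surj: "\<exists>p. rho_pow k p x"
proof -
  have "\<forall>i. \<exists>q. rho q (x i)" using rho_surj by blast
  then obtain P where P: "\<And>i. rho (P i) (x i)" using choice[of "\<lambda>i q. rho q (x i)"] by blast
  define p where "p m = P (m mod k) (m div k)" for m
  have "(\<lambda>m. p (k * m + i)) = P i" if "i < k" for i
    using that by (auto simp: p_def fun_eq_iff)
  with P have "rho_pow k p x" unfolding rho_pow_def by simp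
  then show ?thesis by blast
qed

lemma sym_matrix_rep_surj:
  assumes "transpose A = A"
  shows "\<exists>p. sym_matrix_rep p A"
proof -
  let ?f = "\<lambda>(i, j). upper_index i (j::'a)"
  let ?U = "{(i, j). i \<le> (j::'a)}"
  define x where "x = (\<lambda>(i, j). A $ i $ j) \<circ> inv_into ?U ?f"
  have "A $ i $ j = x (upper_index i j)" if "i \<le> j" for i j
    using inv_into_f_f[of ?f ?U "(i, j)"] upper_index_bij[where 'n='a] that
    by (simp add: x_def bij_betw_def)
  moreover obtain p where "rho_pow (CARD('a) * (CARD('a) + 1) div 2) p x"
    using rho_pow_surj by blast
  ultimately have "sym_matrix_rep p A"
    unfolding sym_matrix_rep_def using assms by blast
  then show ?thesis by blast
qed

lemma tuple_index_less:
  "CARD('n) * rank_of i + rank_of j < CARD('n) * CARD('n)" for i j :: "'n::{finite,linorder}"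
proof -
  have r: "rank_of i < CARD('n)" "rank_of j < CARD('n)"
    using rank_of_bij[where 'n='n] by (auto simp: bij_betw_def)
  have "CARD('n) * rank_of i + rank_of j < CARD('n) * Suc (rank_of i)" using r by simp
  also have "\<dots> \<le> CARD('n) * CARD('n)" using r by (intro mult_le_mono2) simp
  finally show ?thesis .
qed

lemma tuple_rep_unique:
  assumes "tuple_rep p v" "tuple_rep p w"
  shows "v = w"
  using assms tuple_index_less unfolding tuple_rep_def rho_pow_def vec_eq_iff
  by (metis rho_unique)

lemma tuple_rep_surj: "\<exists>p. tuple_rep p (w :: 'n::{finite,linorder} vec_tuple)"
proof -
  let ?r = "rank_of :: 'n \<Rightarrow> nat"
  define x where "x m = w $ inv ?r (m div CARD('n)) $ inv ?r (m mod CARD('n))" for m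
  have r: "?r i < CARD('n)" "inv ?r (?r i) = i" for i
    using rank_of_bij[where 'n='n] by (auto simp: bij_betw_def)
  have "w $ i $ j = x (CARD('n) * ?r i + ?r j)" for i j
    unfolding x_def by (simp add: r)
  moreover obtain p where "rho_pow (CARD('n) * CARD('n)) p x" using rho_pow_surj by blast
  ultimately have "tuple_rep p w" unfolding tuple_rep_def by blast
  then show ?thesis by blast
qed

end

theory Submission
  imports Defs
begin

text \<open>Lower bound: starting from the zero matrix, add \<open>d - 1\<close> times a small multiple of \<open>e e\<^sup>T\<close> for a vector
  \<open>e\<close> of the current kernel. If \<open>Diag\<close> is continuous on the piece of the current matrix, with witness \<open>w\<close>,
  and \<open>e\<close> is not parallel to any vector of \<open>w\<close>, then all matrices near the new one have no eigenbasis
  near \<open>w\<close> and so avoid this piece; thus the \<open>d\<close> matrices obtained lie in different pieces. A computable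
  mapping is continuous, since each prefix of the output depends on a prefix of the input only.

  Upper bound: the advice is the number \<open>k\<close> of distinct eigenvalues. The machine searches for rational vectors
  \<open>v i\<close> and numbers \<open>\<mu> i\<close> such that \<open>A v i - \<mu> i v i\<close> is small compared to the gaps between the \<open>\<mu> i\<close>, of which
  there are exactly \<open>k\<close>. Then \<open>A\<close> has exactly one eigenvalue close to each value of \<open>\<mu>\<close>, and \<open>v i\<close> is close to
  its projection to the corresponding eigenspace. Starting from a nearly orthonormal tuple, each such tuple is
  refined near the eigenvectors that it approximates, and the limit is a basis of eigenvectors.\<close>

section \<open>Eigenbases of symmetric matrices\<close>

text \<open>The bounds meet through \<open>Ct\<close> \<le> \<open>Cc\<close>: the lower bound is
  needed for \<open>Ct\<close> only, the machine for \<open>Cc\<close> only.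

  The obstacle in the upper bound is that written output cannot be revised while equality of reals
  is undecidable. No finite precision alone shows that two close approximate eigenvalues belong to
  one eigenvalue; knowing that there are exactly \<open>k\<close> eigenvalues and seeing
  \<open>k\<close> well separated approximations settles it. Moreover, a tuple that is partly
  written must stay refinable. Therefore the test of a candidate certifies exact eigenvectors nearby
  (\<open>admissible_sound\<close>), and these are the target that lets the next round succeed
  (\<open>admissible_exists_Suc\<close>). The tolerance of the Gram matrix grows with the round
  \<open>j\<close> as \<open>(2 - 1 / 2 ^ j) / (4 * d)\<close>, which absorbs each displacement and
  stays below \<open>1 / (2 * d)\<close>, enough for independence in the limit.

  The unbounded search is spread over the stages of one endless loop; a stage tries one candidate or
  emits one bit. So only primitive recursive functionals with oracle access to the input have to be
  compiled.\<close>

lemma inner_matrix_commute: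
  fixes A :: "real^'n^'n"
  assumes "transpose A = A"
  shows "inner (A *v x) y = inner x (A *v y)"
  using dot_lmul_matrix[of x A y] assms by (simp add: transpose_matrix_vector[symmetric])

text \<open>Vanishing of a first derivative at a minimum, for quadratics; it supplies the first
  variation at the maximum of the Rayleigh quotient.\<close>

lemma linear_coeff_zero:
  fixes b c :: real
  assumes "\<And>t. 0 \<le> t * b + t^2 * c"
  shows "b = 0"
proof (rule ccontr)
  assume b: "b \<noteq> 0"
  \<comment> \<open>As \<open>k\<close> exceeds \<open>\<bar>c\<bar>\<close>, the linear term at
    \<open>t = - b / k\<close> outweighs the quadratic one.\<close>
  define k where "k = \<bar>c\<bar> + 1"
  define t where "t = - b / k"
  have k: "k > 0" by (simp add: k_def)
  then have tk: "t * k = - b" by (simp add: t_def)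
  have "(t * b + t\<^sup>2 * \<bar>c\<bar>) * k\<^sup>2 = (t * k) * b * k + (t * k)\<^sup>2 * \<bar>c\<bar>"
    by (simp add: power2_eq_square algebra_simps)
  also have "\<dots> = - b\<^sup>2" unfolding tk by (simp add: k_def power2_eq_square algebra_simps)
  finally have "(t * b + t\<^sup>2 * \<bar>c\<bar>) * k\<^sup>2 < 0" using b by simp
  then have "t * b + t\<^sup>2 * \<bar>c\<bar> < 0" by (simp add: mult_less_0_iff)
  moreover have "t * b + t\<^sup>2 * c \<le> t * b + t\<^sup>2 * \<bar>c\<bar>" by (simp add: mult_left_mono)
  ultimately show False using assms[of t] by simp
qed

text \<open>A maximizer of the Rayleigh quotient on the unit sphere of \<open>S\<close> works: its
  first variation vanishes in all directions of \<open>S\<close>, and invariance of \<open>S\<close>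
  puts the residual \<open>c *\<^sub>R v - A *v v\<close> itself among these directions.\<close>

lemma symmetric_eigenvector_in_subspace:
  fixes A :: "real^'n^'n"
  assumes sym: "transpose A = A" and S: "subspace S" "\<And>x. x \<in> S \<Longrightarrow> A *v x \<in> S" "x0 \<in> S" "x0 \<noteq> 0"
  obtains v c where "v \<in> S" "norm v = 1" "A *v v = c *\<^sub>R v"
proof -
  let ?K = "S \<inter> sphere 0 1"
  have cpt: "compact ?K" using closed_subspace[OF S(1)] by (intro closed_Int_compact) auto
  have ne: "?K \<noteq> {}"
  proof -
    have "(1 / norm x0) *\<^sub>R x0 \<in> ?K" using S by (simp add: subspace_scale)
    then show ?thesis by blast
  qed
  have "continuous_on ?K (\<lambda>x. inner x (A *v x))"
    by (intro continuous_intros matrix_vector_mult_linear_continuous_on)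
  then obtain v where v: "v \<in> ?K" "\<And>x. x \<in> ?K \<Longrightarrow> inner x (A *v x) \<le> inner v (A *v v)"
    using continuous_attains_sup[OF cpt ne] by blast
  define c where "c = inner v (A *v v)"
  have le: "inner x (A *v x) \<le> c * inner x x" if "x \<in> S" for x
  proof (cases "x = 0")
    case False
    let ?y = "(1 / norm x) *\<^sub>R x"
    have "?y \<in> ?K" using that S(1) False by (simp add: subspace_scale)
    then have "inner ?y (A *v ?y) \<le> c" unfolding c_def by (rule v(2))
    then have "inner x (A *v x) / (norm x)\<^sup>2 \<le> c"
      by (simp add: matrix_vector_mult_scaleR power2_eq_square)
    then show ?thesis using False by (simp add: divide_le_eq power2_norm_eq_inner)
  qed simp
  have vS: "v \<in> S" and nv: "norm v = 1" using v(1) by auto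
  have orth: "inner (c *\<^sub>R v - A *v v) u = 0" if u: "u \<in> S" for u
  proof -
    have "0 \<le> t * (2 * inner (c *\<^sub>R v - A *v v) u) + t\<^sup>2 * (c * inner u u - inner u (A *v u))" for t
    proof -
      have "v + t *\<^sub>R u \<in> S" using vS u S(1) by (simp add: subspace_add subspace_scale)
      from le[OF this] have "0 \<le> c * inner (v + t *\<^sub>R u) (v + t *\<^sub>R u) - inner (v + t *\<^sub>R u) (A *v (v + t *\<^sub>R u))"
        by simp
      also have "\<dots> = (c * inner v v - inner v (A *v v)) + t * (2 * c * inner v u - inner u (A *v v) - inner v (A *v u))
          + t\<^sup>2 * (c * inner u u - inner u (A *v u))"
        by (simp add: matrix_vector_right_distrib matrix_vector_mult_scaleR inner_add_left inner_add_right
            inner_commute[of u v] ring_distribs power2_eq_square)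
      also have "inner v (A *v u) = inner (A *v v) u" using inner_matrix_commute[OF sym] by simp
      also have "c * inner v v - inner v (A *v v) = 0"
        using nv by (simp add: c_def norm_eq_1)
      also have "2 * c * inner v u - inner u (A *v v) - inner (A *v v) u = 2 * inner (c *\<^sub>R v - A *v v) u"
        by (simp add: inner_diff_left inner_commute[of u "A *v v"])
      finally show ?thesis by simp
    qed
    then have "2 * inner (c *\<^sub>R v - A *v v) u = 0" by (rule linear_coeff_zero)
    then show ?thesis by simp
  qed
  have "c *\<^sub>R v - A *v v \<in> S" using vS S by (simp add: subspace_diff subspace_scale)
  from orth[OF this] have "A *v v = c *\<^sub>R v" by simp
  with vS nv that show thesis by blast
qed

text \<open>A maximal orthonormal set of eigenvectors spans the space: its orthogonal complement is
  invariant because \<open>A\<close> is symmetric, so a nonzero complement would contain a further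
  eigenvector.\<close>

theorem symmetric_orthonormal_eigenbasis:
  fixes A :: "real^'n^'n"
  assumes sym: "transpose A = A"
  shows "\<exists>(w :: real^'n^'n) c. (\<forall>i. A *v w $ i = c i *\<^sub>R w $ i) \<and>
    (\<forall>i j. inner (w $ i) (w $ j) = (if i = j then 1 else 0))"
proof -
  define P where "P B \<longleftrightarrow> finite B \<and> pairwise orthogonal B \<and> (\<forall>b\<in>B. norm b = 1 \<and> (\<exists>c. A *v b = c *\<^sub>R b))"
    for B :: "(real^'n) set"
  have ind: "independent B" if "P B" for B
    using that unfolding P_def by (intro pairwise_orthogonal_independent) auto
  then have bound: "card B \<le> CARD('n)" if "P B" for B
    using independent_bound[OF ind[OF that]] by simp
  have "P {}" by (simp add: P_def)
  then obtain B where B: "P B" "\<And>B'. P B' \<Longrightarrow> card B' \<le> card B"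
    using ex_has_greatest_nat[of P "{}" card "Suc CARD('n)"] bound by (metis le_imp_less_Suc)
  let ?S = "{x. \<forall>b\<in>B. inner b x = 0}"
  have S0: "x = 0" if xS: "x \<in> ?S" for x
  proof (rule ccontr)
    assume x: "x \<noteq> 0"
    have sub: "subspace ?S" by (auto simp: subspace_def inner_add_right)
    have inv: "A *v y \<in> ?S" if "y \<in> ?S" for y
    proof -
      have "inner b (A *v y) = 0" if b: "b \<in> B" for b
      proof -
        obtain c where "A *v b = c *\<^sub>R b" using B(1) b unfolding P_def by blast
        then have "inner b (A *v y) = c * inner b y"
          using inner_matrix_commute[OF sym, of b y] by simp
        then show ?thesis using \<open>y \<in> ?S\<close> b by simp
      qed
      then show ?thesis by simp
    qed
    obtain v c where v: "v \<in> ?S" "norm v = 1" "A *v v = c *\<^sub>R v"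
      using symmetric_eigenvector_in_subspace[OF sym sub inv xS x] .
    have "v \<notin> B" using v by auto
    moreover have "P (insert v B)"
      using B(1) v unfolding P_def by (auto simp: pairwise_insert orthogonal_def inner_commute)
    ultimately show False using B(2)[of "insert v B"] B(1) by (simp add: P_def)
  qed
  have "span B = UNIV"
  proof (rule ccontr)
    assume "span B \<noteq> UNIV"
    then have "dim B < DIM(real^'n)" using dim_eq_full[of B] dim_subset_UNIV[of B] by linarith
    then obtain x where "x \<noteq> 0" "\<And>y. y \<in> span B \<Longrightarrow> orthogonal x y"
      using orthogonal_to_subspace_exists by blast
    with S0[of x] show False by (simp add: orthogonal_def inner_commute span_base)
  qed
  then have "card B = CARD('n)"
    using ind[OF B(1)] B(1) by (metis DIM_cart DIM_real dim_UNIV dim_span_eq_card_independent mult.right_neutral)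
  then obtain h where h: "bij_betw h (UNIV :: 'n set) B"
    using finite_same_card_bij[of "UNIV :: 'n set" B] B(1) by (auto simp: P_def)
  have hB: "h i \<in> B" for i using h by (auto simp: bij_betw_def)
  have "\<exists>c. A *v h i = c *\<^sub>R h i" for i using hB B(1) unfolding P_def by blast
  then obtain c where c: "\<And>i. A *v h i = c i *\<^sub>R h i" by metis
  have "inner (h i) (h j) = (if i = j then 1 else 0)" for i j
  proof (cases "i = j")
    case True
    then show ?thesis using hB[of j] B(1) by (simp add: P_def norm_eq_1)
  next
    case False
    then have "h i \<noteq> h j" using h by (auto simp: bij_betw_def inj_def)
    then show ?thesis using hB B(1) False by (auto simp: P_def pairwise_def orthogonal_def)
  qed
  with c show ?thesis by (intro exI[of _ "\<chi> i. h i"] exI[of _ c]) simp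
qed

text \<open>The vectors span iff the orthogonal complement of their span is trivial, and
  \<open>CARD('n)\<close> spanning vectors are distinct and independent by counting.\<close>

lemma basis_tuple_iff_kernel:
  fixes w :: "real^'n^'n"
  shows "basis_tuple w \<longleftrightarrow> (\<forall>x. (\<forall>i. inner (w $ i) x = 0) \<longrightarrow> x = 0)"
proof
  assume w: "basis_tuple w"
  show "\<forall>x. (\<forall>i. inner (w $ i) x = 0) \<longrightarrow> x = 0"
  proof (intro allI impI)
    fix x assume x: "\<forall>i. inner (w $ i) x = 0"
    have "x \<in> span (range (\<lambda>i. w $ i))" using w unfolding basis_tuple_def by blast
    then have "orthogonal x x"
      by (rule orthogonal_to_span) (use x in \<open>auto simp: orthogonal_def inner_commute\<close>)
    then show "x = 0" by (simp add: orthogonal_def)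
  qed
next
  assume k: "\<forall>x. (\<forall>i. inner (w $ i) x = 0) \<longrightarrow> x = 0"
  let ?R = "range (\<lambda>i. w $ i)"
  have d: "dim ?R = CARD('n)"
  proof (rule ccontr)
    assume "dim ?R \<noteq> CARD('n)"
    then have "dim ?R < DIM(real^'n)"
      using dim_subset_UNIV[of ?R] by simp
    then obtain x where "x \<noteq> 0" "\<And>y. y \<in> span ?R \<Longrightarrow> orthogonal x y"
      using orthogonal_to_subspace_exists[of ?R] by blast
    with k show False by (metis orthogonal_def inner_commute rangeI span_base)
  qed
  then have sp: "span ?R = UNIV" using dim_eq_full[of ?R] by simp
  have le: "card ?R \<le> CARD('n)" by (metis card_image_le finite)
  have "CARD('n) \<le> card ?R" using dim_le_card'[of ?R] d by simp
  with le have c: "card ?R = CARD('n)" by simp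
  then have "inj (\<lambda>i. w $ i)" by (simp add: eq_card_imp_inj_on)
  moreover have "independent ?R"
    by (rule card_le_dim_spanning[of ?R UNIV]) (use sp c in auto)
  ultimately show "basis_tuple w" using sp by (simp add: basis_tuple_def)
qed

text \<open>The determinant shows that being a basis is an open condition (used in
  \<open>leave_piece\<close>) and that it is invariant under transposition (used in
  \<open>gram_imp_basis_tuple\<close>).\<close>

lemma basis_tuple_iff_det:
  fixes w :: "real^'n^'n"
  shows "basis_tuple w \<longleftrightarrow> det w \<noteq> 0"
proof -
  have "det w \<noteq> 0 \<longleftrightarrow> (\<exists>B. B ** w = mat 1)"
    by (metis invertible_det_nz invertible_left_inverse)
  also have "\<dots> \<longleftrightarrow> (\<forall>x. w *v x = 0 \<longrightarrow> x = 0)" by (rule matrix_left_invertible_ker)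
  also have "\<dots> \<longleftrightarrow> basis_tuple w"
    unfolding basis_tuple_iff_kernel by (simp add: vec_eq_iff matrix_vector_mul_component)
  finally show ?thesis by simp
qed

text \<open>The second part is Parseval's identity. Both follow since a matrix with orthonormal rows
  has its transpose as a two-sided inverse.\<close>

lemma orthonormal_imp_basis_tuple:
  fixes w :: "real^'n^'n"
  assumes "\<And>i j. inner (w $ i) (w $ j) = (if i = j then 1 else 0)"
  shows "basis_tuple w" "(norm x)\<^sup>2 = (\<Sum>i\<in>UNIV. (inner (w $ i) x)\<^sup>2)"
proof -
  have "w ** transpose w = mat 1"
    using assms by (simp add: vec_eq_iff matrix_matrix_mult_def transpose_def mat_def inner_vec_def)
  then have tw: "transpose w ** w = mat 1" by (rule matrix_left_right_inverse[THEN iffD1])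
  have wx: "(w *v x) $ i = inner (w $ i) x" for x i by (simp add: matrix_vector_mul_component)
  have *: "inner (w *v x) (w *v x) = inner x x" for x
  proof -
    have "inner (w *v x) (w *v x) = inner x (transpose w *v (w *v x))"
      using dot_lmul_matrix[of "w *v x" w x] by (simp add: inner_commute)
    then show ?thesis using tw by (simp add: matrix_vector_mul_assoc)
  qed
  show "(norm x)\<^sup>2 = (\<Sum>i\<in>UNIV. (inner (w $ i) x)\<^sup>2)" for x
    unfolding power2_norm_eq_inner using *[of x] by (simp add: inner_vec_def[of "w *v x"] wx power2_eq_square)
  show "basis_tuple w"
    unfolding basis_tuple_iff_kernel
  proof (intro allI impI)
    fix x assume "\<forall>i. inner (w $ i) x = 0"
    then have "w *v x = 0" by (simp add: vec_eq_iff wx)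
    then show "x = 0" using *[of x] by simp
  qed
qed

lemma mdom_Diag: "mdom (Diag :: ('n::finite sq_matrix, 'n vec_tuple) multimap) = {A. transpose A = A}"
proof -
  have "Diag A \<noteq> {}" if A: "transpose A = A" for A :: "'n sq_matrix"
  proof -
    obtain w :: "'n vec_tuple" and c where w: "\<And>i. A *v w $ i = c i *\<^sub>R w $ i"
        "\<And>i j. inner (w $ i) (w $ j) = (if i = j then 1 else (0::real))"
      using symmetric_orthonormal_eigenbasis[OF A] by metis
    have "basis_tuple w" by (rule orthonormal_imp_basis_tuple(1)[OF w(2)])
    moreover have "w $ i \<noteq> 0" for i using w(2)[of i i] by (metis inner_zero_left zero_neq_one)
    ultimately have "w \<in> Diag A" using A w(1) by (auto simp: Diag_def eigenvector_def)
    then show ?thesis by blast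
  qed
  then show ?thesis by (auto simp: mdom_def Diag_def)
qed

definition spectrum :: "real^'n^'n \<Rightarrow> real set" where
  "spectrum A = {c. \<exists>x. x \<noteq> 0 \<and> A *v x = c *\<^sub>R x}"

text \<open>An eigenvector for \<open>a\<close> is not orthogonal to every \<open>w $ i\<close>, and
  symmetry forces \<open>a\<close> to agree with \<open>c i\<close> wherever the inner product is
  nonzero.\<close>

lemma spectrum_eq_range:
  fixes A :: "real^'n^'n"
  assumes sym: "transpose A = A" and w: "basis_tuple w" "\<And>i. A *v w $ i = c i *\<^sub>R w $ i"
  shows "spectrum A = range c"
proof (intro equalityI subsetI)
  fix a assume "a \<in> spectrum A"
  then obtain x where x: "x \<noteq> 0" "A *v x = a *\<^sub>R x" by (auto simp: spectrum_def)
  then obtain i where i: "inner (w $ i) x \<noteq> 0" using w(1) unfolding basis_tuple_iff_kernel by blast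
  have "c i * inner (w $ i) x = a * inner (w $ i) x"
    using inner_matrix_commute[OF sym, of "w $ i" x] w(2) x(2) by simp
  with i show "a \<in> range c" by auto
next
  fix a assume "a \<in> range c"
  then obtain i where "a = c i" by blast
  moreover have "w $ i \<noteq> 0"
    using w(1) dependent_zero unfolding basis_tuple_def by (metis rangeI)
  ultimately show "a \<in> spectrum A" using w(2) by (auto simp: spectrum_def)
qed

lemma finite_spectrum:
  fixes A :: "real^'n^'n"
  assumes "transpose A = A"
  shows "finite (spectrum A)" "spectrum A \<noteq> {}" "card (spectrum A) \<le> CARD('n)"
proof -
  obtain w where "w \<in> Diag A" using assms mdom_Diag unfolding mdom_def by blast
  then have w: "basis_tuple w" "\<forall>i. \<exists>c. A *v w $ i = c *\<^sub>R w $ i"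
    using assms by (auto simp: Diag_def eigenvector_def)
  from w(2) obtain c where "\<And>i. A *v w $ i = c i *\<^sub>R w $ i" by metis
  with w(1) have "spectrum A = range c" by (rule spectrum_eq_range[OF assms])
  then show "finite (spectrum A)" "spectrum A \<noteq> {}" "card (spectrum A) \<le> CARD('n)"
    by (auto intro: card_image_le)
qed

section \<open>The lower bound\<close>

text \<open>On the line \<open>a + t *\<^sub>R b\<close> through independent \<open>a\<close> and
  \<open>b\<close>, each nonzero \<open>w i\<close> is parallel to at most one point, so only
  finitely many \<open>t\<close> are bad.\<close>

lemma nonparallel_vector:
  fixes W :: "'a::euclidean_space set" and w :: "'i::finite \<Rightarrow> 'a"
  assumes "subspace W" "2 \<le> dim W"
  obtains e where "e \<in> W" "e \<noteq> 0" "\<And>i. w i \<noteq> 0 \<Longrightarrow> w i \<notin> span {e}"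
proof -
  obtain B where B: "B \<subseteq> W" "independent B" "card B = dim W" by (metis basis_exists)
  then obtain a b where ab: "a \<in> B" "b \<in> B" "a \<noteq> b"
    using assms(2) by (metis One_nat_def Suc_1 card_le_Suc0_iff_eq card.infinite not_less_eq_eq zero_le)
  have ind: "\<alpha> = 0 \<and> \<beta> = 0" if "\<alpha> *\<^sub>R a + \<beta> *\<^sub>R b = 0" for \<alpha> \<beta>
  proof -
    have "independent {a, b}" using B(2) ab by (meson independent_mono insert_subset empty_subsetI)
    then have "\<forall>u. (\<Sum>v\<in>{a, b}. u v *\<^sub>R v) = 0 \<longrightarrow> (\<forall>v\<in>{a, b}. u v = 0)"
      using dependent_finite[of "{a, b}"] by auto
    moreover have "(\<Sum>v\<in>{a, b}. (if v = a then \<alpha> else \<beta>) *\<^sub>R v) = 0" using that ab(3) by simp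
    ultimately have "\<forall>v\<in>{a, b}. (if v = a then \<alpha> else \<beta>) = 0"
      by (elim allE[of _ "\<lambda>v. if v = a then \<alpha> else \<beta>"]) simp
    with ab(3) show ?thesis by (metis insertCI)
  qed
  define T where "T i = {t. w i \<in> span {a + t *\<^sub>R b}}" for i
  have fin: "finite (T i)" if "w i \<noteq> 0" for i
  proof -
    have "t = t'" if t: "t \<in> T i" "t' \<in> T i" for t t'
    proof -
      obtain k k' where k: "w i = k *\<^sub>R (a + t *\<^sub>R b)" "w i = k' *\<^sub>R (a + t' *\<^sub>R b)"
        using t by (auto simp: T_def span_singleton)
      then have "(k - k') *\<^sub>R a + (k * t - k' * t') *\<^sub>R b = 0"
        by (simp add: algebra_simps)
      then have "k = k'" "k * t = k' * t'" using ind by fastforce+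
      moreover have "k \<noteq> 0" using k(1) \<open>w i \<noteq> 0\<close> by auto
      ultimately show ?thesis by simp
    qed
    then have "T i = {} \<or> (\<exists>t. T i = {t})" by blast
    then show ?thesis by auto
  qed
  have "finite (\<Union>i\<in>{i. w i \<noteq> 0}. T i)" using fin by auto
  then obtain t where t: "t \<notin> (\<Union>i\<in>{i. w i \<noteq> 0}. T i)"
    using infinite_UNIV_char_0[where 'a = real] by (metis UNIV_eq_I)
  have "a + t *\<^sub>R b \<in> W" using assms(1) B(1) ab by (auto intro: subspace_add subspace_scale)
  moreover have "a + t *\<^sub>R b \<noteq> 0" using ind[of 1 t] by auto
  ultimately show thesis using that[of "a + t *\<^sub>R b"] t by (auto simp: T_def)
qed

text \<open>The rank-one perturbation \<open>z + s e e\<^sup>T\<close> in a kernel direction \<open>e\<close> that is far from all vectors of the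
  witness of continuity at \<open>z\<close> leaves the piece of \<open>z\<close>: all eigenbases of nearby matrices contain a
  vector close to the line through \<open>e\<close>.\<close>

lemma leave_piece:
  fixes z :: "'n::{finite,linorder} sq_matrix"
  assumes sym: "transpose z = z" and ker: "2 \<le> dim {x. z *v x = 0}"
    and U: "open U" "z \<in> U" and D: "z \<in> D" "mcontinuous (mrestrict Diag D)" "D \<subseteq> {A. transpose A = A}"
  obtains y U' where "transpose y = y" "dim {x. z *v x = 0} \<le> Suc (dim {x. y *v x = 0})"
    "open U'" "y \<in> U'" "U' \<subseteq> U" "U' \<inter> D = {}"
proof -
  let ?f = "mrestrict Diag D :: ('n sq_matrix, 'n vec_tuple) multimap"
  have domf: "mdom ?f = D"
    using D(3) mdom_Diag[where 'n = 'n] by (auto simp: mdom_def mrestrict_def)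
  obtain w where w: "w \<in> Diag z" and cont: "\<And>V. open V \<Longrightarrow> w \<in> V \<Longrightarrow>
      \<exists>U. open U \<and> z \<in> U \<and> (\<forall>x\<in>U \<inter> D. ?f x \<inter> V \<noteq> {})"
    using D(1,2) domf unfolding mcontinuous_def mcontinuous_at_def by (auto simp: mrestrict_def)
  have wb: "basis_tuple w" using w sym by (simp add: Diag_def)
  have w0: "w $ i \<noteq> 0" for i using wb dependent_zero unfolding basis_tuple_def by (metis rangeI)
  let ?W = "{x. z *v x = 0}"
  have "subspace ?W" 
    by (simp add: subspace_def matrix_vector_right_distrib matrix_vector_mult_scaleR)
  then obtain e where e: "e \<in> ?W" "e \<noteq> 0" "\<And>i. w $ i \<notin> span {e}"
    using nonparallel_vector[of ?W "\<lambda>i. w $ i"] ker w0 by metis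
  have e2: "inner e e > 0" using e(2) by simp
  \<comment> \<open>An open set around \<open>w\<close> of bases avoiding the line of
    \<open>e\<close>. A closed ball inside it is compact, which later makes a projection
    closed.\<close>
  let ?G = "{v :: 'n vec_tuple. det v \<noteq> 0} \<inter> (\<Inter>i. (\<lambda>v. v $ i) -` (- span {e}))"
  have "open ?G"
  proof (intro open_Int open_INT open_vimage)
    show "open {v :: 'n vec_tuple. det v \<noteq> 0}"
    proof (rule open_Collect_neq)
      show "continuous_on UNIV (\<lambda>v :: 'n vec_tuple. det v)" unfolding det_def by (intro continuous_intros)
    qed simp
  qed (auto intro!: continuous_intros closed_subspace)
  moreover have "w \<in> ?G" using wb e(3) by (simp add: basis_tuple_iff_det)
  ultimately obtain r where r: "r > 0" "cball w r \<subseteq> ?G" by (meson open_contains_cball)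
  obtain Uf where Uf: "open Uf" "z \<in> Uf" "\<And>x. x \<in> Uf \<inter> D \<Longrightarrow> ?f x \<inter> ball w r \<noteq> {}"
    using cont[of "ball w r"] r(1) by auto
  define E :: "'n sq_matrix" where "E = (\<chi> i j. e $ i * e $ j)"
  \<comment> \<open>The division by \<open>inner e e\<close> makes \<open>e\<close> an eigenvector
    of \<open>Y \<kappa>\<close> for the eigenvalue \<kappa>.\<close>
  define Y where "Y \<kappa> = z + (\<kappa> / inner e e) *\<^sub>R E" for \<kappa>
  have Ev: "E *v x = inner e x *\<^sub>R e" for x
    by (simp add: vec_eq_iff E_def matrix_vector_mult_def inner_vec_def sum_distrib_left mult_ac)
  have Yv: "Y \<kappa> *v x = z *v x + (\<kappa> * inner e x / inner e e) *\<^sub>R e" for \<kappa> x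
    by (simp add: Y_def matrix_vector_mult_add_rdistrib scaleR_matrix_vector_assoc[symmetric] Ev)
  have symY: "transpose (Y \<kappa>) = Y \<kappa>" for \<kappa>
    using sym by (simp add: Y_def E_def transpose_def vec_eq_iff mult_ac)
  have contY: "continuous_on UNIV Y"
    unfolding Y_def by (intro continuous_intros) (use e2 in auto)
  let ?O = "Y -` (U \<inter> Uf)"
  have "open ?O" using contY U(1) Uf(1) by (intro open_vimage) auto
  moreover have "0 \<in> ?O" using U(2) Uf(2) by (simp add: Y_def)
  ultimately have "infinite ?O" using finite_imp_not_open by blast
  \<comment> \<open>Infinitely many small \<kappa> remain outside the finite spectrum of
    \<open>z\<close>; for such \<kappa> the eigenspace of \<open>Y \<kappa>\<close> is exactly the
    line of \<open>e\<close>.\<close>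
  then have "infinite (?O - insert 0 (spectrum z))" using finite_spectrum(1)[OF sym] by simp
  then have "?O - insert 0 (spectrum z) \<noteq> {}" by (metis finite.emptyI)
  then obtain \<kappa> where \<kappa>: "Y \<kappa> \<in> U" "Y \<kappa> \<in> Uf" "\<kappa> \<noteq> 0" "\<kappa> \<notin> spectrum z"
    by blast
  let ?y = "Y \<kappa>"
  have ye: "?y *v e = \<kappa> *\<^sub>R e" using e(1) e2 by (simp add: Yv)
  have par: "x \<in> span {e}" if "?y *v x = \<kappa> *\<^sub>R x" for x
  proof -
    define c where "c = inner e x / inner e e"
    define u where "u = x - c *\<^sub>R e"
    have "z *v u = z *v x" using e(1) by (simp add: u_def matrix_vector_mult_diff_distrib matrix_vector_mult_scaleR)
    also have "\<dots> = \<kappa> *\<^sub>R x - (\<kappa> * c) *\<^sub>R e" using that unfolding Yv c_def by (simp add: algebra_simps)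
    finally have "z *v u = \<kappa> *\<^sub>R u" by (simp add: u_def algebra_simps)
    with \<kappa>(4) have "u = 0" by (auto simp: spectrum_def)
    then show ?thesis by (auto simp: u_def span_singleton)
  qed
  \<comment> \<open>Parallelism of \<open>A *v v $ i\<close> and \<open>v $ i\<close> without
    reference to an eigenvalue: an equation between continuous functions, hence closed.\<close>
  define C where "C = {(v :: 'n vec_tuple, A :: 'n sq_matrix).
      \<forall>i. inner (v $ i) (v $ i) *\<^sub>R (A *v v $ i) = inner (v $ i) (A *v v $ i) *\<^sub>R v $ i}"
  have contmv: "continuous_on UNIV (\<lambda>p :: 'n vec_tuple \<times> 'n sq_matrix. snd p *v (fst p $ i))" for i
    unfolding matrix_vector_mult_def by (intro continuous_intros)
  have "closed C"
    unfolding C_def case_prod_unfold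
    by (intro closed_Collect_all closed_Collect_eq continuous_intros contmv)
  let ?N = "{A. \<exists>v. v \<in> cball w r \<and> (v, A) \<in> C}"
  have "closedin (top_of_set (cball w r \<times> UNIV)) (C \<inter> cball w r \<times> UNIV)"
    using \<open>closed C\<close> by (metis Int_commute closedin_closed_Int)
  \<comment> \<open>Projection along a compact factor preserves closedness.\<close>
  then have "closedin (top_of_set UNIV) {A. \<exists>v. v \<in> cball w r \<and> (v, A) \<in> C \<inter> cball w r \<times> UNIV}"
    by (intro closedin_compact_projection) auto
  then have "closed ?N" by (simp add: conj_commute cong: conj_cong)
  have "?y \<notin> ?N"
  proof
    assume "?y \<in> ?N"
    then obtain v where v: "v \<in> cball w r" "(v, ?y) \<in> C" by blast
    have vG: "det v \<noteq> 0" "\<And>i. v $ i \<notin> span {e}" using v(1) r(2) by auto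
    \<comment> \<open>Eigenvectors of a symmetric matrix for different eigenvalues are orthogonal.
      As no \<open>v $ i\<close> lies on the line of \<open>e\<close>, the whole tuple would lie in
      the complement of \<open>e\<close> and could not span.\<close>
    have "inner (v $ i) e = 0" for i
    proof -
      have v0: "v $ i \<noteq> 0" using vG(2)[of i] span_0 by metis
      define c where "c = inner (v $ i) (?y *v v $ i) / inner (v $ i) (v $ i)"
      have "inner (v $ i) (v $ i) *\<^sub>R (?y *v v $ i) = inner (v $ i) (?y *v v $ i) *\<^sub>R v $ i"
        using v(2) by (simp add: C_def)
      then have yv: "?y *v v $ i = c *\<^sub>R v $ i"
        using v0 by (simp add: c_def) (metis (no_types) divide_inverse_commute inner_eq_zero_iff real_vector_eq_affinity
            scaleR_scaleR scaleR_one left_inverse)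
      then have "c \<noteq> \<kappa>" using par vG(2) by metis
      moreover have "c * inner (v $ i) e = \<kappa> * inner (v $ i) e"
        using inner_matrix_commute[OF symY, of \<kappa> "v $ i" e] yv ye by simp
      ultimately show ?thesis by simp
    qed
    with vG(1) e(2) show False
      unfolding basis_tuple_iff_det[symmetric] basis_tuple_iff_kernel by blast
  qed
  let ?U = "U \<inter> Uf \<inter> - ?N"
  have "open ?U" using U(1) Uf(1) \<open>closed ?N\<close> by (intro open_Int open_Compl)
  moreover have "?y \<in> ?U" using \<kappa> \<open>?y \<notin> ?N\<close> by simp
  moreover have "?U \<inter> D = {}"
  proof (rule ccontr)
    assume "?U \<inter> D \<noteq> {}"
    then obtain x where x: "x \<in> Uf" "x \<in> D" "x \<notin> ?N" by blast
    then obtain v where v: "v \<in> Diag x" "v \<in> ball w r"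
      using Uf(3)[of x] by (auto simp: mrestrict_def)
    have "\<exists>c. x *v v $ i = c *\<^sub>R v $ i" for i
      using v(1) by (auto simp: Diag_def eigenvector_def split: if_splits)
    then obtain c where "\<And>i. x *v v $ i = c i *\<^sub>R v $ i" by metis
    then have "(v, x) \<in> C" by (simp add: C_def mult.commute)
    with v(2) x(3) show False by auto
  qed
  \<comment> \<open>The perturbation vanishes on the hyperplane orthogonal to \<open>e\<close>, and
    intersecting the kernel with a hyperplane costs at most one dimension.\<close>
  moreover have "dim ?W \<le> Suc (dim {x. ?y *v x = 0})"
  proof -
    have "?W \<inter> {x. inner e x = 0} \<subseteq> {x. ?y *v x = 0}" by (auto simp: Yv)
    then have "dim (?W \<inter> {x. inner e x = 0}) \<le> dim {x. ?y *v x = 0}" by (rule dim_subset)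
    moreover have "dim {x. inner e x = 0} = CARD('n) - 1" using dim_hyperplane[OF e(2)] by simp
    moreover have "dim {x + y |x y. x \<in> ?W \<and> y \<in> {x. inner e x = 0}} + dim (?W \<inter> {x. inner e x = 0}) =
        dim ?W + dim {x. inner e x = 0}"
      by (rule dim_sums_Int) (auto intro: subspace_hyperplane \<open>subspace ?W\<close>)
    moreover have "dim {x + y |x y. x \<in> ?W \<and> y \<in> {x. inner e x = 0}} \<le> CARD('n)"
      using dim_subset_UNIV[of "{x + y |x y. x \<in> ?W \<and> y \<in> {x. inner e x = 0}}"] by simp
    ultimately show ?thesis by linarith
  qed
  ultimately show thesis using that[of ?y ?U] symY by blast
qed

text \<open>Nested neighbourhoods keep each later matrix out of all pieces left before. A move needs
  a kernel of dimension at least 2 and costs at most one dimension, so \<open>CARD('n) - 1\<close>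
  moves are possible from the zero matrix.\<close>

lemma partition_card_ge:
  fixes \<Delta> :: "'n::{finite,linorder} sq_matrix set set"
  assumes P: "partition_on {A. transpose A = A} \<Delta>"
    and C: "\<And>D. D \<in> \<Delta> \<Longrightarrow> mcontinuous (mrestrict Diag D :: ('n sq_matrix, 'n vec_tuple) multimap)"
    and fin: "finite \<Delta>"
  shows "CARD('n) \<le> card \<Delta>"
proof -
  have piece: "\<exists>D\<in>\<Delta>. z \<in> D" if "transpose z = z" for z
    using P that unfolding partition_on_def by blast
  have sub: "D \<subseteq> {A. transpose A = A}" if "D \<in> \<Delta>" for D
    using P that unfolding partition_on_def by blast
  have "\<exists>z U Ds. transpose z = z \<and> CARD('n) \<le> m + dim {x. z *v x = 0} \<and> open U \<and> z \<in> U \<and>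
      Ds \<subseteq> \<Delta> \<and> card Ds = m \<and> (\<forall>D\<in>Ds. U \<inter> D = {})" if "m < CARD('n)" for m
    using that
  proof (induction m)
    case 0
    have "transpose (0 :: 'n sq_matrix) = 0" by (simp add: transpose_def vec_eq_iff)
    moreover have "dim {x. (0 :: 'n sq_matrix) *v x = 0} = CARD('n)" by simp
    ultimately show ?case by (intro exI[of _ "0 :: 'n sq_matrix"] exI[of _ UNIV] exI[of _ "{}"]) auto
  next
    case (Suc m)
    then obtain z U Ds where z: "transpose z = z" "CARD('n) \<le> m + dim {x. z *v x = 0}" "open U" "z \<in> U"
      "Ds \<subseteq> \<Delta>" "card Ds = m" "\<And>D. D \<in> Ds \<Longrightarrow> U \<inter> D = {}"
      by (metis Suc_lessD)
    obtain D where D: "D \<in> \<Delta>" "z \<in> D" using piece z(1) by blast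
    have "D \<notin> Ds" using z(4,7) D(2) by blast
    have "2 \<le> dim {x. z *v x = 0}" using Suc.prems z(2) by linarith
    then obtain y U' where y: "transpose y = y" "dim {x. z *v x = 0} \<le> Suc (dim {x. y *v x = 0})"
        "open U'" "y \<in> U'" "U' \<subseteq> U" "U' \<inter> D = {}"
      using leave_piece[OF z(1) _ z(3,4) D(2) C[OF D(1)] sub[OF D(1)]] by blast
    have "card (insert D Ds) = Suc m"
      using z(5,6) \<open>D \<notin> Ds\<close> fin by (simp add: finite_subset)
    moreover have "CARD('n) \<le> Suc m + dim {x. y *v x = 0}" using z(2) y(2) by linarith
    moreover have "\<forall>D'\<in>insert D Ds. U' \<inter> D' = {}" using y(5,6) z(7) by blast
    ultimately show ?case
      using y z(5) D(1) by (intro exI[of _ y] exI[of _ U'] exI[of _ "insert D Ds"]) auto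
  qed
  from this[of "CARD('n) - 1"] obtain z U Ds where z: "transpose z = z" "z \<in> U"
      "Ds \<subseteq> \<Delta>" "card Ds = CARD('n) - 1" "\<And>D. D \<in> Ds \<Longrightarrow> U \<inter> D = {}"
    by auto
  obtain D where D: "D \<in> \<Delta>" "z \<in> D" using piece z(1) by blast
  then have "D \<notin> Ds" using z(2,5) by blast
  then have "card (insert D Ds) = CARD('n)" using z(3,4) fin by (simp add: finite_subset)
  moreover have "card (insert D Ds) \<le> card \<Delta>" using z(3) D(1) fin by (intro card_mono) auto
  ultimately show ?thesis by simp
qed

section \<open>Computability implies continuity\<close>

text \<open>A step advances an input head by at most one cell, so the first \<open>n\<close> steps
  read only cells below \<open>n\<close>.\<close>

lemma run_cong_prefix:
  assumes "\<And>t i. i < n \<Longrightarrow> inp t i = inp' t i" "k \<le> n"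
  shows "run M inp k = run M inp' k \<and> (\<forall>t. in_pos (run M inp k) t \<le> k)"
  using assms(2)
proof (induction k)
  case 0
  then show ?case by (simp add: run_def init_config_def)
next
  case (Suc k)
  let ?c = "run M inp k"
  have IH: "run M inp' k = ?c" "\<And>t. in_pos ?c t \<le> k" using Suc by auto
  have "inp t (in_pos ?c t) = inp' t (in_pos ?c t)" for t
    using assms(1)[of "in_pos ?c t" t] IH(2)[of t] Suc.prems by simp
  then have "exec inp i ?c = exec inp' i ?c" for i by (cases i) auto
  moreover have "in_pos (exec inp i ?c) t \<le> Suc k" for i t
    using IH(2) by (cases i) (auto simp: le_SucI)
  ultimately show ?case
    using IH by (auto simp: run_def step_def le_SucI)
qed

text \<open>All points of \<open>D\<close> share one advice word. The condition on \<alpha> asks for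
  a single well-chosen name of \<open>x\<close>: the result computed from this name is the witness
  of continuity, and nearby points have names agreeing with it as far as the machine has
  read.\<close>

lemma computable_imp_mcontinuous:
  fixes f :: "('a::topological_space, 'b::topological_space) multimap"
  assumes comp: "computable_with_advice f \<alpha> \<beta> \<Delta>" and D: "D \<in> \<Delta>"
    and \<alpha>: "\<And>x. x \<in> D \<Longrightarrow> \<exists>p. \<alpha> p x \<and>
      (\<forall>n. \<exists>U. open U \<and> x \<in> U \<and> (\<forall>z\<in>U \<inter> mdom f. \<exists>p'. \<alpha> p' z \<and> (\<forall>i<n. p' i = p i)))"
    and \<beta>: "\<And>q y V. \<beta> q y \<Longrightarrow> open V \<Longrightarrow> y \<in> V \<Longrightarrow>
      \<exists>n. \<forall>q' y'. \<beta> q' y' \<and> (\<forall>i<n. q' i = q i) \<longrightarrow> y' \<in> V"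
  shows "mcontinuous (mrestrict f D)"
  unfolding mcontinuous_def mcontinuous_at_def
proof
  fix x assume "x \<in> mdom (mrestrict f D)"
  then have xD: "x \<in> D" by (auto simp: mdom_def mrestrict_def split: if_splits)
  obtain \<delta> :: "bool list \<rightharpoonup> 'a set" and M where \<delta>: "ran \<delta> = \<Delta>" and
    M0: "\<forall>D\<in>\<Delta>. \<forall>a\<in>D. \<forall>p w. \<alpha> p a \<and> \<delta> w = Some D \<longrightarrow> (\<exists>q. outputs M p w q \<and> (\<exists>b\<in>f a. \<beta> q b))"
    using comp unfolding computable_with_advice_def by (elim exE conjE)
  have M: "\<exists>q. outputs M p w q \<and> (\<exists>b\<in>f a. \<beta> q b)" if "D \<in> \<Delta>" "a \<in> D" "\<alpha> p a" "\<delta> w = Some D" for D a p w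
    using M0[rule_format, OF that(1,2)] that(3,4) by blast
  obtain w where w: "\<delta> w = Some D" using D \<delta> by (auto simp: ran_def)
  obtain p where p: "\<alpha> p x"
      "\<And>n. \<exists>U. open U \<and> x \<in> U \<and> (\<forall>z\<in>U \<inter> mdom f. \<exists>p'. \<alpha> p' z \<and> (\<forall>i<n. p' i = p i))"
    using \<alpha>[OF xD] by blast
  obtain q b where q: "outputs M p w q" "b \<in> f x" "\<beta> q b"
    using M[OF D xD p(1) w] by blast
  define inp where "inp p = (\<lambda>t::nat. if t = 0 then inf_tape p else if t = 1 then fin_tape w else (\<lambda>_. None))" for p
  have out: "outputs M p w q \<longleftrightarrow> (\<forall>n. \<forall>i<length (out (run M (inp p) n)). out (run M (inp p) n) ! i = q i) \<and>
       (\<forall>m. \<exists>n. m \<le> length (out (run M (inp p) n)))" for p q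
    unfolding outputs_def inp_def Let_def by simp
  have out1: "out (run M (inp p) n) ! i = q i" if "outputs M p w q" "i < length (out (run M (inp p) n))" for p q n i
    using that(1)[unfolded out, THEN conjunct1] that(2) by simp
  have out2: "\<exists>n. m \<le> length (out (run M (inp p) n))" if "outputs M p w q" for p q m
    using that(1)[unfolded out, THEN conjunct2] by simp
  show "\<exists>y\<in>mrestrict f D x. \<forall>V. open V \<and> y \<in> V \<longrightarrow>
      (\<exists>U. open U \<and> x \<in> U \<and> (\<forall>z\<in>U \<inter> mdom (mrestrict f D). mrestrict f D z \<inter> V \<noteq> {}))"
  proof (intro bexI[of _ b] allI impI)
    fix V assume V: "open V \<and> b \<in> V"
    obtain n where n: "\<forall>q' y'. \<beta> q' y' \<and> (\<forall>i<n. q' i = q i) \<longrightarrow> y' \<in> V"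
      using \<beta>[OF q(3) conjunct1[OF V] conjunct2[OF V]] by (elim exE)
    obtain m where m: "n \<le> length (out (run M (inp p) m))" using out2[OF q(1), of n] by (elim exE)
    obtain U where U: "open U" "x \<in> U" "\<And>z. z \<in> U \<Longrightarrow> z \<in> mdom f \<Longrightarrow> \<exists>p'. \<alpha> p' z \<and> (\<forall>i<m. p' i = p i)"
      using p(2)[of m] by blast
    have "mrestrict f D z \<inter> V \<noteq> {}" if z: "z \<in> U" "z \<in> mdom (mrestrict f D)" for z
    proof -
      have zD: "z \<in> D" "z \<in> mdom f" using z(2) by (auto simp: mdom_def mrestrict_def split: if_splits)
      obtain p' where p': "\<alpha> p' z" "\<And>i. i < m \<Longrightarrow> p' i = p i" using U(3)[OF z(1) zD(2)] by blast
      obtain q' b' where q': "outputs M p' w q'" "b' \<in> f z" "\<beta> q' b'"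
        using M[OF D zD(1) p'(1) w] by blast
      have "run M (inp p') m = run M (inp p) m"
        using run_cong_prefix[of m "inp p'" "inp p" m M] p'(2) by (simp add: inp_def inf_tape_def)
      then have "q' i = q i" if "i < n" for i
        using out1[OF q(1), of i m] out1[OF q'(1), of i m] that m by simp
      then have "b' \<in> V" using n q'(3) by blast
      with q'(2) zD(1) show ?thesis by (auto simp: mrestrict_def)
    qed
    then show "\<exists>U. open U \<and> x \<in> U \<and> (\<forall>z\<in>U \<inter> mdom (mrestrict f D). mrestrict f D z \<inter> V \<noteq> {})"
      using U(1,2) by blast
  qed (use q(2) xD in \<open>simp add: mrestrict_def\<close>)
qed

section \<open>Prefixes of names and neighbourhoods of the named objects\<close>

lemma encodes_seq_prefix:
  assumes p: "encodes_seq p n" "encodes_seq p' n'" and eq: "\<And>j. j < K \<Longrightarrow> n j = n' j"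
    and i: "i < (\<Sum>j<K. Suc (n j))"
  shows "p i = p' i"
  using eq i
proof (induction K)
  case (Suc K)
  let ?s = "\<Sum>j<K. Suc (n j)"
  have s: "?s = (\<Sum>j<K. Suc (n' j))" using Suc.prems(1) by simp
  have e: "n K = n' K" using Suc.prems(1) by simp
  show ?case
  proof (cases "i < ?s")
    case True
    then show ?thesis using Suc by simp
  next
    case False
    define l where "l = i - ?s"
    have l: "i = ?s + l" "l \<le> n K" using False Suc.prems(2) by (simp_all add: l_def)
    show ?thesis
    proof (cases "l = n K")
      case True
      then show ?thesis using p l(1) s e unfolding encodes_seq_def by metis
    next
      case False
      then have "l < n K" using l(2) by simp
      then show ?thesis using p l(1) s e unfolding encodes_seq_def by metis
    qed
  qed
qed simp

lemma encodes_seq_determined: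
  assumes p: "encodes_seq p n" "encodes_seq p' n'"
    and eq: "\<And>i. i < (\<Sum>j<K. Suc (n j)) \<Longrightarrow> p' i = p i" and k: "k < K"
  shows "n' k = n k"
  using k
proof (induction k rule: less_induct)
  case (less k)
  let ?s = "\<Sum>j<k. Suc (n j)"
  have s: "?s = (\<Sum>j<k. Suc (n' j))" using less by simp
  have "(\<Sum>j<Suc k. Suc (n j)) \<le> (\<Sum>j<K. Suc (n j))"
    using less.prems by (intro sum_mono2) auto
  then have le: "?s + l < (\<Sum>j<K. Suc (n j))" if "l \<le> n k" for l using that by simp
  show ?case
  proof (rule ccontr)
    assume "n' k \<noteq> n k"
    then consider "n' k < n k" | "n k < n' k" by linarith
    then show False
    proof cases
      case 1
      then have "p (?s + n' k)" using p(1) unfolding encodes_seq_def by blast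
      moreover have "\<not> p' (?s + n' k)" using p(2) s unfolding encodes_seq_def by metis
      ultimately show False using eq[OF le[of "n' k"]] 1 by simp
    next
      case 2
      then have "p' (?s + n k)" using p(2) s unfolding encodes_seq_def by metis
      moreover have "\<not> p (?s + n k)" using p(1) unfolding encodes_seq_def by blast
      ultimately show False using eq[OF le[of "n k"]] by simp
    qed
  qed
qed

text \<open>All approximations in the name \<open>p\<close> are strict, so that every prefix of \<open>p\<close> is a prefix of a
  name of each number close enough to \<open>x\<close>.\<close>

lemma rho_extendable_name:
  "\<exists>p. rho p x \<and> (\<forall>N. \<exists>e>0. \<forall>z. \<bar>z - x\<bar> < e \<longrightarrow> (\<exists>p'. rho p' z \<and> (\<forall>i<N. p' i = p i)))"
proof -
  define Q where "Q n k = real_of_rat (rat_of_triple (n (3*k)) (n (3*k+1)) (n (3*k+2)))" for n :: "nat \<Rightarrow> nat" and k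
  obtain n0 where n0: "\<And>k. \<bar>x - Q n0 k\<bar> \<le> 1 / 2 ^ k"
    using rho_surj[of x] unfolding rho_def Q_def by blast
  \<comment> \<open>Dropping the first triple makes the rational number \<open>k\<close> the old
    number \<open>k + 1\<close>, whose error bound is half as large; so all bounds become
    strict.\<close>
  define n where "n m = n0 (m + 3)" for m
  have Q: "\<bar>x - Q n k\<bar> < 1 / 2 ^ k" for k
  proof -
    have "Q n k = Q n0 (Suc k)" by (simp add: Q_def n_def numeral_eq_Suc)
    moreover have "1 / 2 ^ Suc k < (1 / 2 ^ k :: real)" by (simp add: field_simps)
    ultimately show ?thesis using n0[of "Suc k"] by linarith
  qed
  obtain p where p: "encodes_seq p n" using encodes_seq_exists by blast
  have "\<exists>e>0. \<forall>z. \<bar>z - x\<bar> < e \<longrightarrow> (\<exists>p'. rho p' z \<and> (\<forall>i<N. p' i = p i))" for N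
  proof -
    \<comment> \<open>The least slack in the first \<open>N\<close> bounds; the element 1 serves the
      case \<open>N = 0\<close>.\<close>
    define e where "e = Min (insert 1 ((\<lambda>k. 1 / 2 ^ k - \<bar>x - Q n k\<bar>) ` {..<N}))"
    have "e > 0" unfolding e_def using Q by (subst Min_gr_iff) auto
    moreover have "\<exists>p'. rho p' z \<and> (\<forall>i<N. p' i = p i)" if z: "\<bar>z - x\<bar> < e" for z
    proof -
      obtain p1 n1 where n1: "encodes_seq p1 n1" "\<And>k. \<bar>z - Q n1 k\<bar> \<le> 1 / 2 ^ k"
        using rho_surj[of z] unfolding rho_def Q_def by blast
      \<comment> \<open>The first \<open>N\<close> triples are kept and continued by those of a name
        of \<open>z\<close>. Every number occupies at least one cell, so the kept part covers the
        prefix of length \<open>N\<close>.\<close>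
      define n' where "n' m = (if m < 3 * N then n m else n1 m)" for m
      obtain p' where p': "encodes_seq p' n'" using encodes_seq_exists by blast
      have "\<bar>z - Q n' k\<bar> \<le> 1 / 2 ^ k" for k
      proof (cases "k < N")
        case True
        then have "Q n' k = Q n k" by (simp add: Q_def n'_def)
        moreover have "e \<le> 1 / 2 ^ k - \<bar>x - Q n k\<bar>" unfolding e_def using True by (intro Min_le) auto
        ultimately show ?thesis using z by linarith
      next
        case False
        then have "Q n' k = Q n1 k" by (simp add: Q_def n'_def)
        then show ?thesis using n1(2)[of k] by simp
      qed
      then have "rho p' z" using p' unfolding rho_def Q_def by blast
      moreover have "p' i = p i" if "i < N" for i
      proof -
        have "(\<Sum>j<3 * N. 1) \<le> (\<Sum>j<3 * N. Suc (n j))" by (rule sum_mono) simp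
        then have "i < (\<Sum>j<3 * N. Suc (n j))" using that by simp
        then show ?thesis using encodes_seq_prefix[OF p p', of "3 * N" i] by (simp add: n'_def)
      qed
      ultimately show ?thesis by blast
    qed
    ultimately show ?thesis by blast
  qed
  moreover have "rho p x" unfolding rho_def using p Q by (auto simp: Q_def intro: less_imp_le)
  ultimately show ?thesis by blast
qed

text \<open>A prefix that contains the triple number \<open>k\<close> puts both reals within
  \<open>1 / 2 ^ k\<close> of the same rational.\<close>

lemma rho_prefix_determines:
  assumes "rho q y" "e > 0"
  shows "\<exists>N. \<forall>q' y'. rho q' y' \<and> (\<forall>i<N. q' i = q i) \<longrightarrow> \<bar>y' - y\<bar> < e"
proof -
  obtain n where n: "encodes_seq q n"
      "\<And>k. \<bar>y - of_rat (rat_of_triple (n (3*k)) (n (3*k+1)) (n (3*k+2)))\<bar> \<le> 1 / 2 ^ k"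
    using assms(1) unfolding rho_def by blast
  obtain k where k: "(1 / 2) ^ k < e / 2" using real_arch_pow_inv[of "e / 2" "1 / 2"] assms(2) by auto
  have "\<bar>y' - y\<bar> < e" if q': "rho q' y'" "\<And>i. i < (\<Sum>j<3 * k + 3. Suc (n j)) \<Longrightarrow> q' i = q i" for q' y'
  proof -
    obtain n' where n': "encodes_seq q' n'"
        "\<And>k. \<bar>y' - of_rat (rat_of_triple (n' (3*k)) (n' (3*k+1)) (n' (3*k+2)))\<bar> \<le> 1 / 2 ^ k"
      using q'(1) unfolding rho_def by blast
    have e: "n' j = n j" if "j < 3 * k + 3" for j
      using encodes_seq_determined[OF n(1) n'(1) q'(2) that] .
    have "\<bar>y' - of_rat (rat_of_triple (n (3*k)) (n (3*k+1)) (n (3*k+2)))\<bar> \<le> 1 / 2 ^ k"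
      using n'(2)[of k] by (simp add: e)
    with n(2)[of k] k show ?thesis by (simp add: power_one_over)
  qed
  then show ?thesis by blast
qed

lemma rho_pow_extendable_name:
  assumes "k > 0"
  shows "\<exists>p. rho_pow k p x \<and>
    (\<forall>N. \<exists>e>0. \<forall>z. (\<forall>i<k. \<bar>z i - x i\<bar> < e) \<longrightarrow> (\<exists>p'. rho_pow k p' z \<and> (\<forall>i<N. p' i = p i)))"
proof -
  obtain P where P: "\<And>i. rho (P i) (x i)"
      "\<And>i N. \<exists>e>0. \<forall>z. \<bar>z - x i\<bar> < e \<longrightarrow> (\<exists>p'. rho p' z \<and> (\<forall>j<N. p' j = P i j))"
    using rho_extendable_name[of "x _"] by metis
  define p where "p m = P (m mod k) (m div k)" for m
  have split: "(k * m + i) mod k = i" "(k * m + i) div k = m" if "i < k" for i m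
    using that by auto
  have "rho_pow k p x" unfolding rho_pow_def p_def using P(1) split by simp
  moreover have "\<exists>e>0. \<forall>z. (\<forall>i<k. \<bar>z i - x i\<bar> < e) \<longrightarrow> (\<exists>p'. rho_pow k p' z \<and> (\<forall>i<N. p' i = p i))" for N
  proof -
    obtain e where e: "\<And>i. e i > 0" "\<And>i z. \<bar>z - x i\<bar> < e i \<Longrightarrow> \<exists>p'. rho p' z \<and> (\<forall>j<N. p' j = P i j)"
    proof -
      have "\<forall>i. \<exists>e. e > 0 \<and> (\<forall>z. \<bar>z - x i\<bar> < e \<longrightarrow> (\<exists>p'. rho p' z \<and> (\<forall>j<N. p' j = P i j)))"
        using P(2) by blast
      from choice[OF this] show thesis using that by blast
    qed
    have "Min (e ` {..<k}) > 0" using e(1) assms by (subst Min_gr_iff) auto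
    moreover have "\<exists>p'. rho_pow k p' z \<and> (\<forall>i<N. p' i = p i)" if z: "\<And>i. i < k \<Longrightarrow> \<bar>z i - x i\<bar> < Min (e ` {..<k})" for z
    proof -
      have "\<exists>p'. rho p' (z i) \<and> (\<forall>j<N. p' j = P i j)" if "i < k" for i
      proof (rule e(2))
        have "Min (e ` {..<k}) \<le> e i" using that by (intro Min_le) auto
        then show "\<bar>z i - x i\<bar> < e i" using z[OF that] by linarith
      qed
      then obtain P' where P': "\<And>i. i < k \<Longrightarrow> rho (P' i) (z i)" "\<And>i j. i < k \<Longrightarrow> j < N \<Longrightarrow> P' i j = P i j"
        by metis
      define p' where "p' m = P' (m mod k) (m div k)" for m
      have "rho_pow k p' z" unfolding rho_pow_def p'_def using P'(1) split by simp
      moreover have "p' m = p m" if "m < N" for m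
        using P'(2)[of "m mod k" "m div k"] assms that by (simp add: p_def p'_def le_less_trans[OF div_le_dividend])
      ultimately show ?thesis by blast
    qed
    ultimately show ?thesis by blast
  qed
  ultimately show ?thesis by blast
qed

lemma rho_pow_prefix_determines:
  assumes "rho_pow k q y" "e > 0"
  shows "\<exists>N. \<forall>q' y'. rho_pow k q' y' \<and> (\<forall>i<N. q' i = q i) \<longrightarrow> (\<forall>i<k. \<bar>y' i - y i\<bar> < e)"
proof -
  have "\<exists>N. \<forall>q' y'. rho q' y' \<and> (\<forall>j<N. q' j = q (k * j + i)) \<longrightarrow> \<bar>y' - y i\<bar> < e" if "i < k" for i
    using rho_prefix_determines[of "\<lambda>j. q (k * j + i)" "y i" e] assms that unfolding rho_pow_def by simp
  then obtain N where N: "\<And>i q' y'. i < k \<Longrightarrow> rho q' y' \<Longrightarrow> (\<And>j. j < N i \<Longrightarrow> q' j = q (k * j + i)) \<Longrightarrow> \<bar>y' - y i\<bar> < e"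
    by metis
  define L where "L = (\<Sum>i<k. k * N i + k)"
  have "\<bar>y' i - y i\<bar> < e" if q': "rho_pow k q' y'" "\<And>j. j < L \<Longrightarrow> q' j = q j" and i: "i < k" for q' y' i
  proof (rule N[OF i])
    show "rho (\<lambda>j. q' (k * j + i)) (y' i)" using q'(1) i unfolding rho_pow_def by blast
    fix j assume j: "j < N i"
    have "k * j + i < k * N i + k"
      using j i by (metis add_less_mono add.commute less_imp_le_nat mult_le_mono2 add_mono_thms_linordered_field(4))
    also have "\<dots> \<le> L" unfolding L_def using i by (intro member_le_sum) auto
    finally show "q' (k * j + i) = q (k * j + i)" by (rule q'(2))
  qed
  then show ?thesis by blast
qed

definition upper_entries :: "'n::{finite,linorder} sq_matrix \<Rightarrow> nat \<Rightarrow> real" where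
  "upper_entries A = (\<lambda>(i, j). A $ i $ j) \<circ> inv_into {(i, j). i \<le> j} (\<lambda>(i, j). upper_index i j)"

lemma upper_entries: "i \<le> j \<Longrightarrow> upper_entries A (upper_index i j) = A $ i $ j"
  using inv_into_f_f[of "\<lambda>(i, j). upper_index i (j::'a)" "{(i, j). i \<le> j}" "(i, j)"] upper_index_bij[where 'n='a]
  by (simp add: upper_entries_def bij_betw_def)

lemma sym_matrix_rep_extendable_name:
  fixes A :: "'n::{finite,linorder} sq_matrix"
  assumes "transpose A = A"
  shows "\<exists>p. sym_matrix_rep p A \<and> (\<forall>N. \<exists>U. open U \<and> A \<in> U \<and>
    (\<forall>B\<in>U \<inter> {B. transpose B = B}. \<exists>p'. sym_matrix_rep p' B \<and> (\<forall>i<N. p' i = p i)))"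
proof -
  let ?k = "CARD('n) * (CARD('n) + 1) div 2"
  have "CARD('n) > 0" by simp
  then have k: "?k > 0" by (cases "CARD('n)") auto
  obtain p where p: "rho_pow ?k p (upper_entries A)"
      "\<And>N. \<exists>e>0. \<forall>z. (\<forall>i<?k. \<bar>z i - upper_entries A i\<bar> < e) \<longrightarrow> (\<exists>p'. rho_pow ?k p' z \<and> (\<forall>i<N. p' i = p i))"
    using rho_pow_extendable_name[OF k] by blast
  have "\<exists>U. open U \<and> A \<in> U \<and>
      (\<forall>B\<in>U \<inter> {B. transpose B = B}. \<exists>p'. sym_matrix_rep p' B \<and> (\<forall>i<N. p' i = p i))" for N
  proof -
    obtain e where e: "e > 0" "\<And>z. (\<And>i. i < ?k \<Longrightarrow> \<bar>z i - upper_entries A i\<bar> < e) \<Longrightarrow>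
        \<exists>p'. rho_pow ?k p' z \<and> (\<forall>i<N. p' i = p i)"
      using p(2) by blast
    let ?U = "{B. \<forall>i j. \<bar>B $ i $ j - A $ i $ j\<bar> < e}"
    have "open ?U"
    proof -
      have "?U = (\<Inter>i. \<Inter>j. {B. \<bar>B $ i $ j - A $ i $ j\<bar> < e})" by auto
      then show ?thesis by (simp only:) (intro open_INT ballI open_Collect_less continuous_intros finite)
    qed
    moreover have "\<exists>p'. sym_matrix_rep p' B \<and> (\<forall>i<N. p' i = p i)" if B: "B \<in> ?U" "transpose B = B" for B
    proof -
      have "\<bar>upper_entries B i - upper_entries A i\<bar> < e" for i
        using B(1) by (auto simp: upper_entries_def split: prod.split)
      then obtain p' where "rho_pow ?k p' (upper_entries B)" "\<And>i. i < N \<Longrightarrow> p' i = p i" using e(2) by blast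
      then show ?thesis using B(2) upper_entries[of _ _ B] unfolding sym_matrix_rep_def by metis
    qed
    ultimately show ?thesis using e(1) by (intro exI[of _ ?U]) auto
  qed
  moreover have "sym_matrix_rep p A"
    using p(1) assms upper_entries[of _ _ A] unfolding sym_matrix_rep_def by metis
  ultimately show ?thesis by blast
qed

lemma norm_vec_vec_le: "norm (w :: (real^'n)^'m) \<le> (\<Sum>i\<in>UNIV. \<Sum>j\<in>UNIV. \<bar>w $ i $ j\<bar>)"
proof -
  have "norm w \<le> (\<Sum>i\<in>UNIV. norm (w $ i))" by (simp add: norm_vec_def L2_set_le_sum)
  also have "\<dots> \<le> (\<Sum>i\<in>UNIV. \<Sum>j\<in>UNIV. \<bar>w $ i $ j\<bar>)" by (intro sum_mono norm_le_l1_cart)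
  finally show ?thesis .
qed

lemma tuple_rep_prefix_determines:
  fixes w :: "'n::{finite,linorder} vec_tuple"
  assumes "tuple_rep q w" "open V" "w \<in> V"
  shows "\<exists>N. \<forall>q' w'. tuple_rep q' w' \<and> (\<forall>i<N. q' i = q i) \<longrightarrow> w' \<in> V"
proof -
  let ?d = "CARD('n)"
  obtain e where e: "e > 0" "ball w e \<subseteq> V" using assms(2,3) open_contains_ball by blast
  \<comment> \<open>There are \<open>?d * ?d\<close> entries, so entrywise errors below
    \<open>h\<close> add up to less than \<open>e\<close>.\<close>
  define h where "h = e / (real ?d * real ?d)"
  have h: "h > 0" using e(1) by (simp add: h_def)
  obtain x where x: "rho_pow (?d * ?d) q x" "\<And>i j. w $ i $ j = x (?d * rank_of i + rank_of j)"
    using assms(1) unfolding tuple_rep_def by blast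
  obtain N where N0: "\<forall>q' y'. rho_pow (?d * ?d) q' y' \<and> (\<forall>i<N. q' i = q i) \<longrightarrow> (\<forall>i<?d * ?d. \<bar>y' i - x i\<bar> < h)"
    using rho_pow_prefix_determines[OF x(1) h] by (elim exE)
  have N: "\<bar>y' i - x i\<bar> < h" if "rho_pow (?d * ?d) q' y'" "\<And>i. i < N \<Longrightarrow> q' i = q i" "i < ?d * ?d" for q' y' i
    using N0[rule_format, of q' y' i] that by blast
  have "w' \<in> V" if w': "tuple_rep q' w'" "\<And>i. i < N \<Longrightarrow> q' i = q i" for q' w'
  proof -
    obtain x' where x': "rho_pow (?d * ?d) q' x'" "\<And>i j. w' $ i $ j = x' (?d * rank_of i + rank_of j)"
      using w'(1) unfolding tuple_rep_def by blast
    have "\<bar>(w' - w) $ i $ j\<bar> < h" for i j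
      using N[OF x'(1) w'(2) tuple_index_less[of i j]] by (simp add: x(2) x'(2))
    then have "(\<Sum>i\<in>UNIV. \<Sum>j\<in>UNIV. \<bar>(w' - w) $ i $ j\<bar>) < (\<Sum>i\<in>(UNIV::'n set). \<Sum>j\<in>(UNIV::'n set). h)"
      by (intro sum_strict_mono) auto
    also have "\<dots> = e" by (simp add: h_def)
    finally have "norm (w' - w) < e" using norm_vec_vec_le[of "w' - w"] by linarith
    with e(2) show ?thesis by (auto simp: dist_norm norm_minus_commute)
  qed
  then show ?thesis by blast
qed

section \<open>Counter programs with an oracle\<close>

text \<open>An intermediate language between expressions and machine code. \<open>Rd\<close> gives
  random access to the input, which the machine itself can only read once from left to
  right.\<close>

datatype com =
    Inc nat
  | Dec nat
  | Rd nat
  | Out bool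
  | Seq com com
  | While nat com

inductive bs :: "inf_word \<Rightarrow> com \<Rightarrow> (nat \<Rightarrow> nat) \<Rightarrow> (nat \<Rightarrow> nat) \<Rightarrow> bool list \<Rightarrow> bool" for p where
  Inc: "bs p (Inc r) s (s(r := Suc (s r))) []"
| Dec: "s r = Suc n \<Longrightarrow> bs p (Dec r) s (s(r := n)) []"
| Rd: "bs p (Rd r) s (s(r := of_bool (p (s r)))) []"
| Out: "bs p (Out b) s s [b]"
| Seq: "bs p c s s' u \<Longrightarrow> bs p c' s' s'' v \<Longrightarrow> bs p (Seq c c') s s'' (u @ v)"
| While0: "s r = 0 \<Longrightarrow> bs p (While r c) s s []"
| WhileS: "s r \<noteq> 0 \<Longrightarrow> bs p c s s' u \<Longrightarrow> bs p (While r c) s' s'' v \<Longrightarrow> bs p (While r c) s s'' (u @ v)"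

section \<open>Compilation of counter programs to machine code\<close>

fun clen :: "com \<Rightarrow> nat" where
  "clen (Inc r) = 2"
| "clen (Dec r) = 1"
| "clen (Rd r) = 17"
| "clen (Out b) = 1"
| "clen (Seq c c') = clen c + clen c'"
| "clen (While r c) = clen c + 2"

text \<open>Offsets 0 to 5 fetch the next input letter if the buffer cell is blank
  (\<open>False\<close> is written first and corrected if necessary); 6 to 9 count the register down
  while the buffer head moves right; 10 to 12 store the bit in the register; 13 to 16 rewind to the
  blank at cell -1 and return to cell 0.\<close>

definition rd_code :: "nat \<Rightarrow> nat \<Rightarrow> machine" where
  "rd_code r a =
    [Work_Branch 0 (Some True) (a + 6), Work_Branch 0 (Some False) (a + 6),
     Work_Write 0 (Some False), In_Branch 0 (Some False) (a + 5), Work_Write 0 (Some True), In_Right 0,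
     Work_Branch (Suc r) None (a + 10), Work_Left (Suc r), Work_Right 0, Jump a,
     Work_Branch 0 (Some False) (a + 13), Work_Right (Suc r), Work_Write (Suc r) (Some True),
     Work_Left 0, Work_Branch 0 None (a + 16), Jump (a + 13), Work_Right 0]"

fun code :: "com \<Rightarrow> nat \<Rightarrow> machine" where
  "code (Inc r) a = [Work_Right (Suc r), Work_Write (Suc r) (Some True)]"
| "code (Dec r) a = [Work_Left (Suc r)]"
| "code (Rd r) a = rd_code r a"
| "code (Out b) a = [Output b]"
| "code (Seq c c') a = code c a @ code c' (a + clen c)"
| "code (While r c) a = Work_Branch (Suc r) None (a + clen c + 2) # code c (Suc a) @ [Jump a]"

lemma length_code [simp]: "length (code c a) = clen c"
  by (induction c arbitrary: a) (simp_all add: rd_code_def)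

definition loaded :: "machine \<Rightarrow> nat \<Rightarrow> machine \<Rightarrow> bool" where
  "loaded M a xs \<longleftrightarrow> (\<forall>i<length xs. a + i < length M \<and> M ! (a + i) = xs ! i)"

lemma loaded_Nil [simp]: "loaded M a []"
  by (simp add: loaded_def)

lemma loaded_Cons: "loaded M a (x # xs) \<longleftrightarrow> a < length M \<and> M ! a = x \<and> loaded M (Suc a) xs"
  unfolding loaded_def length_Cons All_less_Suc2 by simp

lemma loaded_append: "loaded M a (xs @ ys) \<longleftrightarrow> loaded M a xs \<and> loaded M (a + length xs) ys"
  by (induction xs arbitrary: a) (simp_all add: loaded_Cons)

definition reach :: "machine \<Rightarrow> (nat \<Rightarrow> nat \<Rightarrow> cell) \<Rightarrow> config \<Rightarrow> config \<Rightarrow> bool" where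
  "reach M inp c c' \<longleftrightarrow> (\<exists>n. (step M inp ^^ n) c = c')"

lemma reach_refl [simp]: "reach M inp c c"
  unfolding reach_def by (rule exI[of _ 0]) simp

lemma reach_trans: "reach M inp c c' \<Longrightarrow> reach M inp c' c'' \<Longrightarrow> reach M inp c c''"
  unfolding reach_def by (metis comp_apply funpow_add)

lemma reach_step:
  assumes "pc c < length M" "M ! pc c = i" "reach M inp (exec inp i c) c'"
  shows "reach M inp c c'"
proof -
  from assms(3) obtain n where n: "(step M inp ^^ n) (exec inp i c) = c'" unfolding reach_def by blast
  have "(step M inp ^^ Suc n) c = c'"
    using n assms(1,2) by (simp add: funpow_Suc_right step_def del: funpow.simps)
  then show ?thesis unfolding reach_def by blast
qed

text \<open>The last case compares the fields one by one because the simplifier does not reorder record updates.\<close>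

fun follows :: "machine \<Rightarrow> nat \<Rightarrow> (nat \<Rightarrow> nat \<Rightarrow> cell) \<Rightarrow> nat list \<Rightarrow> config \<Rightarrow> config \<Rightarrow> bool" where
  "follows xs a inp (i # is) c c' \<longleftrightarrow> pc c = a + i \<and> i < length xs \<and> follows xs a inp is (exec inp (xs ! i) c) c'"
| "follows xs a inp [] c c' \<longleftrightarrow> pc c = pc c' \<and> in_pos c = in_pos c' \<and> work_pos c = work_pos c' \<and>
     work c = work c' \<and> out c = out c'"

lemma follows_reach: "loaded M a xs \<Longrightarrow> follows xs a inp is c c' \<Longrightarrow> reach M inp c c'"
proof (induction "is" arbitrary: c)
  case Nil
  then have "c = c'" by (intro config.equality) simp_all
  then show ?case by simp
next
  case (Cons i "is")
  then show ?case by (intro reach_step[of c M "xs ! i"]) (auto simp: loaded_def)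
qed

text \<open>Work tape \<open>r + 1\<close> holds the value of register \<open>r\<close> as its head position: cell 0 is blank and
  the cells from 1 up to the head are marked, which makes zero testable without any initialization.
  Work tape 0 buffers the part of the infinite input read so far; its head is at \<open>h\<close>.\<close>

definition sim :: "inf_word \<Rightarrow> (nat \<Rightarrow> nat) \<Rightarrow> bool list \<Rightarrow> int \<Rightarrow> config \<Rightarrow> bool" where
  "sim p s o' h c \<longleftrightarrow>
     (\<forall>r. work_pos c (Suc r) = int (s r) \<and> work c (Suc r) 0 = None \<and>
        (\<forall>i\<ge>1. i \<le> int (s r) \<longrightarrow> work c (Suc r) i = Some True)) \<and>
     work_pos c 0 = h \<and> (\<forall>i<0. work c 0 i = None) \<and>
     (\<forall>i. work c 0 (int i) = (if i < in_pos c 0 then Some (p i) else None)) \<and> out c = o'"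

lemma sim_reg_None_iff:
  assumes "sim p s o' h c"
  shows "work c (Suc r) (work_pos c (Suc r)) = None \<longleftrightarrow> s r = 0"
proof -
  have *: "work_pos c (Suc r) = int (s r)" "work c (Suc r) 0 = None"
    "\<And>i. i \<ge> 1 \<Longrightarrow> i \<le> int (s r) \<Longrightarrow> work c (Suc r) i = Some True"
    using assms unfolding sim_def by auto
  show ?thesis
    using * by (cases "s r") auto
qed

lemma sim_inc:
  assumes "sim p s o' h c"
  shows "sim p (s(r := Suc (s r))) o' h (exec inp (Work_Write (Suc r) (Some True)) (exec inp (Work_Right (Suc r)) c))"
proof -
  have "i = int (s r) + 1 \<or> i \<le> int (s r)" if "i \<le> int (s r) + 1" for i using that by linarith
  with assms show ?thesis unfolding sim_def by fastforce
qed

lemma sim_dec: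
  assumes "sim p s o' h c" "s r = Suc n"
  shows "sim p (s(r := n)) o' h (exec inp (Work_Left (Suc r)) c)"
  using assms unfolding sim_def by auto

lemma sim_pc [simp]: "sim p s o' h (c\<lparr>pc := a\<rparr>) = sim p s o' h c"
  unfolding sim_def by simp

text \<open>The bound \<open>h \<le> in_pos c 0\<close> excludes gaps in the buffer: if the scanned
  cell is blank, then the next unread input letter is the one that belongs there.\<close>

lemma rd_fill:
  assumes L: "loaded M a (rd_code r a)" and inp: "inp 0 = inf_tape p"
    and s: "sim p s o' (int h) c" "pc c = a" "h \<le> in_pos c 0"
  shows "\<exists>c'. reach M inp c c' \<and> sim p s o' (int h) c' \<and> pc c' = a + 6 \<and> h < in_pos c' 0"
proof (cases "h < in_pos c 0")
  case True
  with s have w: "work c 0 (work_pos c 0) = Some (p h)" unfolding sim_def by auto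
  have "reach M inp c (c\<lparr>pc := a + 6\<rparr>)"
  proof (cases "p h")
    case pT: True
    note F = s w pT
    show ?thesis
      by (rule follows_reach[OF L, of _ "[0]"]) (use F in \<open>simp add: rd_code_def\<close>)
  next
    case pF: False
    note F = s w pF
    show ?thesis
      by (rule follows_reach[OF L, of _ "[0, 1]"]) (use F in \<open>simp add: rd_code_def\<close>)
  qed
  then show ?thesis using s True by (intro exI[of _ "c\<lparr>pc := a + 6\<rparr>"]) simp
next
  case False
  with s have h: "in_pos c 0 = h" by simp
  with s have w: "work c 0 (work_pos c 0) = None" unfolding sim_def by auto
  have i: "inp 0 (in_pos c 0) = Some (p h)" using inp h by (simp add: inf_tape_def)
  have wp: "work_pos c 0 = int h" using s unfolding sim_def by simp
  let ?c = "c\<lparr>pc := a + 6, in_pos := (in_pos c)(0 := Suc h), work := (work c)(0 := (work c 0)(int h := Some (p h)))\<rparr>"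
  have "reach M inp c ?c"
  proof (cases "p h")
    case True
    note F = s(2) w[unfolded wp] i[unfolded h] True wp h
    show ?thesis
      by (rule follows_reach[OF L, of _ "[0, 1, 2, 3, 4, 5]"]) (use F in \<open>simp add: rd_code_def\<close>)
  next
    case False
    note F = s(2) w[unfolded wp] i[unfolded h] False wp h
    show ?thesis
      by (rule follows_reach[OF L, of _ "[0, 1, 2, 3, 5]"]) (use F in \<open>simp add: rd_code_def\<close>)
  qed
  moreover have "sim p s o' (int h) ?c"
    using s(1) h unfolding sim_def by auto
  ultimately show ?thesis by (intro exI[of _ ?c]) simp
qed

text \<open>Each unit taken from the register moves the buffer head by one cell, so the value of the
  register becomes an offset of the head, and the register ends at zero.\<close>

lemma rd_right:
  assumes L: "loaded M a (rd_code r a)" and inp: "inp 0 = inf_tape p"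
    and s: "sim p s o' (int h) c" "pc c = a" "h \<le> in_pos c 0"
  shows "\<exists>c'. reach M inp c c' \<and> sim p (s(r := 0)) o' (int (h + s r)) c' \<and> pc c' = a + 10 \<and> h + s r < in_pos c' 0"
  using s
proof (induction "s r" arbitrary: s h c)
  case 0
  obtain c' where c': "reach M inp c c'" "sim p s o' (int h) c'" "pc c' = a + 6" "h < in_pos c' 0"
    using rd_fill[where inp=inp, OF L inp 0(2-4)] by blast
  note F = c'(3) 0(1)[symmetric] sim_reg_None_iff[OF c'(2), of r]
  have "reach M inp c' (c'\<lparr>pc := a + 10\<rparr>)"
    by (rule follows_reach[OF L, of _ "[6]"]) (use F in \<open>simp add: rd_code_def\<close>)
  then have "reach M inp c (c'\<lparr>pc := a + 10\<rparr>)" using c'(1) reach_trans by blast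
  moreover have "s(r := 0) = s" using 0 by auto
  ultimately show ?case using c' 0(1) by (intro exI[of _ "c'\<lparr>pc := a + 10\<rparr>"]) simp
next
  case (Suc n)
  obtain c' where c': "reach M inp c c'" "sim p s o' (int h) c'" "pc c' = a + 6" "h < in_pos c' 0"
    using rd_fill[where inp=inp, OF L inp Suc(3-5)] by blast
  let ?c = "(exec inp (Work_Right 0) (exec inp (Work_Left (Suc r)) c'))\<lparr>pc := a\<rparr>"
  note F = c'(3) Suc(2)[symmetric] sim_reg_None_iff[OF c'(2), of r]
  have "reach M inp c' ?c"
    by (rule follows_reach[OF L, of _ "[6, 7, 8, 9]"]) (use F in \<open>simp add: rd_code_def\<close>)
  moreover have sc: "sim p (s(r := n)) o' (int (Suc h)) ?c"
    using c'(2) Suc(2)[symmetric] unfolding sim_def by auto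
  moreover obtain c'' where "reach M inp ?c c''"
      "sim p ((s(r := n))(r := 0)) o' (int (Suc h + (s(r := n)) r)) c''" "pc c'' = a + 10"
      "Suc h + (s(r := n)) r < in_pos c'' 0"
    using Suc(1)[of "s(r := n)", OF _ sc] c'(4) by auto
  ultimately show ?case
    using c'(1) Suc(2)[symmetric] by (intro exI[of _ c'']) (auto intro: reach_trans)
qed

text \<open>Negative cells of the buffer tape are never written, so the blank at cell -1 marks the
  left end.\<close>

lemma rd_left:
  assumes L: "loaded M a (rd_code r a)"
    and s: "sim p s o' (int h) c" "pc c = a + 13" "h < in_pos c 0"
  shows "\<exists>c'. reach M inp c c' \<and> sim p s o' 0 c' \<and> pc c' = a + 17"
  using s
proof (induction h arbitrary: c)
  case 0
  let ?c = "c\<lparr>pc := a + 17\<rparr>"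
  have w: "work_pos c 0 = 0" "work c 0 (-1) = None" using 0 unfolding sim_def by auto
  note F = 0(2) w
  have "reach M inp c ?c"
    by (rule follows_reach[OF L, of _ "[13, 14, 16]"]) (use F in \<open>simp add: rd_code_def fun_upd_idem\<close>)
  then show ?case using 0 by (intro exI[of _ ?c]) simp
next
  case (Suc h)
  let ?c = "(exec inp (Work_Left 0) c)\<lparr>pc := a + 13\<rparr>"
  have w: "work_pos c 0 = int (Suc h)" "work c 0 (int h) = Some (p h)" using Suc unfolding sim_def by auto
  note F = Suc(3) w
  have r: "reach M inp c ?c"
    by (rule follows_reach[OF L, of _ "[13, 14, 15]"]) (use F in \<open>simp add: rd_code_def\<close>)
  have sc: "sim p s o' (int h) ?c" using Suc(2) unfolding sim_def by auto
  have "\<exists>c'. reach M inp ?c c' \<and> sim p s o' 0 c' \<and> pc c' = a + 17"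
    by (rule Suc(1)[OF sc]) (use Suc(4) in auto)
  then show ?case using r reach_trans by blast
qed

lemma rd_correct:
  assumes L: "loaded M a (rd_code r a)" and inp: "inp 0 = inf_tape p"
    and s: "sim p s o' 0 c" "pc c = a"
  shows "\<exists>c'. reach M inp c c' \<and> sim p (s(r := of_bool (p (s r)))) o' 0 c' \<and> pc c' = a + 17"
proof -
  obtain c1 where c1: "reach M inp c c1" "sim p (s(r := 0)) o' (int (s r)) c1" "pc c1 = a + 10"
      "s r < in_pos c1 0"
    using rd_right[where inp=inp and h=0 and s=s, OF L inp] s by auto
  have w: "work c1 0 (work_pos c1 0) = Some (p (s r))"
    using c1(2,4) unfolding sim_def by auto
  have "\<exists>c2. reach M inp c1 c2 \<and> sim p (s(r := of_bool (p (s r)))) o' (int (s r)) c2 \<and> pc c2 = a + 13 \<and> s r < in_pos c2 0"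
  proof (cases "p (s r)")
    case True
    let ?c = "exec inp (Work_Write (Suc r) (Some True)) (exec inp (Work_Right (Suc r)) (c1\<lparr>pc := a + 11\<rparr>))"
    note F = c1(3) w True
    have "reach M inp c1 ?c"
      by (rule follows_reach[OF L, of _ "[10, 11, 12]"]) (use F in \<open>simp add: rd_code_def\<close>)
    moreover have "sim p (s(r := of_bool (p (s r)))) o' (int (s r)) ?c"
      using sim_inc[of p "s(r := 0)" o' "int (s r)" "c1\<lparr>pc := a + 11\<rparr>" r inp] c1(2) True by simp
    ultimately show ?thesis using c1 by (intro exI[of _ ?c]) simp
  next
    case False
    let ?c = "c1\<lparr>pc := a + 13\<rparr>"
    note F = c1(3) w False
    have "reach M inp c1 ?c"
      by (rule follows_reach[OF L, of _ "[10]"]) (use F in \<open>simp add: rd_code_def\<close>)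
    then show ?thesis using c1 False by (intro exI[of _ ?c]) simp
  qed
  then show ?thesis using rd_left[OF L] c1(1) by (meson reach_trans)
qed

lemma code_correct:
  assumes "bs p com s s' u" "inp 0 = inf_tape p"
    and "loaded M a (code com a)" "sim p s o' 0 c" "pc c = a"
  shows "\<exists>c'. reach M inp c c' \<and> sim p s' (o' @ u) 0 c' \<and> pc c' = a + clen com"
  using assms
proof (induction arbitrary: a o' c rule: bs.induct)
  case (Inc r s)
  let ?c = "exec inp (Work_Write (Suc r) (Some True)) (exec inp (Work_Right (Suc r)) c)"
  have "reach M inp c ?c"
    by (rule follows_reach[OF Inc(2), of _ "[0, 1]"]) (use Inc(4) in simp)
  moreover have "sim p (s(r := Suc (s r))) (o' @ []) 0 ?c"
    using sim_inc[OF Inc(3), of r inp] by (simp del: exec.simps)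
  moreover have "pc ?c = a + clen (com.Inc r)" using Inc(4) by simp
  ultimately show ?case by blast
next
  case (Dec s r n)
  let ?c = "exec inp (Work_Left (Suc r)) c"
  have "reach M inp c ?c"
    by (rule follows_reach[OF Dec(3), of _ "[0]"]) (use Dec(5) in simp)
  moreover have "sim p (s(r := n)) (o' @ []) 0 ?c"
    using sim_dec[OF Dec(4,1), of inp] by (simp del: exec.simps)
  moreover have "pc ?c = a + clen (com.Dec r)" using Dec(5) by simp
  ultimately show ?case by blast
next
  case (Rd r s)
  then show ?case using rd_correct[of M a r inp p s o' c] by (simp del: fun_upd_apply)
next
  case (Out b s)
  let ?c = "exec inp (Output b) c"
  have "reach M inp c ?c"
    by (rule follows_reach[OF Out(2), of _ "[0]"]) (use Out(4) in simp)
  moreover have "sim p s (o' @ [b]) 0 ?c" using Out(3) unfolding sim_def by auto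
  ultimately show ?case using Out(4) by (intro exI[of _ ?c]) simp
next
  case (Seq d s s' u d' s'' v)
  have L: "loaded M a (code d a)" "loaded M (a + clen d) (code d' (a + clen d))"
    using Seq.prems(2) by (simp_all add: loaded_append)
  obtain c1 where c1: "reach M inp c c1" "sim p s' (o' @ u) 0 c1" "pc c1 = a + clen d"
    using Seq.IH(1)[OF Seq.prems(1) L(1) Seq.prems(3,4)] by blast
  obtain c2 where "reach M inp c1 c2" "sim p s'' ((o' @ u) @ v) 0 c2" "pc c2 = a + clen d + clen d'"
    using Seq.IH(2)[OF Seq.prems(1) L(2) c1(2,3)] by blast
  with c1(1) show ?case by (intro exI[of _ c2]) (auto intro: reach_trans)
next
  case (While0 s r d)
  let ?c = "c\<lparr>pc := a + clen d + 2\<rparr>"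
  have "reach M inp c ?c"
    by (rule reach_step, (use While0 in \<open>simp add: loaded_Cons\<close>), (use While0 in \<open>simp add: loaded_Cons\<close>))
      (use While0 sim_reg_None_iff[OF While0(4), of r] in simp)
  with While0 show ?case by (intro exI[of _ ?c]) simp
next
  case (WhileS s r d s' u s'' v)
  let ?c = "c\<lparr>pc := Suc a\<rparr>"
  have L: "loaded M (Suc a) (code d (Suc a))" "loaded M (Suc a + clen d) [Jump a]"
    using WhileS.prems(2) by (simp_all add: loaded_append loaded_Cons)
  have r0: "reach M inp c ?c"
    by (rule reach_step, (use WhileS in \<open>simp add: loaded_Cons\<close>), (use WhileS in \<open>simp add: loaded_Cons\<close>))
      (use WhileS.hyps WhileS.prems(4) sim_reg_None_iff[OF WhileS.prems(3), of r] in auto)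
  have sc: "sim p s o' 0 ?c" "pc ?c = Suc a" using WhileS.prems(3) by simp_all
  obtain c1 where c1: "reach M inp ?c c1" "sim p s' (o' @ u) 0 c1" "pc c1 = Suc a + clen d"
    using WhileS.IH(1)[OF WhileS.prems(1) L(1) sc] by blast
  let ?d = "c1\<lparr>pc := a\<rparr>"
  have r1: "reach M inp c1 ?d"
    by (rule reach_step[where i = "Jump a"]) (use L(2) c1 in \<open>simp_all add: loaded_Cons\<close>)
  have sd: "sim p s' (o' @ u) 0 ?d" "pc ?d = a" using c1(2) by simp_all
  obtain c2 where "reach M inp ?d c2" "sim p s'' ((o' @ u) @ v) 0 c2" "pc c2 = a + clen (While r d)"
    using WhileS.IH(2)[OF WhileS.prems(1,2) sd] by blast
  with r0 c1(1) r1 show ?case by (intro exI[of _ c2]) (auto intro: reach_trans)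
qed

section \<open>Primitive recursive expressions with an oracle and their compilation\<close>

datatype expr =
    V nat
  | Z
  | S expr
  | Rec expr expr expr
  | Query expr

text \<open>Variables are de Bruijn indices: in the step expression of \<open>Rec\<close>, variable
  0 is the previous value, variable 1 the index of the round, and the outer variables are shifted by
  two.\<close>

fun eval :: "expr \<Rightarrow> inf_word \<Rightarrow> (nat \<Rightarrow> nat) \<Rightarrow> nat" where
  "eval (V i) p e = e i"
| "eval Z p e = 0"
| "eval (S t) p e = Suc (eval t p e)"
| "eval (Rec b t c) p e =
     rec_nat (eval b p e) (\<lambda>k y. eval t p (case_nat y (case_nat k e))) (eval c p e)"
| "eval (Query t) p e = of_bool (p (eval t p e))"

definition clear_com :: "nat \<Rightarrow> com" where
  "clear_com r = While r (Dec r)"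

definition move_com :: "nat \<Rightarrow> nat \<Rightarrow> com" where
  "move_com a b = While a (Seq (Dec a) (Inc b))"

definition copy_com :: "nat \<Rightarrow> nat \<Rightarrow> com" where
  "copy_com a n = Seq (While a (Seq (Dec a) (Seq (Inc n) (Inc (Suc n))))) (move_com (Suc n) a)"

text \<open>The value of the expression is left in register \<open>n\<close>; its variable \<open>i\<close> is kept in register
  \<open>\<rho> i < n\<close>, and all registers from \<open>n\<close> on are scratch, initially zero.\<close>

fun expr_com :: "expr \<Rightarrow> (nat \<Rightarrow> nat) \<Rightarrow> nat \<Rightarrow> com" where
  "expr_com (V i) \<rho> n = copy_com (\<rho> i) n"
| "expr_com Z \<rho> n = clear_com n"
| "expr_com (S t) \<rho> n = Seq (expr_com t \<rho> n) (Inc n)"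
| "expr_com (Query t) \<rho> n = Seq (expr_com t \<rho> n) (Rd n)"
| "expr_com (Rec b t c) \<rho> n =
     Seq (expr_com b \<rho> n) (Seq (expr_com c \<rho> (Suc n)) (Seq
       (While (Suc n) (Seq (expr_com t (case_nat n (case_nat (n + 2) \<rho>)) (n + 3))
          (Seq (clear_com n) (Seq (move_com (n + 3) n) (Seq (Inc (n + 2)) (Dec (Suc n)))))))
       (clear_com (n + 2))))"

lemma bs_Seq_Nil: "bs p c s s' [] \<Longrightarrow> bs p c' s' s'' [] \<Longrightarrow> bs p (Seq c c') s s'' []"
  using bs.Seq[of p c s s' "[]" c' s'' "[]"] by simp

lemma bs_WhileS_Nil:
  "s r \<noteq> 0 \<Longrightarrow> bs p c s s' [] \<Longrightarrow> bs p (While r c) s' s'' [] \<Longrightarrow> bs p (While r c) s s'' []"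
  using bs.WhileS[of s r p c s' "[]" s'' "[]"] by simp

lemma bs_clear: "bs p (clear_com r) s (s(r := 0)) []"
  unfolding clear_com_def
proof (induction "s r" arbitrary: s)
  case 0
  then have "s(r := 0) = s" by auto
  with 0 show ?case using bs.While0[of s r] by simp
next
  case (Suc n)
  have "bs p (While r (Dec r)) (s(r := n)) (s(r := 0)) []"
    using Suc(1)[of "s(r := n)"] by simp
  moreover have "bs p (Dec r) s (s(r := n)) []" using Suc(2) by (intro bs.Dec) simp
  ultimately show ?case using Suc(2) bs_WhileS_Nil[of s r] by simp
qed

lemma bs_move:
  assumes "a \<noteq> b"
  shows "bs p (move_com a b) s (s(a := 0, b := s b + s a)) []"
  unfolding move_com_def
proof (induction "s a" arbitrary: s)
  case 0
  then have "s(a := 0, b := s b + s a) = s" by auto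
  with 0 show ?case using bs.While0[of s a] by (simp del: fun_upd_apply)
next
  case (Suc n)
  let ?s = "s(a := n, b := Suc (s b))"
  have "bs p (Seq (Dec a) (Inc b)) s ?s []"
    using bs.Dec[of s a n p] bs.Inc[of p b "s(a := n)"] Suc(2) assms bs_Seq_Nil by fastforce
  moreover have "?s(a := 0, b := ?s b + ?s a) = s(a := 0, b := s b + s a)"
    using Suc(2)[symmetric] assms by auto
  moreover have "?s a = n" using assms by simp
  ultimately show ?case
    using Suc(1)[of ?s] Suc(2) bs_WhileS_Nil[of s a] by (metis nat.distinct(1))
qed

lemma bs_copy:
  assumes "a < n" "s n = 0" "s (Suc n) = 0"
  shows "bs p (copy_com a n) s (s(n := s a)) []"
proof -
  have loop: "bs p (While a (Seq (Dec a) (Seq (Inc n) (Inc (Suc n))))) s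
      (s(a := 0, n := s n + s a, Suc n := s (Suc n) + s a)) []" for s
  proof (induction "s a" arbitrary: s)
    case 0
    then have "s(a := 0, n := s n + s a, Suc n := s (Suc n) + s a) = s" by auto
    with 0 show ?case using bs.While0[of s a] by (simp del: fun_upd_apply)
  next
    case (Suc m)
    let ?s = "s(a := m, n := Suc (s n), Suc n := Suc (s (Suc n)))"
    have 1: "bs p (Dec a) s (s(a := m)) []" using Suc(2) by (intro bs.Dec) simp
    have 2: "bs p (Inc n) (s(a := m)) (s(a := m, n := Suc (s n))) []"
      using bs.Inc[of p n "s(a := m)"] assms(1) by simp
    have 3: "bs p (Inc (Suc n)) (s(a := m, n := Suc (s n))) ?s []"
      using bs.Inc[of p "Suc n" "s(a := m, n := Suc (s n))"] assms(1) by simp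
    have "bs p (Seq (Dec a) (Seq (Inc n) (Inc (Suc n)))) s ?s []"
      using 1 2 3 bs_Seq_Nil by blast
    moreover have "?s(a := 0, n := ?s n + ?s a, Suc n := ?s (Suc n) + ?s a) =
        s(a := 0, n := s n + s a, Suc n := s (Suc n) + s a)"
      using Suc(2)[symmetric] assms(1) by auto
    moreover have "?s a = m" using assms(1) by simp
    ultimately show ?case
      using Suc(1)[of ?s] Suc(2) bs_WhileS_Nil[of s a] by (metis nat.distinct(1))
  qed
  let ?s = "s(a := 0, n := s n + s a, Suc n := s (Suc n) + s a)"
  have "?s(Suc n := 0, a := ?s a + ?s (Suc n)) = s(n := s a)" using assms by auto
  then show ?thesis
    unfolding copy_com_def using loop[of s] bs_move[of "Suc n" a p ?s] assms(1) bs_Seq_Nil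
    by (metis Suc_n_not_le_n less_imp_le_nat)
qed

text \<open>Nesting relies on the exact final state: all scratch registers above \<open>n\<close>
  are zero again, which is what the next subprogram assumes.\<close>

lemma bs_expr:
  assumes "\<And>i. \<rho> i < n" "\<And>k. k \<ge> n \<Longrightarrow> s k = 0"
  shows "bs p (expr_com t \<rho> n) s (s(n := eval t p (s \<circ> \<rho>))) []"
  using assms
proof (induction t arbitrary: \<rho> n s)
  case (V i)
  then show ?case using bs_copy[of "\<rho> i" n s p] by (simp del: fun_upd_apply)
next
  case Z
  then show ?case using bs_clear[of p n s] by (simp del: fun_upd_apply)
next
  case (S t)
  show ?case
    using bs_Seq_Nil[OF S(1)[of \<rho> n s, OF S(2,3)] bs.Inc[of p n]] by (simp del: fun_upd_apply add: fun_upd_same)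
next
  case (Query t)
  show ?case
    using bs_Seq_Nil[OF Query(1)[of \<rho> n s, OF Query(2,3)] bs.Rd[of p n]] by (simp del: fun_upd_apply add: fun_upd_same)
next
  case (Rec b t c)
  have IH: "bs p (expr_com x \<rho> n) s (s(n := eval x p (s \<circ> \<rho>))) []"
    if "x \<in> {b, t, c}" "\<And>i. \<rho> i < n" "\<And>k. k \<ge> n \<Longrightarrow> s k = 0" for x \<rho> n s
    using that(1) Rec.IH(1)[of \<rho> n s, OF that(2,3)] Rec.IH(2)[of \<rho> n s, OF that(2,3)] Rec.IH(3)[of \<rho> n s, OF that(2,3)]
    by blast
  define e where "e = s \<circ> \<rho>"
  define y where "y k = rec_nat (eval b p e) (\<lambda>k y. eval t p (case_nat y (case_nat k e))) k" for k
  define C where "C = eval c p e"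
  define \<sigma> where "\<sigma> = case_nat n (case_nat (n + 2) \<rho>)"
  define body where "body = Seq (expr_com t \<sigma> (n + 3))
     (Seq (clear_com n) (Seq (move_com (n + 3) n) (Seq (Inc (n + 2)) (Dec (Suc n)))))"
  \<comment> \<open>The loop state after \<open>k\<close> rounds: \<open>n\<close> holds the current
    value, \<open>n + 1\<close> the number of rounds left and \<open>n + 2\<close> the index of the
    next round.\<close>
  define st where "st k = s(n := y k, Suc n := C - k, n + 2 := k)" for k
  have e1: "s(n := v) \<circ> \<rho> = e" for v
    using Rec.prems(1) unfolding e_def by (auto simp: fun_eq_iff dest: less_imp_neq)
  have 1: "bs p (expr_com b \<rho> n) s (s(n := y 0)) []"
    using IH[of b \<rho> n s] Rec.prems by (simp del: fun_upd_apply add: y_def e_def)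
  have "bs p (expr_com c \<rho> (Suc n)) (s(n := y 0)) (s(n := y 0, Suc n := C)) []"
    using IH[of c \<rho> "Suc n" "s(n := y 0)"] Rec.prems e1
    by (simp add: C_def less_SucI)
  moreover have "s(n := y 0, Suc n := C) = st 0" using Rec.prems(2) by (auto simp: st_def)
  ultimately have 2: "bs p (expr_com c \<rho> (Suc n)) (s(n := y 0)) (st 0) []" by simp
  have body: "bs p body (st k) (st (Suc k)) []" if "k < C" for k
  proof -
    have \<sigma>: "\<sigma> i < n + 3" for i
      unfolding \<sigma>_def using Rec.prems(1) by (auto split: nat.split simp: trans_less_add1)
    have "st k \<circ> \<sigma> = case_nat (y k) (case_nat k e)"
    proof
      fix i show "(st k \<circ> \<sigma>) i = case_nat (y k) (case_nat k e) i"
        using Rec.prems(1)[of "i - 2"] by (auto simp: st_def \<sigma>_def e_def split: nat.split)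
    qed
    then have "eval t p (st k \<circ> \<sigma>) = y (Suc k)" by (simp add: y_def)
    then have a: "bs p (expr_com t \<sigma> (n + 3)) (st k) ((st k)(n + 3 := y (Suc k))) []"
      using IH[of t \<sigma> "n + 3" "st k", OF _ \<sigma>] Rec.prems(2) by (simp add: st_def)
    let ?s1 = "(st k)(n + 3 := y (Suc k))"
    let ?s2 = "?s1(n := 0)"
    let ?s3 = "?s2(n + 3 := 0, n := ?s2 n + ?s2 (n + 3))"
    let ?s4 = "?s3(n + 2 := Suc (?s3 (n + 2)))"
    have d: "bs p (Dec (Suc n)) ?s4 (?s4(Suc n := C - Suc k)) []"
      using that by (intro bs.Dec) (auto simp: st_def)
    have s5: "?s4(Suc n := C - Suc k) = st (Suc k)"
      using Rec.prems(2) by (auto simp: st_def)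
    have m: "bs p (move_com (n + 3) n) ?s2 ?s3 []" by (rule bs_move) simp
    have i: "bs p (Inc (n + 2)) ?s3 ?s4 []" by (rule bs.Inc)
    show ?thesis
      unfolding body_def using bs_Seq_Nil[OF a bs_Seq_Nil[OF bs_clear bs_Seq_Nil[OF m bs_Seq_Nil[OF i d]]]]
      by (simp only: s5)
  qed
  \<comment> \<open>The induction is on the number of rounds left, since \<open>While\<close>
    unfolds its first round.\<close>
  have loop: "bs p (While (Suc n) body) (st (C - m)) (st C) []" if "m \<le> C" for m
    using that
  proof (induction m)
    case 0
    have "st C (Suc n) = 0" by (simp add: st_def)
    then show ?case using bs.While0[of "st C" "Suc n" p body] by simp
  next
    case (Suc m)
    then have C: "C - m = Suc (C - Suc m)" by simp
    have "st (C - Suc m) (Suc n) \<noteq> 0" using Suc(2) by (simp add: st_def)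
    moreover have "bs p body (st (C - Suc m)) (st (C - m)) []"
      unfolding C using Suc(2) by (intro body) simp
    moreover have "bs p (While (Suc n) body) (st (C - m)) (st C) []"
      using Suc by (meson Suc_leD)
    ultimately show ?case by (rule bs_WhileS_Nil)
  qed
  have "(st C)(n + 2 := 0) = s(n := eval (Rec b t c) p (s \<circ> \<rho>))"
    using Rec.prems(2) by (auto simp: st_def y_def C_def e_def)
  then have "bs p (clear_com (n + 2)) (st C) (s(n := eval (Rec b t c) p (s \<circ> \<rho>))) []"
    using bs_clear[of p "n + 2" "st C"] by simp
  then show ?case
    using bs_Seq_Nil[OF 1 bs_Seq_Nil[OF 2 bs_Seq_Nil[OF loop[of C, unfolded diff_self_eq_0, OF order_refl]]]]
    unfolding expr_com.simps body_def \<sigma>_def by blast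
qed

section \<open>The endless loop of stages\<close>

definition emit_com :: "bool \<Rightarrow> com" where
  "emit_com b = While 2 (Seq (Dec 2) (Out b))"

lemma bs_emit: "bs p (emit_com b) s (s(2 := 0)) (replicate (s 2) b)"
  unfolding emit_com_def
proof (induction "s 2" arbitrary: s)
  case 0
  then have "s(2 := 0) = s" by auto
  with 0 show ?case using bs.While0[of s 2] by simp
next
  case (Suc n)
  have "bs p (Seq (Dec 2) (Out b)) s (s(2 := n)) ([] @ [b])"
    using Suc(2) by (intro bs.Seq[OF bs.Dec bs.Out]) simp
  then show ?case
    using bs.WhileS[of s 2 p _ "s(2 := n)"] Suc(1)[of "s(2 := n)"] Suc(2)[symmetric] by fastforce
qed

text \<open>Register 0 keeps the length of the advice word and register 1 the stage number. A stage
  produces two counts of letters rather than one bit, so it may also emit nothing while a search is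
  running.\<close>

definition stage_com :: "expr \<Rightarrow> expr \<Rightarrow> com" where
  "stage_com G0 G1 =
     Seq (expr_com G0 (case_nat 0 (\<lambda>_. 1)) 2) (Seq (emit_com False)
       (Seq (expr_com G1 (case_nat 0 (\<lambda>_. 1)) 2) (Seq (emit_com True) (Inc 1))))"

definition stage_regs :: "nat \<Rightarrow> nat \<Rightarrow> nat \<Rightarrow> nat" where
  "stage_regs k s = (\<lambda>r. if r = 0 then k else if r = 1 then s else 0)"

definition emission :: "(nat \<Rightarrow> nat) \<Rightarrow> (nat \<Rightarrow> nat) \<Rightarrow> nat \<Rightarrow> bool list" where
  "emission g0 g1 n = concat (map (\<lambda>s. replicate (g0 s) False @ replicate (g1 s) True) [0..<n])"

lemma bs_stage:
  "bs p (stage_com G0 G1) (stage_regs k s) (stage_regs k (Suc s))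
     (replicate (eval G0 p (case_nat k (\<lambda>_. s))) False @ replicate (eval G1 p (case_nat k (\<lambda>_. s))) True)"
proof -
  let ?r = "stage_regs k s" and ?\<rho> = "case_nat 0 (\<lambda>_. 1) :: nat \<Rightarrow> nat"
  have e: "?r \<circ> ?\<rho> = case_nat k (\<lambda>_. s)"
    by (auto simp: stage_regs_def fun_eq_iff split: nat.split)
  have \<rho>: "?\<rho> i < 2" for i by (cases i) auto
  have G: "bs p (expr_com G ?\<rho> 2) ?r (?r(2 := eval G p (case_nat k (\<lambda>_. s)))) []" for G
    using bs_expr[of ?\<rho> 2 ?r, OF \<rho>] e by (simp add: stage_regs_def)
  have E: "bs p (emit_com b) (?r(2 := n)) ?r (replicate n b)" for b n
  proof -
    have "?r(2 := n, 2 := 0) = ?r" by (auto simp: stage_regs_def)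
    then show ?thesis using bs_emit[of p b "?r(2 := n)"] by simp
  qed
  have I: "bs p (Inc 1) ?r (stage_regs k (Suc s)) []"
  proof -
    have "?r(1 := Suc (?r 1)) = stage_regs k (Suc s)" by (auto simp: stage_regs_def)
    then show ?thesis using bs.Inc[of p 1 ?r] by simp
  qed
  show ?thesis
    using bs.Seq[OF G[of G0] bs.Seq[OF E[of False] bs.Seq[OF G[of G1] bs.Seq[OF E[of True] I]]]]
    unfolding stage_com_def by simp
qed

text \<open>The first five instructions turn the length of the advice into a unary number on work
  tape 1, that is, into register 0.\<close>

definition stage_machine :: "expr \<Rightarrow> expr \<Rightarrow> machine" where
  "stage_machine G0 G1 =
     [In_Branch 1 None 5, In_Right 1, Work_Right 1, Work_Write 1 (Some True), Jump 0] @
     code (stage_com G0 G1) 5 @ [Jump 5]"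

lemma out_prefix_step: "\<exists>u. out (step M inp c) = out c @ u"
proof -
  have "\<exists>u. out (exec inp i c) = out c @ u" for i by (cases i) auto
  then show ?thesis by (simp add: step_def)
qed

lemma out_prefix_funpow: "\<exists>u. out ((step M inp ^^ n) c) = out c @ u"
proof (induction n)
  case (Suc n)
  then show ?case using out_prefix_step[of M inp "(step M inp ^^ n) c"] by auto
qed simp

lemma stage_machine_init:
  assumes inp: "inp 1 = fin_tape w"
  shows "\<exists>c'. reach (stage_machine G0 G1) inp init_config c' \<and> sim p (stage_regs (length w) 0) [] 0 c' \<and> pc c' = 5"
proof -
  let ?M = "stage_machine G0 G1"
  have L: "loaded ?M 0 [In_Branch 1 None 5, In_Right 1, Work_Right 1, Work_Write 1 (Some True), Jump 0]"
    by (simp add: loaded_Cons stage_machine_def)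
  have "\<exists>c'. reach ?M inp init_config c' \<and> sim p (stage_regs k 0) [] 0 c' \<and> pc c' = 0 \<and> in_pos c' 1 = k"
    if "k \<le> length w" for k
    using that
  proof (induction k)
    case 0
    have "sim p (stage_regs 0 0) [] 0 init_config" "pc init_config = 0" "in_pos init_config 1 = 0"
      by (auto simp: sim_def init_config_def stage_regs_def)
    then show ?case using reach_refl by blast
  next
    case (Suc k)
    then obtain c where c: "reach ?M inp init_config c" "sim p (stage_regs k 0) [] 0 c" "pc c = 0" "in_pos c 1 = k"
      by auto
    let ?c1 = "exec inp (In_Right 1) c"
    let ?c2 = "exec inp (Work_Write (Suc 0) (Some True)) (exec inp (Work_Right (Suc 0)) ?c1)"
    let ?c = "?c2\<lparr>pc := 0\<rparr>"
    obtain b where i: "inp 1 k = Some b" using Suc inp by (simp add: fin_tape_def)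
    have "sim p (stage_regs k 0) [] 0 ?c1" using c(2) unfolding sim_def by simp
    moreover have "(stage_regs k 0)(0 := Suc (stage_regs k 0 0)) = stage_regs (Suc k) 0"
      by (auto simp: stage_regs_def)
    ultimately have s: "sim p (stage_regs (Suc k) 0) [] 0 ?c"
      using sim_inc[of p "stage_regs k 0" "[]" 0 ?c1 0 inp] by (simp del: exec.simps)
    note F = c(3,4) i
    have "reach ?M inp c ?c"
      by (rule follows_reach[OF L, of _ "[0, 1, 2, 3, 4]"]) (use F in simp)
    moreover have "pc ?c = 0" "in_pos ?c 1 = Suc k" using c by simp_all
    ultimately show ?case using c(1) s reach_trans by blast
  qed
  from this[of "length w"] obtain c where c: "reach ?M inp init_config c"
      "sim p (stage_regs (length w) 0) [] 0 c" "pc c = 0" "in_pos c 1 = length w"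
    by auto
  let ?c = "c\<lparr>pc := 5\<rparr>"
  have i: "inp 1 (length w) = None" using inp by (simp add: fin_tape_def)
  have "reach ?M inp c ?c"
    by (rule follows_reach[OF L, of _ "[0]"]) (use c i in simp)
  then have "reach ?M inp init_config ?c" using c(1) reach_trans by blast
  then show ?thesis using c(2) by (intro exI[of _ ?c]) simp
qed

text \<open>Output is never erased, so the output at any time is a prefix of the output at a later
  stage boundary; it suffices to know the emissions at the boundaries.\<close>

theorem stage_machine_outputs:
  assumes g0: "\<And>s. eval G0 p (case_nat (length w) (\<lambda>_. s)) = g0 s"
    and g1: "\<And>s. eval G1 p (case_nat (length w) (\<lambda>_. s)) = g1 s"
    and q: "\<And>s i. i < length (emission g0 g1 s) \<Longrightarrow> emission g0 g1 s ! i = q i"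
    and inf: "\<And>m. \<exists>s. m \<le> length (emission g0 g1 s)"
  shows "outputs (stage_machine G0 G1) p w q"
proof -
  let ?M = "stage_machine G0 G1"
  define inp where "inp = (\<lambda>t::nat. if t = 0 then inf_tape p else if t = 1 then fin_tape w else (\<lambda>_. None))"
  have inp: "inp 0 = inf_tape p" "inp 1 = fin_tape w" unfolding inp_def by simp_all
  have L: "loaded ?M 5 (code (stage_com G0 G1) 5)" "loaded ?M (5 + clen (stage_com G0 G1)) [Jump 5]"
    by (auto simp: loaded_def stage_machine_def nth_append)
  have step: "\<exists>n c'. (step ?M inp ^^ Suc n) c = c' \<and> sim p (stage_regs (length w) (Suc s)) (emission g0 g1 (Suc s)) 0 c' \<and> pc c' = 5"
    if st: "sim p (stage_regs (length w) s) (emission g0 g1 s) 0 c" "pc c = 5" for s c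
  proof -
    let ?u = "replicate (g0 s) False @ replicate (g1 s) True"
    obtain c1 n where c1: "(step ?M inp ^^ n) c = c1" "pc c1 = 5 + clen (stage_com G0 G1)"
        "sim p (stage_regs (length w) (Suc s)) (emission g0 g1 s @ ?u) 0 c1"
      using code_correct[where inp = inp, OF bs_stage inp(1) L(1) st] unfolding g0 g1 reach_def by auto
    have "emission g0 g1 s @ ?u = emission g0 g1 (Suc s)" by (simp add: emission_def)
    moreover have "step ?M inp c1 = c1\<lparr>pc := 5\<rparr>"
      using L(2) c1(2) by (simp add: step_def loaded_Cons)
    ultimately show ?thesis
      using c1 by (intro exI[of _ n] exI[of _ "c1\<lparr>pc := 5\<rparr>"]) simp
  qed
  let ?c = "\<lambda>n. (step ?M inp ^^ n) init_config"
  \<comment> \<open>Every stage takes at least one step, hence stage \<open>s\<close> starts at time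
    \<open>s\<close> or later and the boundaries are cofinal in time.\<close>
  have stages: "\<exists>n\<ge>s. sim p (stage_regs (length w) s) (emission g0 g1 s) 0 (?c n)
      \<and> pc (?c n) = 5" for s
  proof (induction s)
    case 0
    then show ?case
      using stage_machine_init[where inp = inp, OF inp(2), of G0 G1 p]
      by (auto simp: reach_def emission_def)
  next
    case (Suc s)
    then obtain n where n: "n \<ge> s" "sim p (stage_regs (length w) s) (emission g0 g1 s) 0 (?c n)"
      "pc (?c n) = 5" by blast
    obtain m c' where m: "(step ?M inp ^^ Suc m) (?c n) = c'"
      "sim p (stage_regs (length w) (Suc s)) (emission g0 g1 (Suc s)) 0 c'" "pc c' = 5"
      using step[OF n(2,3)] by blast
    have "?c (Suc m + n) = c'"
      using m(1) by (simp only: funpow_add comp_apply)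
    with m(2,3) n(1) show ?case by (intro exI[of _ "Suc m + n"]) simp
  qed
  have out: "out (run ?M inp n) ! i = q i" if "i < length (out (run ?M inp n))" for n i
  proof -
    obtain m where m: "m \<ge> n" "sim p (stage_regs (length w) n) (emission g0 g1 n) 0 (?c m)"
      using stages[of n] by blast
    have "?c m = (step ?M inp ^^ (m - n)) (run ?M inp n)"
      using m(1) funpow_add[of "m - n" n "step ?M inp"] by (simp add: run_def)
    moreover have "out (?c m) = emission g0 g1 n"
      using m(2) by (simp add: sim_def)
    ultimately obtain u where "emission g0 g1 n = out (run ?M inp n) @ u"
      using out_prefix_funpow by metis
    with q[of i n] that show ?thesis by (simp add: nth_append)
  qed
  have len: "\<exists>n. m \<le> length (out (run ?M inp n))" for m
  proof -
    obtain s where s: "m \<le> length (emission g0 g1 s)" using inf by blast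
    obtain n where "sim p (stage_regs (length w) s) (emission g0 g1 s) 0 (?c n)"
      using stages[of s] by blast
    then have "out (run ?M inp n) = emission g0 g1 s" by (simp add: sim_def run_def)
    with s show ?thesis by metis
  qed
  show ?thesis
    unfolding outputs_def Let_def inp_def[symmetric] using out len by blast
qed

section \<open>Primitive recursive functionals\<close>

fun ren :: "(nat \<Rightarrow> nat) \<Rightarrow> expr \<Rightarrow> expr" where
  "ren r (V i) = V (r i)"
| "ren r Z = Z"
| "ren r (S t) = S (ren r t)"
| "ren r (Rec b t c) = Rec (ren r b) (ren (case_nat 0 (case_nat 1 (\<lambda>i. r i + 2))) t) (ren r c)"
| "ren r (Query t) = Query (ren r t)"

lemma eval_ren: "eval (ren r t) p e = eval t p (\<lambda>i. e (r i))"
proof (induction t arbitrary: r e)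
  case (Rec b t c)
  have "(\<lambda>i. case_nat y (case_nat k e) (case_nat 0 (case_nat 1 (\<lambda>i. r i + 2)) i)) =
      case_nat y (case_nat k (\<lambda>i. e (r i)))" for y k
    by (auto simp: fun_eq_iff split: nat.split)
  then show ?case by (simp only: ren.simps eval.simps Rec)
qed simp_all

fun subst_expr :: "(nat \<Rightarrow> expr) \<Rightarrow> expr \<Rightarrow> expr" where
  "subst_expr \<sigma> (V i) = \<sigma> i"
| "subst_expr \<sigma> Z = Z"
| "subst_expr \<sigma> (S t) = S (subst_expr \<sigma> t)"
| "subst_expr \<sigma> (Rec b t c) =
     Rec (subst_expr \<sigma> b) (subst_expr (case_nat (V 0) (case_nat (V 1) (\<lambda>i. ren (\<lambda>i. i + 2) (\<sigma> i)))) t)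
       (subst_expr \<sigma> c)"
| "subst_expr \<sigma> (Query t) = Query (subst_expr \<sigma> t)"

lemma eval_subst_expr: "eval (subst_expr \<sigma> t) p e = eval t p (\<lambda>i. eval (\<sigma> i) p e)"
proof (induction t arbitrary: \<sigma> e)
  case (Rec b t c)
  have "(\<lambda>i. eval (case_nat (V 0) (case_nat (V 1) (\<lambda>i. ren (\<lambda>i. i + 2) (\<sigma> i))) i) p (case_nat y (case_nat k e))) =
      case_nat y (case_nat k (\<lambda>i. eval (\<sigma> i) p e))" for y k
    by (auto simp: fun_eq_iff eval_ren split: nat.split)
  then show ?case by (simp only: subst_expr.simps eval.simps Rec)
qed simp_all

text \<open>\<open>pr\<close> and \<open>dec\<close> hide the syntax of expressions: a program is
  obtained by applying introduction rules to an ordinary function or predicate.\<close>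

definition pr :: "(inf_word \<Rightarrow> (nat \<Rightarrow> nat) \<Rightarrow> nat) \<Rightarrow> bool" where
  "pr f \<longleftrightarrow> (\<exists>t. \<forall>p e. eval t p e = f p e)"

definition dec :: "(inf_word \<Rightarrow> (nat \<Rightarrow> nat) \<Rightarrow> bool) \<Rightarrow> bool" where
  "dec P \<longleftrightarrow> pr (\<lambda>p e. of_bool (P p e))"

named_theorems pr_intros

lemma pr_comp:
  assumes "pr f" "\<And>i. pr (g i)"
  shows "pr (\<lambda>p e. f p (\<lambda>i. g i p e))"
proof -
  obtain t where t: "\<And>p e. eval t p e = f p e" using assms(1) unfolding pr_def by auto
  have "\<exists>\<sigma>. \<forall>i p e. eval (\<sigma> i) p e = g i p e"
    using assms(2) choice[of "\<lambda>i t. \<forall>p e. eval t p e = g i p e"] unfolding pr_def by blast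
  then obtain \<sigma> where \<sigma>: "\<And>i p e. eval (\<sigma> i) p e = g i p e" by blast
  have "eval (subst_expr \<sigma> t) p e = f p (\<lambda>i. g i p e)" for p e
    by (simp add: eval_subst_expr t \<sigma>)
  then show ?thesis unfolding pr_def by blast
qed

lemma pr_var [pr_intros]: "pr (\<lambda>p e. e i)"
  unfolding pr_def by (rule exI[of _ "V i"]) simp

lemma pr_ren: "pr f \<Longrightarrow> pr (\<lambda>p e. f p (\<lambda>i. e (r i)))"
  by (rule pr_comp) (auto intro: pr_var)

lemma pr_comp1: "pr (\<lambda>p e. F p (e 0)) \<Longrightarrow> pr f \<Longrightarrow> pr (\<lambda>p e. F p (f p e))"
  using pr_comp[of "\<lambda>p e. F p (e 0)" "\<lambda>i. f"] by simp

lemma pr_zero: "pr (\<lambda>p e. 0)"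
  unfolding pr_def by (rule exI[of _ Z]) simp

lemma pr_Suc [pr_intros]: "pr f \<Longrightarrow> pr (\<lambda>p e. Suc (f p e))"
  unfolding pr_def by (metis eval.simps(3))

lemma pr_const [pr_intros]: "pr (\<lambda>p e. n)"
  by (induction n) (auto intro: pr_zero pr_Suc)

lemma pr_rec:
  assumes "pr b" "pr c" "pr (\<lambda>p e. st p (\<lambda>i. e (Suc (Suc i))) (e 1) (e 0))"
  shows "pr (\<lambda>p e. rec_nat (b p e) (st p e) (c p e))"
proof -
  obtain tb tc t where t: "\<And>p e. eval tb p e = b p e" "\<And>p e. eval tc p e = c p e"
      "\<And>p e. eval t p e = st p (\<lambda>i. e (Suc (Suc i))) (e 1) (e 0)"
    using assms unfolding pr_def by metis
  have "eval (Rec tb t tc) p e = rec_nat (b p e) (st p e) (c p e)" for p e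
    by (simp add: t)
  then show ?thesis unfolding pr_def by blast
qed

lemma pr_query [pr_intros]: "pr f \<Longrightarrow> dec (\<lambda>p e. p (f p e))"
  unfolding dec_def pr_def by (metis eval.simps(5))

lemma pr_add [pr_intros]:
  assumes "pr f" "pr g"
  shows "pr (\<lambda>p e. f p e + g p e)"
proof -
  have "rec_nat m (\<lambda>k y. Suc y) n = m + n" for m n by (induction n) auto
  with pr_rec[OF assms, of "\<lambda>p e k y. Suc y"] show ?thesis by (simp add: pr_Suc pr_var)
qed

lemma pr_mult [pr_intros]:
  assumes "pr f" "pr g"
  shows "pr (\<lambda>p e. f p e * g p e)"
proof -
  have "rec_nat 0 (\<lambda>k y. y + m) n = m * n" for m n :: nat by (induction n) auto
  with pr_rec[OF pr_zero assms(2), of "\<lambda>p e k y. y + f p e"] show ?thesis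
    using pr_add[OF pr_var pr_ren[OF assms(1), of "\<lambda>i. Suc (Suc i)"], of 0] by simp
qed

lemma pr_diff [pr_intros]:
  assumes "pr f" "pr g"
  shows "pr (\<lambda>p e. f p e - g p e)"
proof -
  have pred: "pr (\<lambda>p e. e 0 - 1)"
  proof -
    have "rec_nat 0 (\<lambda>k y. k) n = n - 1" for n by (induction n) auto
    with pr_rec[OF pr_zero pr_var[of 0], of "\<lambda>p e k y. k"] show ?thesis by (simp add: pr_var)
  qed
  have "rec_nat m (\<lambda>k y. y - 1) n = m - n" for m n :: nat by (induction n) auto
  with pr_rec[OF assms, of "\<lambda>p e k y. y - 1"] pred show ?thesis by simp
qed

lemma pr_power [pr_intros]:
  assumes "pr f" "pr g"
  shows "pr (\<lambda>p e. f p e ^ g p e)"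
proof -
  have "rec_nat 1 (\<lambda>k y. y * m) n = m ^ n" for m n :: nat by (induction n) auto
  with pr_rec[OF pr_const[of 1] assms(2), of "\<lambda>p e k y. y * f p e"] show ?thesis
    using pr_mult[OF pr_var pr_ren[OF assms(1), of "\<lambda>i. Suc (Suc i)"], of 0] by simp
qed

text \<open>Counting by bounded sums takes the place of bounded search: quotients, the inverses of
  pairing and the decoding of the input are all expressed by it.\<close>

lemma pr_sum [pr_intros]:
  assumes "pr f" "pr (\<lambda>p e. g p (\<lambda>i. e (Suc i)) (e 0))"
  shows "pr (\<lambda>p e. \<Sum>x<f p e. g p e x)"
proof -
  have *: "rec_nat 0 (\<lambda>k y. y + h k) n = (\<Sum>x<n. h x)" for h :: "nat \<Rightarrow> nat" and n
    by (induction n) auto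
  have "pr (\<lambda>p e. g p (\<lambda>i. e (Suc (Suc i))) (e 1))"
    using pr_ren[OF assms(2), of "case_nat 1 (\<lambda>i. Suc (Suc i))"] by simp
  then have "pr (\<lambda>p e. e 0 + g p (\<lambda>i. e (Suc (Suc i))) (e 1))" by (rule pr_add[OF pr_var])
  with pr_rec[OF pr_zero assms(1), of "\<lambda>p e k y. y + g p e k"] show ?thesis
    unfolding * by simp
qed

lemma dec_not [pr_intros]: "dec P \<Longrightarrow> dec (\<lambda>p e. \<not> P p e)"
proof -
  have "of_bool (\<not> b) = 1 - (of_bool b :: nat)" for b by simp
  then show "dec P \<Longrightarrow> ?thesis"
    using pr_diff[OF pr_const[of 1], of "\<lambda>p e. of_bool (P p e)"] by (simp only: dec_def)
qed

lemma dec_conj [pr_intros]: "dec P \<Longrightarrow> dec Q \<Longrightarrow> dec (\<lambda>p e. P p e \<and> Q p e)"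
  using pr_mult[of "\<lambda>p e. of_bool (P p e)" "\<lambda>p e. of_bool (Q p e)"] by (simp add: dec_def of_bool_conj)

lemma dec_disj [pr_intros]: "dec P \<Longrightarrow> dec Q \<Longrightarrow> dec (\<lambda>p e. P p e \<or> Q p e)"
  using dec_not[OF dec_conj[OF dec_not dec_not], of P Q] by (simp only: de_Morgan_conj not_not)

lemma dec_imp [pr_intros]: "dec P \<Longrightarrow> dec Q \<Longrightarrow> dec (\<lambda>p e. P p e \<longrightarrow> Q p e)"
  using dec_disj[OF dec_not, of P Q] by (simp only: imp_conv_disj)

lemma dec_iff [pr_intros]: "dec P \<Longrightarrow> dec Q \<Longrightarrow> dec (\<lambda>p e. P p e \<longleftrightarrow> Q p e)"
proof -
  have eq: "(\<lambda>p e. P p e \<longleftrightarrow> Q p e) = (\<lambda>p e. (P p e \<longrightarrow> Q p e) \<and> (Q p e \<longrightarrow> P p e))"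
    by (intro ext) blast
  assume "dec P" "dec Q"
  then show ?thesis unfolding eq by (intro dec_conj dec_imp)
qed

lemma dec_const [pr_intros]: "dec (\<lambda>p e. b)"
  unfolding dec_def by (rule pr_const)

lemma dec_eq_0: "pr f \<Longrightarrow> dec (\<lambda>p e. f p e = 0)"
proof -
  assume "pr f"
  then have "pr (\<lambda>p e. 1 - f p e)" by (rule pr_diff[OF pr_const])
  moreover have "1 - f p e = of_bool (f p e = 0)" for p e by (cases "f p e") auto
  ultimately show ?thesis unfolding dec_def by simp
qed

lemma dec_le [pr_intros]: "pr f \<Longrightarrow> pr g \<Longrightarrow> dec (\<lambda>p e. f p e \<le> g p e)"
  using dec_eq_0[OF pr_diff, of f g] by simp

lemma dec_less [pr_intros]: "pr f \<Longrightarrow> pr g \<Longrightarrow> dec (\<lambda>p e. f p e < g p e)"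
  using dec_not[OF dec_le, of g f] by (simp add: not_le)

lemma dec_eq [pr_intros]: "pr f \<Longrightarrow> pr g \<Longrightarrow> dec (\<lambda>p e. f p e = g p e)"
  using dec_conj[OF dec_le dec_le, of f g g f] by (simp add: order_eq_iff)

lemma pr_if [pr_intros]:
  assumes "dec P" "pr f" "pr g"
  shows "pr (\<lambda>p e. if P p e then f p e else g p e)"
proof -
  have "(if P p e then f p e else g p e) = of_bool (P p e) * f p e + of_bool (\<not> P p e) * g p e" for p e
    by simp
  moreover have "pr (\<lambda>p e. of_bool (P p e) * f p e + of_bool (\<not> P p e) * g p e)"
    using assms dec_not[OF assms(1)] by (intro pr_intros) (simp_all add: dec_def)
  ultimately show ?thesis by simp
qed

lemma pr_of_bool [pr_intros]: "dec P \<Longrightarrow> pr (\<lambda>p e. of_bool (P p e))"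
  by (simp add: dec_def)

text \<open>For \<open>d \<noteq> 0\<close>, the quotient is the number of positive multiples of
  \<open>d\<close> up to the dividend.\<close>

lemma pr_div [pr_intros]:
  assumes "pr f"
  shows "pr (\<lambda>p e. f p e div d)"
proof (cases "d = 0")
  case True
  then show ?thesis by (simp add: pr_const)
next
  case False
  have "(\<Sum>q<n. of_bool (Suc q * d \<le> n)) = n div d" for n
  proof -
    have "q < n div d \<longleftrightarrow> Suc q * d \<le> n" for q
      using False less_eq_div_iff_mult_less_eq[of d "Suc q" n] by (simp add: Suc_le_eq)
    moreover have "q < n" if "Suc q * d \<le> n" for q
    proof -
      have "Suc q * 1 \<le> Suc q * d" using False by (intro mult_le_mono2) simp
      with that show ?thesis by simp
    qed
    ultimately have "{q. q < n \<and> Suc q * d \<le> n} = {..<n div d}" by blast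
    moreover have "(\<Sum>q<n. of_bool (Suc q * d \<le> n)) = card {q. q < n \<and> Suc q * d \<le> n}"
      by (simp add: sum.If_cases of_bool_def Int_def del: mult_Suc)
    ultimately show ?thesis by simp
  qed
  moreover have "pr (\<lambda>p e. \<Sum>q<e 0. of_bool (Suc q * d \<le> e 0))"
    by (intro pr_intros)
  ultimately have "pr (\<lambda>p e. e 0 div d)" by simp
  then show ?thesis using assms by (rule pr_comp1)
qed

lemma pr_mod [pr_intros]: "pr f \<Longrightarrow> pr (\<lambda>p e. f p e mod d)"
  using pr_diff[OF _ pr_mult[OF pr_const[of d] pr_div, of f d], of f]
  by (simp add: minus_mult_div_eq_mod)

lemma dec_ball [pr_intros]:
  assumes "finite A" "\<And>x. x \<in> A \<Longrightarrow> dec (\<lambda>p e. P p e x)"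
  shows "dec (\<lambda>p e. \<forall>x\<in>A. P p e x)"
  using assms by (induction A rule: finite_induct) (auto intro: pr_intros)

lemma dec_all [pr_intros]:
  "(\<And>x::'a::finite. dec (\<lambda>p e. P p e x)) \<Longrightarrow> dec (\<lambda>p e. \<forall>x. P p e x)"
  using dec_ball[of UNIV P] by simp

lemma dec_ex [pr_intros]:
  "(\<And>x::'a::finite. dec (\<lambda>p e. P p e x)) \<Longrightarrow> dec (\<lambda>p e. \<exists>x. P p e x)"
  using dec_not[OF dec_all[of "\<lambda>p e x. \<not> P p e x"]] dec_not by simp

section \<open>Coding of finite sequences\<close>

text \<open>Pairs with \<open>a + b = s\<close> are mapped between \<open>s ^ 2\<close> and
  \<open>s ^ 2 + s\<close>, below \<open>(s + 1) ^ 2\<close>. This is injective, though not onto,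
  and avoids the division in Cantor's pairing.\<close>

definition pair :: "nat \<Rightarrow> nat \<Rightarrow> nat" where
  "pair a b = (a + b)^2 + a"

definition pfst :: "nat \<Rightarrow> nat" where
  "pfst n = (\<Sum>a<Suc n. \<Sum>b<Suc n. if pair a b = n then a else 0)"

definition psnd :: "nat \<Rightarrow> nat" where
  "psnd n = (\<Sum>a<Suc n. \<Sum>b<Suc n. if pair a b = n then b else 0)"

lemma pair_inject: "pair a b = pair c d \<Longrightarrow> a = c \<and> b = d"
proof -
  have lt: "pair a b < pair c d" if "a + b < c + d" for a b c d
  proof -
    have "pair a b < (a + b + 1)^2" by (simp add: pair_def power2_eq_square algebra_simps)
    also have "\<dots> \<le> (c + d)^2" using that by (intro power_mono) auto
    finally show ?thesis by (simp add: pair_def)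
  qed
  assume e: "pair a b = pair c d"
  then have "a + b = c + d" using lt[of a b c d] lt[of c d a b] by (metis less_irrefl linorder_neqE_nat)
  with e show ?thesis by (simp add: pair_def)
qed

lemma pair_ge: "a \<le> pair a b" "b \<le> pair a b"
proof -
  have "b \<le> b\<^sup>2" by (simp add: power2_eq_square)
  also have "\<dots> \<le> (a + b)\<^sup>2" by (intro power_mono) auto
  finally show "b \<le> pair a b" by (simp add: pair_def)
qed (simp add: pair_def)

text \<open>By injectivity only the summand at \<open>x\<close> and \<open>y\<close> can be nonzero,
  and \<open>pair_ge\<close> puts it within the range of summation.\<close>

lemma pair_sum: "(\<Sum>a<Suc (pair x y). \<Sum>b<Suc (pair x y). if pair a b = pair x y then f a b else 0) = (f x y :: nat)"
proof -
  let ?n = "Suc (pair x y)"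
  have inj: "pair a b = pair x y \<longleftrightarrow> a = x \<and> b = y" for a b using pair_inject by blast
  have "(\<Sum>a<?n. \<Sum>b<?n. if pair a b = pair x y then f a b else 0) =
      (\<Sum>a<?n. \<Sum>b<?n. if b = y then if a = x then f a b else 0 else 0)"
    unfolding inj by (intro sum.cong refl) simp
  also have "\<dots> = (\<Sum>a<?n. if a = x then f a y else 0)"
    using pair_ge(2)[of y x] by (intro sum.cong refl) (simp add: sum.delta less_Suc_eq_le)
  also have "\<dots> = f x y"
    using pair_ge(1)[of x y] by (simp add: sum.delta less_Suc_eq_le)
  finally show ?thesis .
qed

lemma pfst_pair [simp]: "pfst (pair a b) = a" and psnd_pair [simp]: "psnd (pair a b) = b"
  unfolding pfst_def psnd_def by (rule pair_sum[where f = "\<lambda>a b. a"], rule pair_sum[where f = "\<lambda>a b. b"])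

lemma pr_pair [pr_intros]: "pr f \<Longrightarrow> pr g \<Longrightarrow> pr (\<lambda>p e. pair (f p e) (g p e))"
  unfolding pair_def by (intro pr_intros)

lemma pr_pfst [pr_intros]: "pr f \<Longrightarrow> pr (\<lambda>p e. pfst (f p e))"
proof (erule pr_comp1[rotated])
  show "pr (\<lambda>p e. pfst (e 0))" unfolding pfst_def by (intro pr_intros)
qed

lemma pr_psnd [pr_intros]: "pr f \<Longrightarrow> pr (\<lambda>p e. psnd (f p e))"
proof (erule pr_comp1[rotated])
  show "pr (\<lambda>p e. psnd (e 0))" unfolding psnd_def by (intro pr_intros)
qed

fun enc :: "nat list \<Rightarrow> nat" where
  "enc [] = 0"
| "enc (x # xs) = pair x (enc xs)"

text \<open>Total on all numbers, so a search through all codes needs no test for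
  well-formedness.\<close>

fun component :: "nat \<Rightarrow> nat \<Rightarrow> nat" where
  "component t 0 = pfst t"
| "component t (Suc i) = component (psnd t) i"

lemma component_enc: "i < length xs \<Longrightarrow> component (enc xs) i = xs ! i"
proof (induction xs arbitrary: i)
  case (Cons x xs)
  then show ?case by (cases i) auto
qed simp

lemma ex_components: "\<exists>t. \<forall>i<n. component t i = f i"
  by (rule exI[of _ "enc (map f [0..<n])"]) (simp add: component_enc)

lemma pr_component [pr_intros]: "pr f \<Longrightarrow> pr (\<lambda>p e. component (f p e) i)"
  by (induction i arbitrary: f) (auto intro: pr_intros)

section \<open>Rational-valued functionals\<close>

text \<open>Rational values in the format of \<open>rat_of_triple\<close>: separate positive and
  negative parts avoid truncated subtraction, and the shifted denominator never vanishes.\<close>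

definition rq :: "(inf_word \<Rightarrow> (nat \<Rightarrow> nat) \<Rightarrow> real) \<Rightarrow> bool" where
  "rq f \<longleftrightarrow> (\<exists>a b c. pr a \<and> pr b \<and> pr c \<and>
     (\<forall>p e. f p e = (real (a p e) - real (b p e)) / (real (c p e) + 1)))"

lemma rqI:
  "pr a \<Longrightarrow> pr b \<Longrightarrow> pr c \<Longrightarrow> (\<And>p e. f p e = (real (a p e) - real (b p e)) / (real (c p e) + 1)) \<Longrightarrow> rq f"
  unfolding rq_def by blast

lemma rqE:
  assumes "rq f"
  obtains a b c where "pr a" "pr b" "pr c"
    "\<And>p e. f p e = (real (a p e) - real (b p e)) / (real (c p e) + 1)"
  using assms unfolding rq_def by blast

lemma rq_of_nat [pr_intros]: "pr f \<Longrightarrow> rq (\<lambda>p e. real (f p e))"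
  by (rule rqI[of f "\<lambda>_ _. 0" "\<lambda>_ _. 0"]) (auto intro: pr_intros)

lemma rq_numeral [pr_intros]: "rq (\<lambda>p e. numeral n)"
  using rq_of_nat[OF pr_const[of "numeral n"]] by simp

lemma rq_zero [pr_intros]: "rq (\<lambda>p e. 0)"
  using rq_of_nat[OF pr_const[of 0]] by simp

lemma rq_one [pr_intros]: "rq (\<lambda>p e. 1)"
  using rq_of_nat[OF pr_const[of 1]] by simp

lemma rq_uminus [pr_intros]: "rq f \<Longrightarrow> rq (\<lambda>p e. - f p e)"
proof (erule rqE)
  fix a b c
  assume "pr a" "pr b" "pr c" and f: "\<And>p e. f p e = (real (a p e) - real (b p e)) / (real (c p e) + 1)"
  then show ?thesis by (intro rqI[of b a c]) (auto simp: f field_simps)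
qed

lemma rq_add [pr_intros]: "rq f \<Longrightarrow> rq g \<Longrightarrow> rq (\<lambda>p e. f p e + g p e)"
proof (elim rqE)
  fix a b c a' b' c'
  assume p: "pr a" "pr b" "pr c" "pr a'" "pr b'" "pr c'"
    and f: "\<And>p e. f p e = (real (a p e) - real (b p e)) / (real (c p e) + 1)"
    and g: "\<And>p e. g p e = (real (a' p e) - real (b' p e)) / (real (c' p e) + 1)"
  have "f p e + g p e = (real (a p e * Suc (c' p e) + a' p e * Suc (c p e)) -
      real (b p e * Suc (c' p e) + b' p e * Suc (c p e))) / (real (c p e * c' p e + c p e + c' p e) + 1)" for p e
  proof -
    have ne: "real (c p e) + 1 \<noteq> 0" "real (c' p e) + 1 \<noteq> 0" by linarith+
    show ?thesis
      unfolding f g add_frac_eq[OF ne]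
      by (intro arg_cong2[where f = "(/)"]) (simp_all add: algebra_simps)
  qed
  then show ?thesis
    by (rule rqI[rotated 3]) (intro pr_intros p)+
qed

lemma rq_mult [pr_intros]: "rq f \<Longrightarrow> rq g \<Longrightarrow> rq (\<lambda>p e. f p e * g p e)"
proof (elim rqE)
  fix a b c a' b' c'
  assume p: "pr a" "pr b" "pr c" "pr a'" "pr b'" "pr c'"
    and f: "\<And>p e. f p e = (real (a p e) - real (b p e)) / (real (c p e) + 1)"
    and g: "\<And>p e. g p e = (real (a' p e) - real (b' p e)) / (real (c' p e) + 1)"
  have "real (c p e * c' p e + c p e + c' p e) + 1 = (real (c p e) + 1) * (real (c' p e) + 1)" for p e
    by (simp add: algebra_simps)
  moreover have "real n + 1 \<noteq> 0" for n by linarith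
  ultimately show ?thesis
    by (intro rqI[of "\<lambda>p e. a p e * a' p e + b p e * b' p e"
          "\<lambda>p e. a p e * b' p e + b p e * a' p e" "\<lambda>p e. c p e * c' p e + c p e + c' p e"])
      (intro pr_intros p, intro pr_intros p, intro pr_intros p,
        simp only: f g times_divide_times_eq, simp add: algebra_simps)
qed

lemma rq_diff [pr_intros]: "rq f \<Longrightarrow> rq g \<Longrightarrow> rq (\<lambda>p e. f p e - g p e)"
  using rq_add[OF _ rq_uminus, of f g] by simp

lemma rq_divide_Suc [pr_intros]: "rq f \<Longrightarrow> pr g \<Longrightarrow> rq (\<lambda>p e. f p e / (real (g p e) + 1))"
  using rq_mult[of f, OF _ rqI[of "\<lambda>_ _. 1" "\<lambda>_ _. 0" g]] by (simp add: pr_const)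

lemma rq_divide_power2 [pr_intros]: "rq f \<Longrightarrow> pr g \<Longrightarrow> rq (\<lambda>p e. f p e / 2 ^ g p e)"
  using rq_divide_Suc[of f "\<lambda>p e. 2 ^ g p e - 1", OF _ pr_diff[OF pr_power[OF pr_const] pr_const]]
  by (simp add: of_nat_diff)

lemma rq_divide_of_nat [pr_intros]: "rq f \<Longrightarrow> rq (\<lambda>p e. f p e / real n)"
proof (cases n)
  case (Suc m)
  then show "rq f \<Longrightarrow> ?thesis" using rq_divide_Suc[of f "\<lambda>p e. m", OF _ pr_const] by (simp add: add.commute)
qed (simp add: rq_zero)

lemma rq_abs [pr_intros]: "rq f \<Longrightarrow> rq (\<lambda>p e. \<bar>f p e\<bar>)"
proof (erule rqE)
  fix a b c
  assume p: "pr a" "pr b" "pr c" and f: "\<And>p e. f p e = (real (a p e) - real (b p e)) / (real (c p e) + 1)"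
  have "\<bar>real m - real n\<bar> = real ((m - n) + (n - m))" for m n by auto
  with p show ?thesis
    by (intro rqI[of "\<lambda>p e. (a p e - b p e) + (b p e - a p e)" "\<lambda>_ _. 0" c])
      (auto intro: pr_intros simp: f abs_divide simp del: of_nat_add of_nat_diff)
qed

lemma rq_sum [pr_intros]: "(\<And>x. x \<in> A \<Longrightarrow> rq (\<lambda>p e. f p e x)) \<Longrightarrow> rq (\<lambda>p e. \<Sum>x\<in>A. f p e x)"
  by (induction A rule: infinite_finite_induct) (auto intro: pr_intros)

lemma dec_rq_le [pr_intros]: "rq f \<Longrightarrow> rq g \<Longrightarrow> dec (\<lambda>p e. f p e \<le> g p e)"
proof (elim rqE)
  fix a b c a' b' c'
  assume p: "pr a" "pr b" "pr c" "pr a'" "pr b'" "pr c'"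
    and f: "\<And>p e. f p e = (real (a p e) - real (b p e)) / (real (c p e) + 1)"
    and g: "\<And>p e. g p e = (real (a' p e) - real (b' p e)) / (real (c' p e) + 1)"
  have "f p e \<le> g p e \<longleftrightarrow> a p e * Suc (c' p e) + b' p e * Suc (c p e) \<le> a' p e * Suc (c p e) + b p e * Suc (c' p e)"
    for p e
  proof -
    have "f p e \<le> g p e \<longleftrightarrow> (real (a p e) - real (b p e)) * (real (c' p e) + 1) \<le> (real (a' p e) - real (b' p e)) * (real (c p e) + 1)"
      by (simp add: f g divide_le_eq pos_le_divide_eq)
    also have "\<dots> \<longleftrightarrow> real (a p e * Suc (c' p e) + b' p e * Suc (c p e)) \<le> real (a' p e * Suc (c p e) + b p e * Suc (c' p e))"
      by (simp add: algebra_simps)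
    finally show ?thesis by (simp only: of_nat_le_iff)
  qed
  then show ?thesis using p by (simp only:) (intro pr_intros)
qed

lemma dec_rq_eq [pr_intros]: "rq f \<Longrightarrow> rq g \<Longrightarrow> dec (\<lambda>p e. f p e = g p e)"
  using dec_conj[OF dec_rq_le dec_rq_le, of f g g f] by (simp add: order_eq_iff)

lemma rq_cong_if [pr_intros]: "rq f \<Longrightarrow> rq g \<Longrightarrow> rq (\<lambda>p e. if b then f p e else g p e)"
  by (cases b) simp_all

section \<open>Approximate eigenvectors\<close>

text \<open>The approximate eigenvalues \<open>\<mu>\<close> have as many values as \<open>A\<close> has eigenvalues, and their gaps exceed the
  residuals by far; hence each eigenvalue of \<open>A\<close> is close to exactly one value of \<open>\<mu>\<close>, and projecting \<open>v i\<close>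
  to the eigenspace next to \<open>\<mu> i\<close> moves it by at most \<open>\<epsilon>\<close>.\<close>

lemma nearby_eigenvectors:
  fixes A :: "real^'n^'n" and v :: "'n \<Rightarrow> real^'n"
  assumes sym: "transpose A = A" and k: "card (spectrum A) = k" "card (range \<mu>) = k"
    and R: "R > 0" and \<epsilon>: "0 < \<epsilon>" "\<epsilon> \<le> 1 / 2"
    and v: "\<And>i. norm (v i) \<ge> 1 / 2"
    and res: "\<And>i. norm (A *v v i - \<mu> i *\<^sub>R v i) \<le> R"
    and gap: "\<And>i j. \<mu> i = \<mu> j \<or> 4 * R \<le> \<bar>\<mu> i - \<mu> j\<bar> * \<epsilon>"
  shows "\<exists>u c. (\<forall>i. A *v u i = c i *\<^sub>R u i) \<and> (\<forall>i. norm (u i - v i) \<le> \<epsilon>) \<and> card (range c) = k"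
proof -
  obtain w :: "real^'n^'n" and b where w: "\<And>i. A *v w $ i = b i *\<^sub>R w $ i"
      "\<And>i j. inner (w $ i) (w $ j) = (if i = j then 1 else 0)"
    using symmetric_orthonormal_eigenbasis[OF sym] by metis
  note parseval = orthonormal_imp_basis_tuple(2)[OF w(2)]
  have spec: "spectrum A = range b"
    by (rule spectrum_eq_range[OF sym orthonormal_imp_basis_tuple(1)[OF w(2)] w(1)])
  let ?D = "\<lambda>i l. (b l - \<mu> i)\<^sup>2 * (inner (w $ l) (v i))\<^sup>2"
  have resw: "(\<Sum>l\<in>UNIV. ?D i l) \<le> R\<^sup>2" for i
  proof -
    have "inner (w $ l) (A *v v i - \<mu> i *\<^sub>R v i) = (b l - \<mu> i) * inner (w $ l) (v i)" for l
      using inner_matrix_commute[OF sym, of "w $ l" "v i"] w(1)[of l] by (simp add: inner_diff_right algebra_simps)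
    then have "(norm (A *v v i - \<mu> i *\<^sub>R v i))\<^sup>2 = (\<Sum>l\<in>UNIV. ?D i l)"
      unfolding parseval by (simp add: power_mult_distrib)
    moreover have "(norm (A *v v i - \<mu> i *\<^sub>R v i))\<^sup>2 \<le> R\<^sup>2" using res[of i] by (intro power_mono) auto
    ultimately show ?thesis by simp
  qed
  \<comment> \<open>Were all eigenvalues farther than \<open>2 * R\<close> from
    \<open>\<mu> i\<close>, Parseval's identity would make the residual exceed
    \<open>2 * R * norm (v i)\<close>, which is at least \<open>R\<close>.\<close>
  have near: "\<exists>c\<in>spectrum A. \<bar>c - \<mu> i\<bar> \<le> 2 * R" for i
  proof (rule ccontr)
    assume "\<not> ?thesis"
    then have far: "2 * R < \<bar>b l - \<mu> i\<bar>" for l unfolding spec by (metis not_le rangeI)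
    have far2: "(2 * R)\<^sup>2 < (b l - \<mu> i)\<^sup>2" for l
      using power_strict_mono[OF far[of l], of 2] R by simp
    have pos: "0 < (norm (v i))\<^sup>2" using v[of i] by (intro zero_less_power) linarith
    have "R\<^sup>2 \<le> (2 * R)\<^sup>2 * (norm (v i))\<^sup>2"
      using mult_mono[OF order_refl[of "(2 * R)\<^sup>2"] power_mono[OF v[of i], of 2]] R
      by (simp add: power2_eq_square)
    also have "\<dots> = (\<Sum>l\<in>UNIV. (2 * R)\<^sup>2 * (inner (w $ l) (v i))\<^sup>2)" by (simp add: parseval sum_distrib_left)
    also have "\<dots> < (\<Sum>l\<in>UNIV. ?D i l)"
    proof (rule sum_strict_mono_ex1)
      show "\<forall>l\<in>UNIV. (2 * R)\<^sup>2 * (inner (w $ l) (v i))\<^sup>2 \<le> ?D i l"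
        using far2 by (intro ballI mult_right_mono) (auto intro: less_imp_le)
      have "v i \<noteq> 0" using pos by auto
      then obtain l where "inner (w $ l) (v i) \<noteq> 0"
        using orthonormal_imp_basis_tuple(1)[OF w(2)] unfolding basis_tuple_iff_kernel by blast
      then show "\<exists>l\<in>UNIV. (2 * R)\<^sup>2 * (inner (w $ l) (v i))\<^sup>2 < ?D i l"
        using far2[of l] by (intro bexI[of _ l] mult_strict_right_mono) auto
    qed simp
    also have "\<dots> \<le> R\<^sup>2" by (rule resw)
    finally show False by simp
  qed
  \<comment> \<open>The eigenvalue is chosen as a function of the value of \<mu>, not of the index,
    so equal approximations share it. Injectivity on \<open>range \<mu>\<close> and equal
    cardinalities then make \<open>g\<close> a bijection onto the spectrum.\<close>
  define g where "g x = (SOME c. c \<in> spectrum A \<and> \<bar>c - x\<bar> \<le> 2 * R)" for x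
  have g: "g (\<mu> i) \<in> spectrum A" "\<bar>g (\<mu> i) - \<mu> i\<bar> \<le> 2 * R" for i
    using someI_ex[of "\<lambda>c. c \<in> spectrum A \<and> \<bar>c - \<mu> i\<bar> \<le> 2 * R"] near[of i] unfolding g_def by blast+
  have sep: "4 * R / \<epsilon> \<le> \<bar>\<mu> i - \<mu> j\<bar>" if "\<mu> i \<noteq> \<mu> j" for i j
    using gap[of i j] that \<epsilon>(1) by (simp add: divide_le_eq)
  have R\<epsilon>: "2 * R \<le> R / \<epsilon>"
    using R \<epsilon> by (simp add: le_divide_eq)
  have "inj_on g (range \<mu>)"
  proof (rule inj_onI, clarify)
    fix i j assume e: "g (\<mu> i) = g (\<mu> j)"
    show "\<mu> i = \<mu> j"
    proof (rule ccontr)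
      assume "\<mu> i \<noteq> \<mu> j"
      then have "4 * R / \<epsilon> \<le> \<bar>\<mu> i - \<mu> j\<bar>" by (rule sep)
      moreover have "\<bar>\<mu> i - \<mu> j\<bar> \<le> 4 * R" using g(2)[of i] g(2)[of j] e by linarith
      moreover have "4 * R / \<epsilon> = 4 * (R / \<epsilon>)" by simp
      ultimately show False using R\<epsilon> R by linarith
    qed
  qed
  then have "card (g ` range \<mu>) = card (spectrum A)" using k by (simp add: card_image)
  moreover have "g ` range \<mu> \<subseteq> spectrum A" using g(1) by blast
  ultimately have gs: "g ` range \<mu> = spectrum A"
    using finite_spectrum(1)[OF sym] by (intro card_subset_eq) auto
  define c where "c i = g (\<mu> i)" for i
  define u where "u i = (\<Sum>l\<in>UNIV. (if b l = c i then inner (w $ l) (v i) else 0) *\<^sub>R w $ l)" for i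
  have "A *v u i = c i *\<^sub>R u i" for i
    unfolding u_def linear_sum[OF matrix_vector_mul_linear] scaleR_sum_right
    by (intro sum.cong refl) (simp add: matrix_vector_mult_scaleR w(1))
  moreover have "norm (u i - v i) \<le> \<epsilon>" for i
  proof -
    have wu: "inner (w $ l) (u i - v i) = (if b l = c i then 0 else - inner (w $ l) (v i))" for l
    proof -
      have "inner (w $ l) (u i) = (\<Sum>m\<in>UNIV. if l = m then (if b m = c i then inner (w $ m) (v i) else 0) else 0)"
        unfolding u_def inner_sum_right by (intro sum.cong refl) (simp add: w(2))
      also have "\<dots> = (if b l = c i then inner (w $ l) (v i) else 0)" by simp
      finally show ?thesis by (simp add: inner_diff_right)
    qed
    \<comment> \<open>The components removed from \<open>v i\<close> belong to eigenvalues at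
      distance at least \<open>R / \<epsilon>\<close> from \<open>\<mu> i\<close>; weighted by this
      distance they are dominated by the residual.\<close>
    have "(R / \<epsilon>)\<^sup>2 * (norm (u i - v i))\<^sup>2 = (\<Sum>l\<in>UNIV. (R / \<epsilon>)\<^sup>2 * (inner (w $ l) (u i - v i))\<^sup>2)"
      unfolding parseval by (simp add: sum_distrib_left)
    also have "\<dots> \<le> (\<Sum>l\<in>UNIV. ?D i l)"
    proof (rule sum_mono)
      fix l :: 'n
      show "(R / \<epsilon>)\<^sup>2 * (inner (w $ l) (u i - v i))\<^sup>2 \<le> ?D i l"
      proof (cases "b l = c i")
        case True
        then show ?thesis by (simp add: wu)
      next
        case False
        have "b l \<in> g ` range \<mu>" using gs spec by blast
        then obtain j where j: "b l = g (\<mu> j)" by blast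
        then have "\<mu> j \<noteq> \<mu> i" using False by (auto simp: c_def)
        then have "4 * R / \<epsilon> \<le> \<bar>\<mu> j - \<mu> i\<bar>" by (rule sep)
        moreover have "4 * R / \<epsilon> = 4 * (R / \<epsilon>)" by simp
        ultimately have "R / \<epsilon> \<le> \<bar>b l - \<mu> i\<bar>" using g(2)[of j] j R\<epsilon> R by linarith
        then have "(R / \<epsilon>)\<^sup>2 \<le> (b l - \<mu> i)\<^sup>2"
          using power_mono[of "R / \<epsilon>" "\<bar>b l - \<mu> i\<bar>" 2] R \<epsilon>(1) by simp
        then show ?thesis using False by (simp add: wu mult_right_mono)
      qed
    qed
    also have "\<dots> \<le> R\<^sup>2" by (rule resw)
    finally have "(R / \<epsilon> * norm (u i - v i))\<^sup>2 \<le> R\<^sup>2" by (simp only: power_mult_distrib)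
    then have "R / \<epsilon> * norm (u i - v i) \<le> R" using R by (meson less_imp_le power2_le_imp_le)
    then show ?thesis using R \<epsilon>(1) by (simp add: field_simps)
  qed
  moreover have "card (range c) = k"
  proof -
    have "range c = g ` range \<mu>" by (auto simp: c_def)
    then show ?thesis using gs k(1) by simp
  qed
  ultimately show ?thesis by blast
qed

section \<open>Decoding the input\<close>

definition false_count :: "inf_word \<Rightarrow> nat \<Rightarrow> nat" where
  "false_count q x = (\<Sum>y<x. of_bool (\<not> q y))"

text \<open>Counts the \<open>True\<close> letters preceded by exactly \<open>m\<close> separators;
  once \<open>x\<close> is beyond block \<open>m\<close>, this is the encoded number
  \<open>n m\<close>.\<close>

definition run_length :: "inf_word \<Rightarrow> nat \<Rightarrow> nat \<Rightarrow> nat" where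
  "run_length q m x = (\<Sum>y<x. of_bool (q y \<and> false_count q y = m))"

definition approx :: "inf_word \<Rightarrow> nat \<Rightarrow> nat \<Rightarrow> real" where
  "approx q m x = (real (run_length q (3 * m) x) - real (run_length q (3 * m + 1) x)) /
     (real (run_length q (3 * m + 2) x) + 1)"

lemma false_count_mono: "x \<le> y \<Longrightarrow> false_count q x \<le> false_count q y"
  unfolding false_count_def by (rule sum_mono2) auto

lemma false_count_encoded:
  assumes "encodes_seq q n" "l \<le> n k"
  shows "false_count q ((\<Sum>j<k. Suc (n j)) + l) = k"
  using assms(2)
proof (induction k arbitrary: l)
  case 0
  have "q y" if "y < l" for y
    using assms(1)[unfolded encodes_seq_def, rule_format, of 0] that 0 by auto
  then show ?case by (simp add: false_count_def)
next
  case (Suc k)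
  let ?s = "\<lambda>k. \<Sum>j<k. Suc (n j)"
  have base: "false_count q (?s (Suc k)) = Suc k"
  proof -
    have "?s (Suc k) = Suc (?s k + n k)" by simp
    then have "false_count q (?s (Suc k)) = false_count q (?s k + n k) + of_bool (\<not> q (?s k + n k))"
      by (simp add: false_count_def)
    then show ?thesis using Suc.IH[of "n k"] assms(1) by (simp add: encodes_seq_def)
  qed
  show ?case
    using Suc.prems
  proof (induction l)
    case 0
    then show ?case using base by simp
  next
    case (Suc l)
    have "q (?s (Suc k) + l)"
      using assms(1) Suc.prems unfolding encodes_seq_def by (meson Suc_le_eq)
    then show ?case using Suc by (simp add: false_count_def)
  qed
qed

text \<open>The condition on \<open>B\<close> says that the separator closing block \<open>m\<close>
  lies below \<open>B\<close>. It is decidable, so the search can demand it of a candidate.\<close>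

lemma run_length_encoded:
  assumes q: "encodes_seq q n" and B: "m < false_count q B"
  shows "run_length q m B = n m"
proof -
  let ?s = "\<lambda>k. \<Sum>j<k. Suc (n j)"
  have BB: "?s m + n m < B"
    using false_count_mono[of B "?s m + n m" q] false_count_encoded[OF q, of "n m" m] B
    by (metis order_refl linorder_not_le)
  have "{y. y < B \<and> q y \<and> false_count q y = m} = {?s m..<?s m + n m}"
  proof (intro equalityI subsetI)
    fix y assume "y \<in> {y. y < B \<and> q y \<and> false_count q y = m}"
    then have y: "q y" "false_count q y = m" by auto
    have "?s m \<le> y"
    proof (rule ccontr)
      assume "\<not> ?thesis"
      then have lt: "y < ?s m" by simp
      then obtain m' where m: "m = Suc m'" by (cases m) auto
      with lt have "y \<le> ?s m' + n m'" by simp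
      from false_count_mono[OF this, of q] show False
        using false_count_encoded[OF q, of "n m'" m'] y(2) m by simp
    qed
    moreover have "y \<noteq> ?s m + n m" using y(1) q by (auto simp: encodes_seq_def)
    moreover have "\<not> ?s m + n m < y"
    proof
      assume "?s m + n m < y"
      then have "?s (Suc m) + 0 \<le> y" by simp
      from false_count_mono[OF this, of q] show False
        using false_count_encoded[OF q, of 0 "Suc m"] y(2) by simp
    qed
    ultimately show "y \<in> {?s m..<?s m + n m}" by auto
  next
    fix y assume "y \<in> {?s m..<?s m + n m}"
    then obtain l where l: "y = ?s m + l" "l < n m" by (metis add.commute atLeastLessThan_iff le_Suc_ex nat_add_left_cancel_less)
    then show "y \<in> {y. y < B \<and> q y \<and> false_count q y = m}"
      using q BB false_count_encoded[OF q, of l m] by (auto simp: encodes_seq_def)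
  qed
  moreover have "run_length q m B = card {y. y < B \<and> q y \<and> false_count q y = m}"
    by (simp add: run_length_def sum.If_cases of_bool_def Int_def)
  ultimately show ?thesis by simp
qed

lemma approx_rho:
  assumes "rho q x" "3 * m + 2 < false_count q B"
  shows "\<bar>x - approx q m B\<bar> \<le> 1 / 2 ^ m"
proof -
  obtain n where n: "encodes_seq q n"
      "\<bar>x - of_rat (rat_of_triple (n (3*m)) (n (3*m+1)) (n (3*m+2)))\<bar> \<le> 1 / 2 ^ m"
    using assms(1) unfolding rho_def by blast
  have "approx q m B = of_rat (rat_of_triple (n (3*m)) (n (3*m+1)) (n (3*m+2)))"
    using assms(2) run_length_encoded[OF n(1), of _ B]
    by (simp add: approx_def rat_of_triple_def of_rat_divide of_rat_diff of_rat_add add.commute)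
  with n(2) show ?thesis by simp
qed

lemma ex_false_count_greater:
  assumes "rho q x"
  shows "\<exists>B. m < false_count q B"
proof -
  obtain n where n: "encodes_seq q n" using assms unfolding rho_def by blast
  from false_count_encoded[OF n, of 0 "Suc m"] show ?thesis by (metis le0 lessI)
qed

lemma pr_false_count [pr_intros]:
  assumes "pr f"
  shows "pr (\<lambda>p e. false_count (\<lambda>m. p (s * m + i)) (f p e))"
  by (rule pr_comp1[OF _ assms]) (unfold false_count_def, intro pr_intros)

lemma pr_run_length [pr_intros]:
  assumes "pr f" "pr g"
  shows "pr (\<lambda>p e. run_length (\<lambda>m. p (s * m + i)) (f p e) (g p e))"
proof -
  have "pr (\<lambda>p e. run_length (\<lambda>m. p (s * m + i)) (e 0) (e 1))"
    unfolding run_length_def by (intro pr_intros)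
  from pr_comp[OF this, of "case_nat f (\<lambda>_. g)"] assms show ?thesis by (auto split: nat.split)
qed

lemma rq_approx [pr_intros]:
  "pr f \<Longrightarrow> pr g \<Longrightarrow> rq (\<lambda>p e. approx (\<lambda>m. p (s * m + i)) (f p e) (g p e))"
  unfolding approx_def by (intro pr_intros)


section \<open>Candidates for approximate eigenvectors\<close>

text \<open>A candidate \<open>t\<close> codes, in this order: the numbers \<open>K\<close> and \<open>c\<close>, the bound \<open>1 / (r + 1)\<close> of the
  residuals, the precision \<open>m\<close> and the bound \<open>B\<close> used for reading the input, for each entry of the
  tuple a number \<open>a \<le> K\<close> standing for \<open>(a - (K - a)) / (c + 1)\<close>, and the approximate eigenvalues.\<close>

definition cand_num :: "nat \<Rightarrow> 'n::{finite,linorder} \<Rightarrow> 'n \<Rightarrow> nat" where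
  "cand_num t i l = component t (5 + (CARD('n) * rank_of i + rank_of l))"

definition cand_entry :: "nat \<Rightarrow> 'n::{finite,linorder} \<Rightarrow> 'n \<Rightarrow> real" where
  "cand_entry t i l = (real (cand_num t i l) - real (component t 0 - cand_num t i l)) / (real (component t 1) + 1)"

definition cand_eig :: "nat \<Rightarrow> 'n::{finite,linorder} \<Rightarrow> real" where
  "cand_eig t i =
     (real (component t (5 + CARD('n) * CARD('n) + 3 * rank_of i)) -
      real (component t (5 + CARD('n) * CARD('n) + 3 * rank_of i + 1))) /
     (real (component t (5 + CARD('n) * CARD('n) + 3 * rank_of i + 2)) + 1)"

definition stream :: "'n::finite itself \<Rightarrow> inf_word \<Rightarrow> nat \<Rightarrow> inf_word" where
  "stream (_ :: 'n itself) p i = (\<lambda>m. p (CARD('n) * (CARD('n) + 1) div 2 * m + i))"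

definition cand_matrix :: "inf_word \<Rightarrow> nat \<Rightarrow> 'n::{finite,linorder} \<Rightarrow> 'n \<Rightarrow> real" where
  "cand_matrix p t i j =
     approx (stream TYPE('n) p (upper_index (min i j) (max i j))) (component t 3) (component t 4)"

text \<open>The last summand bounds the error of replacing row \<open>l\<close> of the matrix by
  approximations, so this is an upper bound for the true component of the residual, computed from
  rationals only.\<close>

definition cand_residual :: "inf_word \<Rightarrow> nat \<Rightarrow> 'n::{finite,linorder} \<Rightarrow> 'n \<Rightarrow> real" where
  "cand_residual p t i l =
     \<bar>(\<Sum>y\<in>UNIV. cand_matrix p t l y * cand_entry t i y) - cand_eig t i * cand_entry t i l\<bar> +
     (\<Sum>y\<in>UNIV. \<bar>cand_entry t i y\<bar>) / 2 ^ component t 3"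

text \<open>With \<open>d = CARD('n)\<close>, componentwise bounds \<open>1 / (r + 1)\<close> give
  residuals of norm at most \<open>R = d / (r + 1)\<close>, and the gaps have to be at least
  \<open>4 * R / \<epsilon>\<close> for the radius
  \<open>\<epsilon> = 1 / (64 * d ^ 2) / 2 ^ j\<close>; this explains the factor
  \<open>4 * d\<close>. The allowed distance to the previous candidate is twice the radius of the
  previous round.\<close>

definition admissible ::
  "'n::{finite,linorder} itself \<Rightarrow> inf_word \<Rightarrow> nat \<Rightarrow> nat \<Rightarrow> nat \<Rightarrow> nat \<Rightarrow> bool" where
  "admissible (_ :: 'n itself) p k j t' t \<longleftrightarrow>
     (\<forall>(i::'n) (l::'n). cand_num t i l \<le> component t 0) \<and>
     (\<forall>i\<in>{..<CARD('n) * (CARD('n) + 1) div 2}. 3 * component t 3 + 2 < false_count (stream TYPE('n) p i) (component t 4)) \<and>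
     (\<forall>(i::'n) (l::'n). cand_residual p t i l \<le> 1 / (real (component t 2) + 1)) \<and>
     (\<forall>(i::'n) (l::'n). cand_eig t i = cand_eig t l \<or>
        real (4 * CARD('n)) / (real (component t 2) + 1) \<le>
        \<bar>cand_eig t i - cand_eig t l\<bar> * (1 / real (64 * CARD('n)^2) / 2 ^ j)) \<and>
     card (range (cand_eig t :: 'n \<Rightarrow> real)) = k \<and>
     (\<forall>(i::'n) (l::'n). \<bar>(\<Sum>y\<in>UNIV. cand_entry t i y * cand_entry t l y) - (if i = l then 1 else 0)\<bar>
        \<le> (2 - 1 / 2 ^ j) / real (4 * CARD('n))) \<and>
     (j = 0 \<or> (\<forall>(i::'n) (l::'n). \<bar>cand_entry t i l - cand_entry t' i l\<bar> \<le> 4 / real (64 * CARD('n)^2) / 2 ^ j))"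

lemma card_range_eq:
  fixes f :: "'n::finite \<Rightarrow> 'a" and g :: "'n \<Rightarrow> 'b"
  assumes "\<And>i l. f i = f l \<longleftrightarrow> g i = g l"
  shows "card (range f) = card (range g)"
proof (rule bij_betw_same_card[of "\<lambda>x. g (SOME i. f i = x)"])
  have s: "g (SOME j. f j = f i) = g i" for i
    using someI[of "\<lambda>j. f j = f i" i] assms by blast
  then show "bij_betw (\<lambda>x. g (SOME i. f i = x)) (range f) (range g)"
    unfolding bij_betw_def inj_on_def using assms by (auto simp: image_image)
qed

text \<open>The cardinality depends only on which values coincide, and every such pattern is that of
  one of the finitely many maps from the index type to itself.\<close>

lemma dec_card_range:
  fixes f :: "inf_word \<Rightarrow> (nat \<Rightarrow> nat) \<Rightarrow> 'n::finite \<Rightarrow> real"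
  assumes "\<And>i. rq (\<lambda>p e. f p e i)" "pr k"
  shows "dec (\<lambda>p e. card (range (f p e)) = k p e)"
proof -
  have "card (range (f p e)) = k p e \<longleftrightarrow>
    (\<exists>g :: 'n \<Rightarrow> 'n. (\<forall>i l. (f p e i = f p e l) \<longleftrightarrow> g i = g l) \<and> card (range g) = k p e)" (is "_ \<longleftrightarrow> (\<exists>g. ?P g)") for p e
  proof -
    define g where "g i = (SOME j. f p e j = f p e i)" for i
    have g: "f p e (g i) = f p e i" for i unfolding g_def by (rule someI[of _ i]) simp
    have eq: "f p e i = f p e l \<longleftrightarrow> g i = g l" for i l
    proof
      show "f p e i = f p e l \<Longrightarrow> g i = g l" by (simp add: g_def)
      show "g i = g l \<Longrightarrow> f p e i = f p e l" using g[of i] g[of l] by simp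
    qed
    show ?thesis
    proof
      assume "card (range (f p e)) = k p e"
      then show "\<exists>g. ?P g"
        using card_range_eq[of "f p e" g, OF eq] eq by auto
    next
      assume "\<exists>g. ?P g"
      then obtain g :: "'n \<Rightarrow> 'n" where "\<And>i l. (f p e i = f p e l) \<longleftrightarrow> g i = g l" "card (range g) = k p e"
        by auto
      then show "card (range (f p e)) = k p e" using card_range_eq[of "f p e" g] by simp
    qed
  qed
  moreover have "dec (\<lambda>p e. \<exists>g :: 'n \<Rightarrow> 'n. (\<forall>i l. (f p e i = f p e l) \<longleftrightarrow> g i = g l) \<and> card (range g) = k p e)"
    by (intro pr_intros assms)
  ultimately show ?thesis by simp
qed

lemma dec_admissible [pr_intros]:
  assumes "pr k" "pr j" "pr t'" "pr t"
  shows "dec (\<lambda>p e. admissible TYPE('n::{finite,linorder}) p (k p e) (j p e) (t' p e) (t p e))"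
  unfolding admissible_def cand_residual_def cand_matrix_def cand_entry_def cand_num_def cand_eig_def stream_def
  by (intro pr_intros dec_card_range assms finite_lessThan)

declare component.simps [simp del]

lemma rank_of_less: "rank_of (i :: 'n::{finite,linorder}) < CARD('n)"
  using rank_of_bij[where 'n = 'n] by (auto simp: bij_betw_def)

lemma inv_rank_of: "inv rank_of (rank_of (i :: 'n::{finite,linorder})) = i"
  using rank_of_bij[where 'n = 'n] by (simp add: bij_betw_def)

lemma radius_bounds:
  "0 < 1 / real (64 * CARD('n::finite)^2) / 2 ^ j" "1 / real (64 * CARD('n)^2) / 2 ^ j \<le> 1 / 2"
proof -
  have "1 \<le> CARD('n)" using zero_less_card_finite[where 'a = 'n] by linarith
  then have "1 \<le> CARD('n)\<^sup>2" by simp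
  then have "2 \<le> 64 * CARD('n)\<^sup>2" by linarith
  then have "2 \<le> real (64 * CARD('n)\<^sup>2)" by (metis of_nat_le_iff of_nat_numeral)
  then have "1 / real (64 * CARD('n)^2) \<le> 1 / 2" by (intro frac_le) auto
  then have "1 / real (64 * CARD('n)^2) / 2 ^ j \<le> 1 / 2 / 2 ^ j" by (intro divide_right_mono) auto
  also have "\<dots> \<le> 1 / 2 / 1" by (intro divide_left_mono) auto
  finally show "1 / real (64 * CARD('n)^2) / 2 ^ j \<le> 1 / 2" by simp
qed simp

section \<open>Soundness of candidates\<close>

lemma cand_matrix_close:
  fixes A :: "'n::{finite,linorder} sq_matrix"
  assumes A: "sym_matrix_rep p A"
    and B: "\<And>i. i < CARD('n) * (CARD('n) + 1) div 2 \<Longrightarrow>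
      3 * component t 3 + 2 < false_count (stream TYPE('n) p i) (component t 4)"
  shows "\<bar>A $ i $ j - cand_matrix p t i j\<bar> \<le> 1 / 2 ^ component t 3"
proof -
  obtain x where x: "rho_pow (CARD('n) * (CARD('n) + 1) div 2) p x"
      "\<And>i j. i \<le> j \<Longrightarrow> A $ i $ j = x (upper_index i j)" and sym: "transpose A = A"
    using A unfolding sym_matrix_rep_def by blast
  have "(transpose A) $ j $ i = A $ i $ j" by (simp add: transpose_def)
  then have e: "A $ i $ j = x (upper_index (min i j) (max i j))"
    using x(2)[of i j] x(2)[of j i] sym by (cases "i \<le> j") (auto simp: min_def max_def)
  have lt: "upper_index (min i j) (max i j) < CARD('n) * (CARD('n) + 1) div 2"
    using bij_betwE[OF upper_index_bij[where 'n='n], THEN bspec, of "(min i j, max i j)"]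
      order_trans[OF min.cobounded1 max.cobounded1, of i j] by simp
  then have "rho (stream TYPE('n) p (upper_index (min i j) (max i j))) (A $ i $ j)"
    using x(1) unfolding rho_pow_def stream_def e by blast
  then show ?thesis unfolding cand_matrix_def using B[OF lt] by (rule approx_rho)
qed

definition cand_vec :: "nat \<Rightarrow> 'n::{finite,linorder} \<Rightarrow> (real, 'n) vec" where
  "cand_vec t i = (\<chi> l. cand_entry t i l)"

lemma inner_cand_vec: "inner (cand_vec t i) (cand_vec t l) = (\<Sum>y\<in>UNIV. cand_entry t i y * cand_entry t l y)"
  by (simp add: cand_vec_def inner_vec_def)

lemma admissible_gram:
  fixes i l :: "'n::{finite,linorder}"
  assumes "admissible TYPE('n) p k j t' t"
  shows "\<bar>inner (cand_vec t i) (cand_vec t l) - (if i = l then 1 else 0)\<bar> \<le> (2 - 1 / 2 ^ j) / real (4 * CARD('n))"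
  using assms unfolding admissible_def inner_cand_vec by blast

lemma admissible_norm:
  fixes i :: "'n::{finite,linorder}"
  assumes "admissible TYPE('n) p k j t' t"
  shows "1 / 2 \<le> norm (cand_vec t i)" "norm (cand_vec t i) \<le> 3 / 2"
proof -
  have "(2 - 1 / 2 ^ j) / real (4 * CARD('n)) \<le> 2 / 4"
  proof (rule frac_le)
    have "0 < CARD('n)" by simp
    then have "1 \<le> CARD('n)" by linarith
    then show "4 \<le> real (4 * CARD('n))" by simp
  qed simp_all
  moreover have "\<bar>inner (cand_vec t i) (cand_vec t i) - 1\<bar> \<le> (2 - 1 / 2 ^ j) / real (4 * CARD('n))"
    using admissible_gram[OF assms, of i i] by simp
  ultimately have "\<bar>inner (cand_vec t i) (cand_vec t i) - 1\<bar> \<le> 1 / 2" by linarith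
  then have "\<bar>(norm (cand_vec t i))\<^sup>2 - 1\<bar> \<le> 1 / 2" by (simp only: power2_norm_eq_inner)
  moreover have "(1 / 2 :: real)\<^sup>2 = 1 / 4" "(3 / 2 :: real)\<^sup>2 = 9 / 4" by (simp_all add: power2_eq_square)
  ultimately have "(1 / 2)\<^sup>2 \<le> (norm (cand_vec t i))\<^sup>2" "(norm (cand_vec t i))\<^sup>2 \<le> (3 / 2)\<^sup>2"
    by linarith+
  then show "1 / 2 \<le> norm (cand_vec t i)" "norm (cand_vec t i) \<le> 3 / 2"
    by (auto intro: power2_le_imp_le)
qed

text \<open>An instance of \<open>nearby_eigenvectors\<close> with
  \<open>R = CARD('n) / (r + 1)\<close>, where the Euclidean norm of the residual is bounded by the
  sum of its components.\<close>

lemma admissible_sound: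
  fixes A :: "'n::{finite,linorder} sq_matrix"
  assumes A: "sym_matrix_rep p A" "card (spectrum A) = k" and adm: "admissible TYPE('n) p k j t' t"
  shows "\<exists>u c. (\<forall>i. A *v u i = c i *\<^sub>R u i) \<and>
    (\<forall>i. norm (u i - cand_vec t i) \<le> 1 / real (64 * CARD('n)^2) / 2 ^ j) \<and> card (range c) = k"
proof (rule nearby_eigenvectors)
  let ?r = "1 / (real (component t 2) + 1)" and ?m = "component t 3"
  show "transpose A = A" using A(1) by (simp add: sym_matrix_rep_def)
  show "card (spectrum A) = k" by fact
  show "card (range (cand_eig t :: 'n \<Rightarrow> real)) = k" using adm by (simp add: admissible_def)
  show "0 < real CARD('n) * ?r" by simp
  show "0 < 1 / real (64 * CARD('n)^2) / 2 ^ j" by simp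
  show "1 / real (64 * CARD('n)^2) / 2 ^ j \<le> 1 / 2" by (rule radius_bounds)
  show "1 / 2 \<le> norm (cand_vec t i)" for i :: 'n using adm by (rule admissible_norm)
  show "cand_eig t i = cand_eig t l \<or>
      4 * (real CARD('n) * ?r) \<le> \<bar>cand_eig t i - cand_eig t l\<bar> * (1 / real (64 * CARD('n)^2) / 2 ^ j)"
    for i l :: 'n
    using adm unfolding admissible_def by simp
  have close: "\<bar>A $ i $ j - cand_matrix p t i j\<bar> \<le> 1 / 2 ^ ?m" for i j
    using adm by (intro cand_matrix_close[OF A(1)]) (simp add: admissible_def)
  show "norm (A *v cand_vec t i - cand_eig t i *\<^sub>R cand_vec t i) \<le> real CARD('n) * ?r" for i
  proof -
    let ?v = "A *v cand_vec t i - cand_eig t i *\<^sub>R cand_vec t i"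
    have "\<bar>?v $ l\<bar> \<le> ?r" for l
    proof -
      have "?v $ l =
          ((\<Sum>y\<in>UNIV. cand_matrix p t l y * cand_entry t i y) - cand_eig t i * cand_entry t i l) +
          (\<Sum>y\<in>UNIV. (A $ l $ y - cand_matrix p t l y) * cand_entry t i y)"
        by (simp add: matrix_vector_mult_def cand_vec_def algebra_simps sum.distrib[symmetric])
      also have "\<bar>\<dots>\<bar> \<le> \<bar>(\<Sum>y\<in>UNIV. cand_matrix p t l y * cand_entry t i y) - cand_eig t i * cand_entry t i l\<bar> +
          (\<Sum>y\<in>UNIV. \<bar>(A $ l $ y - cand_matrix p t l y) * cand_entry t i y\<bar>)"
        by (intro order_trans[OF abs_triangle_ineq] add_left_mono sum_abs)
      also have "\<dots> \<le> cand_residual p t i l"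
        unfolding cand_residual_def sum_divide_distrib
        proof (intro add_left_mono sum_mono)
          fix y
          show "\<bar>(A $ l $ y - cand_matrix p t l y) * cand_entry t i y\<bar> \<le> \<bar>cand_entry t i y\<bar> / 2 ^ ?m"
            using mult_right_mono[OF close[of l y] abs_ge_zero[of "cand_entry t i y"]] by (simp add: abs_mult)
        qed
      also have "\<dots> \<le> ?r" using adm by (simp add: admissible_def)
      finally show ?thesis .
    qed
    then have "(\<Sum>l\<in>UNIV. \<bar>?v $ l\<bar>) \<le> (\<Sum>l\<in>(UNIV::'n set). ?r)"
      by (intro sum_mono)
    moreover have "(\<Sum>l\<in>(UNIV::'n set). ?r) = real CARD('n) * ?r" by simp
    ultimately show ?thesis
      using norm_le_l1_cart[of ?v] by linarith
  qed
qed

section \<open>Existence and refinement of candidates\<close>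

lemma floor_approximation:
  "(\<lambda>s. of_int \<lfloor>y * (real s + 1)\<rfloor> / (real s + 1)) \<longlonglongrightarrow> (y :: real)" (is "?F \<longlonglongrightarrow> _")
proof -
  have "norm (?F s - y) \<le> inverse (real (Suc s))" for s
  proof -
    let ?z = "y * (real s + 1)"
    have "?F s - y = (of_int \<lfloor>?z\<rfloor> - ?z) / (real s + 1)" by (simp add: field_simps)
    moreover have "\<bar>of_int \<lfloor>?z\<rfloor> - ?z\<bar> \<le> 1" by linarith
    ultimately have "norm (?F s - y) \<le> 1 / (real s + 1)"
      by (simp only: real_norm_def abs_divide) (intro divide_mono, auto)
    then show ?thesis by (simp add: inverse_eq_divide add.commute)
  qed
  then have "(\<lambda>s. ?F s - y) \<longlonglongrightarrow> 0"
    by (intro Lim_null_comparison[OF _ LIMSEQ_inverse_real_of_nat] always_eventually allI)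
  then show ?thesis by (simp add: LIM_zero_iff)
qed

lemma ex_candidate:
  fixes a :: "'n::{finite,linorder} \<Rightarrow> 'n \<Rightarrow> nat"
  shows "\<exists>t. component t 0 = K \<and> component t 1 = c \<and> component t 2 = r \<and> component t 3 = m \<and> component t 4 = B \<and>
    (\<forall>i l. cand_num t i l = a i l) \<and>
    (\<forall>i::'n. cand_eig t i = (real (x i) - real (y i)) / (real (z i) + 1))"
proof -
  let ?d = "CARD('n)"
  let ?i = "inv (rank_of :: 'n \<Rightarrow> nat)"
  define f where "f n =
    (if n < 5 then [K, c, r, m, B] ! n
     else if n < 5 + ?d * ?d then a (?i ((n - 5) div ?d)) (?i ((n - 5) mod ?d))
     else ([x, y, z] ! ((n - 5 - ?d * ?d) mod 3)) (?i ((n - 5 - ?d * ?d) div 3)))" for n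
  obtain t where t: "\<And>n. n < 5 + ?d * ?d + 3 * ?d \<Longrightarrow> component t n = f n"
    using ex_components[of "5 + ?d * ?d + 3 * ?d" f] by blast
  have n: "cand_num t i l = a i l" for i l
    using t[of "5 + (?d * rank_of i + rank_of l)"] tuple_index_less[of i l] rank_of_less[of l]
    by (simp add: cand_num_def f_def inv_rank_of)
  have e: "component t (5 + ?d * ?d + 3 * rank_of i + h) = ([x, y, z] ! h) i" if "h < 3" for i h
  proof -
    have "(3 * rank_of i + h) mod 3 = h" "(3 * rank_of i + h) div 3 = rank_of i" using that by auto
    moreover have "5 + ?d * ?d + 3 * rank_of i + h < 5 + ?d * ?d + 3 * ?d" using rank_of_less[of i] that by linarith
    ultimately show ?thesis using t[of "5 + ?d * ?d + 3 * rank_of i + h"] by (simp add: f_def inv_rank_of)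
  qed
  have "cand_eig t i = (real (x i) - real (y i)) / (real (z i) + 1)" for i
    using e[of 0 i] e[of 1 i] e[of 2 i] by (simp add: cand_eig_def)
  moreover have "component t 0 = K \<and> component t 1 = c \<and> component t 2 = r \<and> component t 3 = m \<and> component t 4 = B"
    using t[of 0] t[of 1] t[of 2] t[of 3] t[of 4] by (simp add: f_def)
  ultimately show ?thesis using n by blast
qed

text \<open>At the exact data the conditions on residuals, gaps, Gram matrix and distance hold with
  room to spare, so they hold for rational data of sufficiently high precision
  \<open>s\<close>.\<close>

lemma admissible_exists:
  fixes A :: "'n::{finite,linorder} sq_matrix" and u :: "'n \<Rightarrow> (real, 'n) vec"
  assumes A: "sym_matrix_rep p A" and u: "\<And>i. A *v u i = c i *\<^sub>R u i" and k: "card (range c) = k"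
    and gram: "\<And>i l. \<bar>inner (u i) (u l) - (if i = l then 1 else 0)\<bar> < (2 - 1 / 2 ^ j) / real (4 * CARD('n))"
    and prev: "j = 0 \<or> (\<forall>i l. \<bar>u i $ l - cand_entry t' i l\<bar> < 4 / real (64 * CARD('n)^2) / 2 ^ j)"
  shows "\<exists>t. admissible TYPE('n) p k j t' t"
proof -
  let ?N = "CARD('n) * (CARD('n) + 1) div 2"
  let ?\<epsilon> = "1 / real (64 * CARD('n)^2) / 2 ^ j"
  have \<epsilon>: "?\<epsilon> > 0" by simp
  have "\<exists>g>0. \<forall>i l. c i \<noteq> c l \<longrightarrow> g \<le> \<bar>c i - c l\<bar>"
  proof (intro exI conjI allI impI)
    let ?S = "insert 1 ((\<lambda>(i, l). \<bar>c i - c l\<bar>) ` {(i, l). c i \<noteq> c l})"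
    show "Min ?S > 0" by (subst Min_gr_iff) auto
    show "Min ?S \<le> \<bar>c i - c l\<bar>" if "c i \<noteq> c l" for i l
      using that by (intro Min_le) auto
  qed
  then obtain g where g: "g > 0" "\<And>i l. c i \<noteq> c l \<Longrightarrow> g \<le> \<bar>c i - c l\<bar>" by blast
  have "g * ?\<epsilon> / real (4 * CARD('n)) > 0" using g(1) \<epsilon> by simp
  \<comment> \<open>The residual bound is fixed first, from the smallest gap \<open>g\<close>; it
    stays constant while the precision \<open>s\<close> grows.\<close>
  then obtain r where "inverse (real (Suc r)) < g * ?\<epsilon> / real (4 * CARD('n))" using reals_Archimedean by blast
  then have r: "real (4 * CARD('n)) / (real r + 1) < g * ?\<epsilon>"
    by (simp add: field_simps)
  have "\<exists>B. \<forall>i<?N. 3 * m + 2 < false_count (stream TYPE('n) p i) B" for m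
  proof -
    have "\<exists>B. 3 * m + 2 < false_count (stream TYPE('n) p i) B" if "i < ?N" for i
      using A that unfolding sym_matrix_rep_def rho_pow_def stream_def by (blast intro: ex_false_count_greater)
    then obtain B where B: "\<And>i. i < ?N \<Longrightarrow> 3 * m + 2 < false_count (stream TYPE('n) p i) (B i)" by metis
    have "3 * m + 2 < false_count (stream TYPE('n) p i) (\<Sum>i<?N. B i)" if "i < ?N" for i
    proof -
      have "B i \<le> (\<Sum>i<?N. B i)" using that by (intro member_le_sum) auto
      from false_count_mono[OF this, of "stream TYPE('n) p i"] B[OF that] show ?thesis by linarith
    qed
    then show ?thesis by blast
  qed
  then obtain B where B: "\<And>m i. i < ?N \<Longrightarrow> 3 * m + 2 < false_count (stream TYPE('n) p i) (B m)" by metis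
  define F where "F s y = \<lfloor>y * (real s + 1)\<rfloor>" for s :: nat and y :: real
  \<comment> \<open>For \<open>K = 2 * (s + 1) ^ 2\<close> the numerator \<open>a - (K - a)\<close>
    equals \<open>2 * a - K\<close>; hence the halved entry, shifted by half of \<open>K\<close>.
    For large \<open>s\<close> the shift makes the argument of \<open>nat\<close> non-negative and
    \<open>a\<close> at most \<open>K\<close>.\<close>
  define a where "a s i l = nat (F s (u i $ l / 2) + (int s + 1)\<^sup>2)" for s i l
  have "\<exists>t. component t 0 = 2 * (s + 1)\<^sup>2 \<and> component t 1 = s \<and> component t 2 = r \<and> component t 3 = s \<and>
      component t 4 = B s \<and> (\<forall>i l. cand_num t i l = a s i l) \<and>
      (\<forall>i::'n. cand_eig t i = (real (nat (F s (c i))) - real (nat (- F s (c i)))) / (real s + 1))" for s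
    by (rule ex_candidate)
  then obtain T where T: "\<And>s. component (T s) 0 = 2 * (s + 1)\<^sup>2" "\<And>s. component (T s) 1 = s"
      "\<And>s. component (T s) 2 = r" "\<And>s. component (T s) 3 = s" "\<And>s. component (T s) 4 = B s"
      "\<And>s i l. cand_num (T s) i l = a s i l"
      "\<And>s (i::'n). cand_eig (T s) i = (real (nat (F s (c i))) - real (nat (- F s (c i)))) / (real s + 1)"
    by metis
  have ev_a: "\<forall>\<^sub>F s in sequentially. cand_num (T s) i l \<le> component (T s) 0 \<and>
      cand_entry (T s) i l = 2 * (of_int (F s (u i $ l / 2)) / (real s + 1))" for i l
  proof -
    obtain s0 where s0: "\<bar>u i $ l\<bar> \<le> real s0" using real_arch_simple by blast
    have "cand_num (T s) i l \<le> component (T s) 0 \<and>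
      cand_entry (T s) i l = 2 * (of_int (F s (u i $ l / 2)) / (real s + 1))" if s: "s \<ge> s0" for s
    proof -
      let ?x = "u i $ l / 2 * (real s + 1)"
      have "\<bar>u i $ l\<bar> \<le> real s" using s0 s by simp
      then have "\<bar>u i $ l\<bar> * (real s + 1) \<le> real s * (real s + 1)" by (intro mult_right_mono) auto
      then have "\<bar>?x\<bar> \<le> real s * (real s + 1) / 2" by (simp add: abs_mult)
      moreover have "real s * (real s + 1) / 2 + 1 \<le> (real s + 1)\<^sup>2" by (simp add: power2_eq_square field_simps)
      ultimately have "of_int (- ((int s + 1)\<^sup>2)) \<le> ?x - 1" "?x \<le> of_int ((int s + 1)\<^sup>2)" by simp_all
      then have F: "- ((int s + 1)\<^sup>2) \<le> F s (u i $ l / 2)" "F s (u i $ l / 2) \<le> (int s + 1)\<^sup>2"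
        unfolding F_def by linarith+
      have e: "int (a s i l) = F s (u i $ l / 2) + (int s + 1)\<^sup>2" using F by (simp add: a_def)
      have i: "int (2 * (s + 1)\<^sup>2) = 2 * (int s + 1)\<^sup>2" by (simp add: algebra_simps power2_eq_square)
      have le: "a s i l \<le> 2 * (s + 1)\<^sup>2" using e F(2) i by linarith
      then have d: "int (2 * (s + 1)\<^sup>2 - a s i l) = (int s + 1)\<^sup>2 - F s (u i $ l / 2)" using e i by linarith
      have "real (a s i l) - real (2 * (s + 1)\<^sup>2 - a s i l) = real_of_int (int (a s i l) - int (2 * (s + 1)\<^sup>2 - a s i l))"
        by simp
      also have "\<dots> = 2 * real_of_int (F s (u i $ l / 2))" unfolding e d by simp
      finally show ?thesis using le by (simp add: cand_entry_def T T(2)[unfolded One_nat_def])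
    qed
    then show ?thesis unfolding eventually_sequentially by blast
  qed
  have E: "(\<lambda>s. cand_entry (T s) i l) \<longlonglongrightarrow> u i $ l" for i l
  proof -
    have "(\<lambda>s. 2 * (of_int (F s (u i $ l / 2)) / (real s + 1))) \<longlonglongrightarrow> 2 * (u i $ l / 2)"
      unfolding F_def by (intro tendsto_intros floor_approximation)
    then have "(\<lambda>s. 2 * (of_int (F s (u i $ l / 2)) / (real s + 1))) \<longlonglongrightarrow> u i $ l" by simp
    then show ?thesis
      by (rule Lim_transform_eventually) (rule eventually_mono[OF ev_a[of i l]], simp)
  qed
  have mu: "cand_eig (T s) i = of_int (F s (c i)) / (real s + 1)" for s i
    unfolding T(7) by (cases "0 \<le> F s (c i)") auto
  have M: "(\<lambda>s. cand_eig (T s) i) \<longlonglongrightarrow> c i" for i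
    unfolding mu F_def by (rule floor_approximation)
  have p2: "(\<lambda>s. 1 / 2 ^ s :: real) \<longlonglongrightarrow> 0"
    using LIMSEQ_power_zero[of "1 / 2 :: real"] by (simp add: power_one_over)
  have X: "(\<lambda>s. cand_matrix p (T s) i l) \<longlonglongrightarrow> A $ i $ l" for i l
  proof -
    have "\<bar>A $ i $ l - cand_matrix p (T s) i l\<bar> \<le> 1 / 2 ^ s" for s
      using cand_matrix_close[OF A, of "T s" i l] B[of _ s] by (simp add: T)
    then have "(\<lambda>s. cand_matrix p (T s) i l - A $ i $ l) \<longlonglongrightarrow> 0"
      by (intro Lim_null_comparison[OF _ p2] always_eventually allI) (simp add: abs_minus_commute)
    then show ?thesis by (simp add: LIM_zero_iff)
  qed
  have C1: "\<forall>\<^sub>F s in sequentially. \<forall>(i::'n) (l::'n). cand_num (T s) i l \<le> component (T s) 0"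
  proof (intro eventually_all_finite)
    show "\<forall>\<^sub>F s in sequentially. cand_num (T s) i l \<le> component (T s) 0" for i l :: 'n
      by (rule eventually_mono[OF ev_a[of i l]]) simp
  qed
  have C3: "\<forall>\<^sub>F s in sequentially. \<forall>(i::'n) (l::'n). cand_residual p (T s) i l \<le> 1 / (real (component (T s) 2) + 1)"
    (is "eventually (\<lambda>s. \<forall>i l. ?P s i l) _")
  proof (intro eventually_all_finite)
    fix i l :: 'n
    have "(\<lambda>s. \<bar>(\<Sum>y\<in>UNIV. cand_matrix p (T s) l y * cand_entry (T s) i y) - cand_eig (T s) i * cand_entry (T s) i l\<bar> +
        (\<Sum>y\<in>UNIV. \<bar>cand_entry (T s) i y\<bar>) * (1 / 2 ^ s))
      \<longlonglongrightarrow> \<bar>(\<Sum>y\<in>UNIV. A $ l $ y * u i $ y) - c i * u i $ l\<bar> + (\<Sum>y\<in>UNIV. \<bar>u i $ y\<bar>) * 0"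
      by (intro tendsto_intros E M X p2)
    moreover have "(\<Sum>y\<in>UNIV. A $ l $ y * u i $ y) - c i * u i $ l = 0"
      using arg_cong[OF u[of i], of "\<lambda>v. v $ l"] by (simp add: matrix_vector_mult_def)
    ultimately have "(\<lambda>s. cand_residual p (T s) i l) \<longlonglongrightarrow> 0"
      by (simp add: cand_residual_def T)
    then have "\<forall>\<^sub>F s in sequentially. cand_residual p (T s) i l < 1 / (real r + 1)"
      by (rule order_tendstoD(2)) simp
    then show "\<forall>\<^sub>F s in sequentially. ?P s i l"
      by (rule eventually_mono) (simp add: T)
  qed
  \<comment> \<open>Equal eigenvalues receive identical approximations, as these depend on
    \<open>c i\<close> alone; convergence is used for the distinct ones.\<close>
  have C4: "\<forall>\<^sub>F s in sequentially. \<forall>(i::'n) (l::'n). (cand_eig (T s) i = cand_eig (T s) l \<longleftrightarrow> c i = c l) \<and>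
      (cand_eig (T s) i = cand_eig (T s) l \<or> real (4 * CARD('n)) / (real (component (T s) 2) + 1) \<le>
        \<bar>cand_eig (T s) i - cand_eig (T s) l\<bar> * ?\<epsilon>)"
    (is "eventually (\<lambda>s. \<forall>i l. ?P s i l) _")
  proof (intro eventually_all_finite)
    fix i l :: 'n
    show "\<forall>\<^sub>F s in sequentially. ?P s i l"
    proof (cases "c i = c l")
      case True
      then show ?thesis by (simp add: mu)
    next
      case False
      have "(\<lambda>s. \<bar>cand_eig (T s) i - cand_eig (T s) l\<bar> * ?\<epsilon>) \<longlonglongrightarrow> \<bar>c i - c l\<bar> * ?\<epsilon>"
        by (intro tendsto_intros M)
      moreover have "real (4 * CARD('n)) / (real r + 1) < \<bar>c i - c l\<bar> * ?\<epsilon>"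
        using r mult_right_mono[OF g(2)[OF False] less_imp_le[OF \<epsilon>]] by linarith
      ultimately have "\<forall>\<^sub>F s in sequentially. real (4 * CARD('n)) / (real r + 1) <
          \<bar>cand_eig (T s) i - cand_eig (T s) l\<bar> * ?\<epsilon>"
        by (rule order_tendstoD(1))
      then show ?thesis
      proof (rule eventually_mono)
        fix s assume s: "real (4 * CARD('n)) / (real r + 1) < \<bar>cand_eig (T s) i - cand_eig (T s) l\<bar> * ?\<epsilon>"
        have "0 \<le> real (4 * CARD('n)) / (real r + 1)" by simp
        from order_le_less_trans[OF this s] have "cand_eig (T s) i \<noteq> cand_eig (T s) l" by auto
        with s False show "?P s i l"
          by (simp add: T)
      qed
    qed
  qed
  have C6: "\<forall>\<^sub>F s in sequentially. \<forall>(i::'n) (l::'n). \<bar>(\<Sum>y\<in>UNIV. cand_entry (T s) i y * cand_entry (T s) l y) - (if i = l then 1 else 0)\<bar>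
        \<le> (2 - 1 / 2 ^ j) / real (4 * CARD('n))"
    (is "eventually (\<lambda>s. \<forall>i l. ?g s i l \<le> ?\<tau>) _")
  proof (intro eventually_all_finite)
    fix i l :: 'n
    have "(\<lambda>s. ?g s i l) \<longlonglongrightarrow> \<bar>(\<Sum>y\<in>UNIV. u i $ y * u l $ y) - (if i = l then 1 else 0)\<bar>"
      by (intro tendsto_intros E)
    moreover have "(\<Sum>y\<in>UNIV. u i $ y * u l $ y) = inner (u i) (u l)" by (simp add: inner_vec_def)
    ultimately have "\<forall>\<^sub>F s in sequentially. ?g s i l < ?\<tau>"
      using gram[of i l] by (intro order_tendstoD(2)) simp_all
    then show "\<forall>\<^sub>F s in sequentially. ?g s i l \<le> ?\<tau>"
      by (rule eventually_mono) simp
  qed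
  have C7: "\<forall>\<^sub>F s in sequentially. j = 0 \<or> (\<forall>(i::'n) (l::'n). \<bar>cand_entry (T s) i l - cand_entry t' i l\<bar> \<le> 4 / real (64 * CARD('n)^2) / 2 ^ j)"
    (is "eventually (\<lambda>s. j = 0 \<or> (\<forall>i l. ?g s i l \<le> ?b)) _")
  proof (cases "j = 0")
    case False
    have "\<forall>\<^sub>F s in sequentially. \<forall>i l. ?g s i l \<le> ?b"
    proof (intro eventually_all_finite)
      fix i l :: 'n
      have "(\<lambda>s. ?g s i l) \<longlonglongrightarrow> \<bar>u i $ l - cand_entry t' i l\<bar>"
        by (intro tendsto_intros E)
      moreover have "\<bar>u i $ l - cand_entry t' i l\<bar> < ?b" using prev False by blast
      ultimately have "\<forall>\<^sub>F s in sequentially. ?g s i l < ?b"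
        by (rule order_tendstoD(2))
      then show "\<forall>\<^sub>F s in sequentially. ?g s i l \<le> ?b"
        by (rule eventually_mono) (rule less_imp_le)
    qed
    then show ?thesis by (rule eventually_mono) blast
  qed simp
  have "\<forall>\<^sub>F s in sequentially. admissible TYPE('n) p k j t' (T s)"
    using C1 C3 C4 C6 C7
  proof eventually_elim
    case (elim s)
    have "card (range (cand_eig (T s) :: 'n \<Rightarrow> real)) = k"
      using card_range_eq[of "cand_eig (T s) :: 'n \<Rightarrow> real" c] elim(3) k by simp
    moreover have "\<forall>i\<in>{..<?N}. 3 * component (T s) 3 + 2 < false_count (stream TYPE('n) p i) (component (T s) 4)"
      using B[of _ s] by (simp add: T)
    moreover have "\<forall>(i::'n) (l::'n). cand_eig (T s) i = cand_eig (T s) l \<or>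
        real (4 * CARD('n)) / (real (component (T s) 2) + 1) \<le> \<bar>cand_eig (T s) i - cand_eig (T s) l\<bar> * ?\<epsilon>"
      using elim(3) by blast
    ultimately show ?case
      unfolding admissible_def using elim(1,2,4,5) by (intro conjI) assumption+
  qed
  then have "\<exists>s. admissible TYPE('n) p k j t' (T s)"
    by (rule eventually_happens'[OF sequentially_bot])
  then show ?thesis by blast
qed

lemma admissible_exists_0:
  fixes A :: "'n::{finite,linorder} sq_matrix"
  assumes A: "sym_matrix_rep p A" "card (spectrum A) = k"
  shows "\<exists>t. admissible TYPE('n) p k 0 t' t"
proof -
  have sym: "transpose A = A" using A(1) by (simp add: sym_matrix_rep_def)
  obtain w :: "'n vec_tuple" and c where w: "\<And>i. A *v w $ i = c i *\<^sub>R w $ i"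
      "\<And>i j. inner (w $ i) (w $ j) = (if i = j then 1 else 0)"
    using symmetric_orthonormal_eigenbasis[OF sym] by metis
  have "spectrum A = range c"
    by (rule spectrum_eq_range[OF sym orthonormal_imp_basis_tuple(1)[OF w(2)] w(1)])
  then have "card (range c) = k" using A(2) by simp
  moreover have "inner (w $ i) (w $ l) - (if i = l then 1 else 0) = 0" for i l using w(2)[of i l] by simp
  then have "\<bar>inner (w $ i) (w $ l) - (if i = l then 1 else 0)\<bar> < (2 - 1 / 2 ^ 0) / real (4 * CARD('n))" for i l
    by (simp only:) simp
  ultimately show ?thesis by (rule admissible_exists[OF A(1) w(1)]) simp
qed

text \<open>The target is the eigenvectors certified within \<open>?\<epsilon>\<close> of the
  current tuple. Passing to them changes Gram entries by less than \<open>4 * ?\<epsilon>\<close>,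
  which is at most the growth \<open>1 / 2 ^ Suc j / (4 * CARD('n))\<close> of the tolerance, so the
  new condition holds strictly.\<close>

lemma admissible_exists_Suc:
  fixes A :: "'n::{finite,linorder} sq_matrix"
  assumes A: "sym_matrix_rep p A" "card (spectrum A) = k" and adm: "admissible TYPE('n) p k j t' t"
  shows "\<exists>t''. admissible TYPE('n) p k (Suc j) t t''"
proof -
  let ?\<epsilon> = "1 / real (64 * CARD('n)^2) / 2 ^ j"
  obtain u c where u: "\<And>i. A *v u i = c i *\<^sub>R u i" "\<And>i. norm (u i - cand_vec t i) \<le> ?\<epsilon>" "card (range c) = k"
    using admissible_sound[OF A adm] by blast
  have d: "1 \<le> CARD('n)" using zero_less_card_finite[where 'a = 'n] by linarith
  have \<epsilon>2: "?\<epsilon> \<le> 1 / 2" by (rule radius_bounds)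
  have \<epsilon>: "0 < ?\<epsilon>" by simp
  show ?thesis
  proof (rule admissible_exists[OF A(1) u(1,3)])
    fix i l :: 'n
    let ?v = "cand_vec t :: 'n \<Rightarrow> (real, 'n) vec"
    have nu: "norm (u l) \<le> 2"
    proof -
      have "norm (u l) \<le> norm (u l - ?v l) + norm (?v l)" using norm_triangle_ineq[of "u l - ?v l" "?v l"] by simp
      then show ?thesis using u(2)[of l] admissible_norm(2)[OF adm, of l] \<epsilon>2 by linarith
    qed
    have "inner (u i) (u l) - inner (?v i) (?v l) = inner (u i - ?v i) (u l) + inner (?v i) (u l - ?v l)"
      by (simp add: inner_diff_left inner_diff_right)
    also have "\<bar>\<dots>\<bar> \<le> norm (u i - ?v i) * norm (u l) + norm (?v i) * norm (u l - ?v l)"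
      by (intro order_trans[OF abs_triangle_ineq] add_mono Cauchy_Schwarz_ineq2)
    \<comment> \<open>The vectors \<open>u l\<close> have norm at most \<open>3 / 2 + 1 / 2\<close>,
      the candidate vectors at most \<open>3 / 2\<close>.\<close>
    also have "\<dots> \<le> ?\<epsilon> * 2 + 3 / 2 * ?\<epsilon>"
      using u(2) nu admissible_norm(2)[OF adm, of i] \<epsilon> by (intro add_mono mult_mono) auto
    also have "\<dots> < 4 * ?\<epsilon>"
    proof -
      have "e * 2 + 3 / 2 * e < 4 * e" if "0 < e" for e :: real using that by linarith
      then show ?thesis using \<epsilon> .
    qed
    also have "\<dots> \<le> 1 / 2 ^ Suc j / real (4 * CARD('n))"
    proof -
      have "CARD('n) * 1 \<le> CARD('n) * CARD('n)" by (rule mult_le_mono2[OF d])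
      then have "8 * CARD('n) \<le> 16 * CARD('n)^2" unfolding power2_eq_square by linarith
      then have "real (8 * CARD('n)) \<le> real (16 * CARD('n)^2)" by (simp only: of_nat_le_iff)
      then have "1 / real (16 * CARD('n)^2) \<le> 1 / real (8 * CARD('n))" by (intro frac_le) auto
      then have "1 / real (16 * CARD('n)^2) / 2 ^ j \<le> 1 / real (8 * CARD('n)) / 2 ^ j" by (intro divide_right_mono) auto
      then show ?thesis by (simp add: mult_ac)
    qed
    finally have "\<bar>inner (u i) (u l) - inner (?v i) (?v l)\<bar> < 1 / 2 ^ Suc j / real (4 * CARD('n))" .
    moreover have "(2 - 1 / 2 ^ j) / real (4 * CARD('n)) + 1 / 2 ^ Suc j / real (4 * CARD('n)) = (2 - 1 / 2 ^ Suc j) / real (4 * CARD('n))"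
      by (simp only: add_divide_distrib[symmetric]) simp
    ultimately show "\<bar>inner (u i) (u l) - (if i = l then 1 else 0)\<bar> < (2 - 1 / 2 ^ Suc j) / real (4 * CARD('n))"
      using admissible_gram[OF adm, of i l] by linarith
  next
    have "\<bar>u i $ l - cand_entry t i l\<bar> < 4 / real (64 * CARD('n)^2) / 2 ^ Suc j" for i l
    proof -
      have "\<bar>u i $ l - cand_entry t i l\<bar> \<le> norm (u i - cand_vec t i)"
        using component_le_norm_cart[of "u i - cand_vec t i" l] by (simp add: cand_vec_def)
      also have "\<dots> \<le> ?\<epsilon>" by (rule u(2))
      also have "\<dots> < 2 * ?\<epsilon>"
      proof -
        have "e < 2 * e" if "0 < e" for e :: real using that by linarith
        then show ?thesis using \<epsilon> .
      qed
      also have "\<dots> = 4 / real (64 * CARD('n)^2) / 2 ^ Suc j" by simp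
      finally show ?thesis .
    qed
    then show "Suc j = 0 \<or> (\<forall>i l. \<bar>u i $ l - cand_entry t i l\<bar> < 4 / real (64 * CARD('n)^2) / 2 ^ Suc j)" by blast
  qed
qed

section \<open>The limit of a sequence of candidates\<close>

lemma dyadic_limit:
  fixes x :: "nat \<Rightarrow> real"
  assumes "\<And>j. \<bar>x (Suc j) - x j\<bar> \<le> 1 / 2 ^ Suc j"
  shows "\<exists>L. x \<longlonglongrightarrow> L \<and> (\<forall>j. \<bar>L - x j\<bar> \<le> 1 / 2 ^ j)"
proof -
  have d: "\<bar>x (j + n) - x j\<bar> \<le> 1 / 2 ^ j - 1 / 2 ^ (j + n)" for j n
  proof (induction n)
    case (Suc n)
    have "1 / 2 ^ (j + n) = 2 * (1 / 2 ^ Suc (j + n) :: real)" by simp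
    then show ?case using Suc assms[of "j + n"] by simp
  qed simp
  have "Cauchy x"
  proof (rule CauchyI)
    fix e :: real assume e: "e > 0"
    obtain k where k: "(1 / 2 :: real) ^ k < e / 2" using real_arch_pow_inv[of "e / 2" "1 / 2"] e by auto
    have "\<bar>x m - x k\<bar> < e / 2" if "m \<ge> k" for m
    proof -
      have "\<bar>x m - x k\<bar> \<le> 1 / 2 ^ k - 1 / 2 ^ m" using d[of k "m - k"] that by simp
      moreover have "(0::real) < 1 / 2 ^ m" by simp
      ultimately show ?thesis using k[unfolded power_one_over] by linarith
    qed
    then have "norm (x m - x n) < e" if "m \<ge> k" "n \<ge> k" for m n
      using that by (smt (verit) field_sum_of_halves real_norm_def)
    then show "\<exists>M. \<forall>m\<ge>M. \<forall>n\<ge>M. norm (x m - x n) < e" by blast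
  qed
  then obtain L where L: "x \<longlonglongrightarrow> L" using Cauchy_convergent_iff convergent_def by blast
  have "\<bar>L - x j\<bar> \<le> 1 / 2 ^ j" for j
  proof (rule LIMSEQ_le_const2)
    show "(\<lambda>n. \<bar>x n - x j\<bar>) \<longlonglongrightarrow> \<bar>L - x j\<bar>" by (intro tendsto_intros L)
    have "\<bar>x n - x j\<bar> \<le> 1 / 2 ^ j" if "n \<ge> j" for n
    proof -
      have "(0::real) < 1 / 2 ^ n" by simp
      moreover have "j + (n - j) = n" using that by simp
      ultimately show ?thesis using d[of j "n - j"] by (metis diff_ge_0_iff_ge diff_left_mono less_imp_le order_trans diff_zero)
    qed
    then show "\<exists>N. \<forall>n\<ge>N. \<bar>x n - x j\<bar> \<le> 1 / 2 ^ j" by blast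
  qed
  with L show ?thesis by blast
qed

text \<open>Diagonal dominance of the Gram matrix.\<close>

lemma gram_imp_basis_tuple:
  fixes w :: "'n::finite vec_tuple"
  assumes "\<And>i l. \<bar>inner (w $ i) (w $ l) - (if i = l then 1 else 0)\<bar> \<le> 1 / real (2 * CARD('n))"
  shows "basis_tuple w"
proof -
  \<comment> \<open>On the transpose, the kernel criterion speaks about linear relations between the
    vectors \<open>w $ l\<close>. In such a relation the coefficient of largest modulus would be at
    most half of itself.\<close>
  have "y = 0" if y: "\<forall>l. inner (transpose w $ l) y = 0" for y
  proof (rule ccontr)
    assume "y \<noteq> 0"
    obtain i where i: "\<And>l. \<bar>y $ l\<bar> \<le> \<bar>y $ i\<bar>"
    proof -
      have "Max (range (\<lambda>l. \<bar>y $ l\<bar>)) \<in> range (\<lambda>l. \<bar>y $ l\<bar>)" by (rule Max_in) auto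
      then obtain i where "Max (range (\<lambda>l. \<bar>y $ l\<bar>)) = \<bar>y $ i\<bar>" by (rule imageE)
      then show thesis using that[of i] by (metis Max_ge finite_imageI finite rangeI)
    qed
    have "(\<Sum>l\<in>UNIV. y $ l *\<^sub>R w $ l) = 0"
      using y by (simp add: vec_eq_iff inner_vec_def transpose_def mult.commute)
    then have "(\<Sum>l\<in>UNIV. y $ l * inner (w $ i) (w $ l)) = 0"
      by (metis (no_types, lifting) inner_scaleR_right inner_sum_right inner_zero_right sum.cong)
    moreover have "(\<Sum>l\<in>UNIV. y $ l * (if i = l then 1 else 0)) = (\<Sum>l\<in>UNIV. if i = l then y $ l else 0)"
      by (intro sum.cong) auto
    moreover have "(\<Sum>l\<in>UNIV. if i = l then y $ l else 0) = y $ i" by simp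
    moreover have "(\<Sum>l\<in>UNIV. y $ l * (inner (w $ i) (w $ l) - (if i = l then 1 else 0))) =
        (\<Sum>l\<in>UNIV. y $ l * inner (w $ i) (w $ l)) - (\<Sum>l\<in>UNIV. y $ l * (if i = l then 1 else 0))"
      by (simp only: right_diff_distrib sum_subtractf)
    ultimately have "\<bar>y $ i\<bar> = \<bar>\<Sum>l\<in>UNIV. y $ l * (inner (w $ i) (w $ l) - (if i = l then 1 else 0))\<bar>" by linarith
    also have "\<dots> \<le> (\<Sum>l\<in>UNIV. \<bar>y $ l * (inner (w $ i) (w $ l) - (if i = l then 1 else 0))\<bar>)"
      by (rule sum_abs)
    also have "\<dots> \<le> (\<Sum>l\<in>(UNIV::'n set). \<bar>y $ i\<bar> * (1 / real (2 * CARD('n))))"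
      unfolding abs_mult by (intro sum_mono mult_mono i assms) auto
    also have "\<dots> = \<bar>y $ i\<bar> / 2" by simp
    finally have "y $ i = 0" by simp
    then show False using i \<open>y \<noteq> 0\<close> by (simp add: vec_eq_iff)
  qed
  then have "basis_tuple (transpose w)" unfolding basis_tuple_iff_kernel by blast
  then show ?thesis by (simp add: basis_tuple_iff_det det_transpose)
qed

text \<open>The candidates and the exact eigenvectors near them have the same limit, although the
  latter are chosen anew in each round. To avoid a limit of eigenvalues, the eigenvector equation is
  used in the form \<open>inner v v *\<^sub>R (A *v v) = inner v (A *v v) *\<^sub>R v\<close>, which
  is continuous in \<open>v\<close>.\<close>

theorem admissible_limit:
  fixes A :: "'n::{finite,linorder} sq_matrix"
  assumes A: "sym_matrix_rep p A" "card (spectrum A) = k"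
    and adm0: "admissible TYPE('n) p k 0 t0 (T 0)"
    and adm: "\<And>j. admissible TYPE('n) p k (Suc j) (T j) (T (Suc j))"
  shows "\<exists>w\<in>Diag A. \<forall>j i l. \<bar>w $ i $ l - cand_entry (T j) i l\<bar> \<le> 1 / 2 ^ j"
proof -
  let ?\<epsilon> = "\<lambda>j. 1 / real (64 * CARD('n)^2) / 2 ^ j"
  have d: "1 \<le> CARD('n)" using zero_less_card_finite[where 'a = 'n] by linarith
  have admj: "\<exists>t'. admissible TYPE('n) p k j t' (T j)" for j
    using adm0 adm by (cases j) auto
  have "\<bar>cand_entry (T (Suc j)) i l - cand_entry (T j) i l\<bar> \<le> 1 / 2 ^ Suc j" for i l :: 'n and j
  proof -
    have "\<bar>cand_entry (T (Suc j)) i l - cand_entry (T j) i l\<bar> \<le> 4 / real (64 * CARD('n)^2) / 2 ^ Suc j"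
      using adm[of j] unfolding admissible_def by blast
    also have "\<dots> \<le> 1 / 2 ^ Suc j"
    proof (rule divide_right_mono)
      have "1 \<le> CARD('n)^2" using d by simp
      then have "4 \<le> 64 * CARD('n)^2" by linarith
      then have "4 \<le> real (64 * CARD('n)^2)" by (metis of_nat_le_iff of_nat_numeral)
      then show "4 / real (64 * CARD('n)^2) \<le> 1" by (simp add: divide_le_eq)
    qed simp
    finally show ?thesis .
  qed
  then have "\<exists>L. (\<lambda>j. cand_entry (T j) i l) \<longlonglongrightarrow> L \<and> (\<forall>j. \<bar>L - cand_entry (T j) i l\<bar> \<le> 1 / 2 ^ j)" for i l :: 'n
    by (rule dyadic_limit)
  then obtain L :: "'n \<Rightarrow> 'n \<Rightarrow> real" where L: "\<And>i l. (\<lambda>j. cand_entry (T j) i l) \<longlonglongrightarrow> L i l"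
      "\<And>i l j. \<bar>L i l - cand_entry (T j) i l\<bar> \<le> 1 / 2 ^ j"
    by metis
  define w where "w = (\<chi> i l. L i l)"
  have vw: "(\<lambda>j. cand_vec (T j) i) \<longlonglongrightarrow> w $ i" for i
    by (rule vec_tendstoI) (simp add: cand_vec_def w_def L)
  have "\<exists>u c. (\<forall>i. A *v u i = c i *\<^sub>R u i) \<and> (\<forall>i. norm (u i - cand_vec (T j) i) \<le> ?\<epsilon> j) \<and> card (range c) = k" for j
    using admj[of j] admissible_sound[OF A] by blast
  then obtain u c where u: "\<And>j i. A *v u j i = c j i *\<^sub>R u j i" "\<And>j i. norm (u j i - cand_vec (T j) i) \<le> ?\<epsilon> j"
    by metis
  have \<epsilon>0: "?\<epsilon> \<longlonglongrightarrow> 0"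
  proof -
    have "(\<lambda>j. 1 / real (64 * CARD('n)^2) * (1 / 2) ^ j) \<longlonglongrightarrow> 1 / real (64 * CARD('n)^2) * 0"
      by (intro tendsto_mult tendsto_const LIMSEQ_power_zero) simp
    then show ?thesis by (simp add: power_one_over)
  qed
  have uw: "(\<lambda>j. u j i) \<longlonglongrightarrow> w $ i" for i
  proof -
    have "(\<lambda>j. u j i - cand_vec (T j) i) \<longlonglongrightarrow> 0"
      by (rule Lim_null_comparison[OF _ \<epsilon>0]) (simp add: u(2)[simplified])
    from tendsto_add[OF this vw[of i]] show ?thesis by simp
  qed
  have Au: "(\<lambda>j. A *v u j i) \<longlonglongrightarrow> A *v w $ i" for i
    by (rule bounded_linear.tendsto[OF matrix_vector_mul_bounded_linear uw])
  have "inner (w $ i) (w $ i) *\<^sub>R (A *v w $ i) = inner (w $ i) (A *v w $ i) *\<^sub>R w $ i" for i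
  proof (rule LIMSEQ_unique)
    show "(\<lambda>j. inner (u j i) (u j i) *\<^sub>R (A *v u j i)) \<longlonglongrightarrow> inner (w $ i) (w $ i) *\<^sub>R (A *v w $ i)"
      by (intro tendsto_intros uw Au)
    have "(\<lambda>j. inner (u j i) (A *v u j i) *\<^sub>R u j i) \<longlonglongrightarrow> inner (w $ i) (A *v w $ i) *\<^sub>R w $ i"
      by (intro tendsto_intros uw Au)
    then show "(\<lambda>j. inner (u j i) (u j i) *\<^sub>R (A *v u j i)) \<longlonglongrightarrow> inner (w $ i) (A *v w $ i) *\<^sub>R w $ i"
      by (simp add: u(1) mult.commute)
  qed
  note eig = this
  have "\<bar>inner (w $ i) (w $ l) - (if i = l then 1 else 0)\<bar> \<le> 1 / real (2 * CARD('n))" for i l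
  proof (rule LIMSEQ_le_const2)
    let ?g = "\<lambda>j. \<bar>inner (cand_vec (T j) i) (cand_vec (T j) l) - (if i = l then 1 else 0)\<bar>"
    show "?g
        \<longlonglongrightarrow> \<bar>inner (w $ i) (w $ l) - (if i = l then 1 else 0)\<bar>"
      by (intro tendsto_intros vw)
    have "?g j \<le> 1 / real (2 * CARD('n))" for j
    proof -
      obtain t' where "admissible TYPE('n) p k j t' (T j)" using admj by blast
      then have "?g j \<le> (2 - 1 / 2 ^ j) / real (4 * CARD('n))"
        by (rule admissible_gram)
      also have "\<dots> \<le> 2 / real (4 * CARD('n))" by (intro divide_right_mono) auto
      finally show ?thesis by simp
    qed
    then show "\<exists>N. \<forall>j\<ge>N. ?g j \<le> 1 / real (2 * CARD('n))"
      by blast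
  qed
  then have w: "basis_tuple w" by (rule gram_imp_basis_tuple)
  have "eigenvector A (w $ i)" for i
  proof -
    have "w $ i \<noteq> 0" using w dependent_zero unfolding basis_tuple_def by (metis rangeI)
    moreover from this have "A *v w $ i = (inner (w $ i) (A *v w $ i) / inner (w $ i) (w $ i)) *\<^sub>R w $ i"
      using arg_cong[OF eig[of i], of "\<lambda>v. (1 / inner (w $ i) (w $ i)) *\<^sub>R v"] by simp
    ultimately show ?thesis unfolding eigenvector_def by blast
  qed
  then have "w \<in> Diag A" using w A(1) by (simp add: Diag_def sym_matrix_rep_def)
  moreover have "\<bar>w $ i $ l - cand_entry (T j) i l\<bar> \<le> 1 / 2 ^ j" for i l j using L(2) by (simp add: w_def)
  ultimately show ?thesis by blast
qed

section \<open>The diagonalization machine\<close>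

text \<open>All entries of a candidate have the same denominator and the same sum of the first two numbers of
  their triples, so all of the interleaved streams finish their rationals simultaneously.\<close>

definition block_length :: "'n::finite itself \<Rightarrow> nat \<Rightarrow> nat" where
  "block_length (_ :: 'n itself) t = CARD('n) * CARD('n) * (component t 0 + component t 1 + 3)"

text \<open>In the stream of an entry \<open>a\<close>, the separators stand at \<open>a\<close>,
  \<open>K + 1\<close> and \<open>K + c + 2\<close>, and all other letters are \<open>True\<close>;
  only the first separator depends on the entry.\<close>

definition block_bit :: "'n::finite itself \<Rightarrow> nat \<Rightarrow> nat \<Rightarrow> bool" where
  "block_bit (_ :: 'n itself) t x \<longleftrightarrow>
     \<not> x div (CARD('n) * CARD('n)) = component t 0 + 1 \<and>
     \<not> x div (CARD('n) * CARD('n)) = component t 0 + component t 1 + 2 \<and>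
     (\<forall>i\<in>{..<CARD('n) * CARD('n)}. x mod (CARD('n) * CARD('n)) = i \<longrightarrow>
        \<not> x div (CARD('n) * CARD('n)) = component t (5 + i))"

text \<open>A state codes the round \<open>j\<close>, the candidate found in the previous round, the current candidate, and \<open>0\<close>
  during the search or else \<open>x + 1\<close>, where \<open>x\<close> is the next bit of the block to be written.\<close>

definition next_state :: "'n::{finite,linorder} itself \<Rightarrow> inf_word \<Rightarrow> nat \<Rightarrow> nat \<Rightarrow> nat" where
  "next_state N p k h =
     (if component h 3 = 0 then
        if admissible N p k (component h 0) (component h 1) (component h 2)
        then enc [component h 0, component h 1, component h 2, 1]
        else enc [component h 0, component h 1, Suc (component h 2), 0]
      else if component h 3 = block_length N (component h 2)
        then enc [Suc (component h 0), component h 2, 0, 0]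
        else enc [component h 0, component h 1, component h 2, Suc (component h 3)])"

definition state :: "'n::{finite,linorder} itself \<Rightarrow> inf_word \<Rightarrow> nat \<Rightarrow> nat \<Rightarrow> nat" where
  "state N p k s = rec_nat (enc [0, 0, 0, 0]) (\<lambda>_. next_state N p k) s"

definition emit :: "bool \<Rightarrow> 'n::{finite,linorder} itself \<Rightarrow> inf_word \<Rightarrow> nat \<Rightarrow> nat \<Rightarrow> nat" where
  "emit b N p k s = of_bool (\<not> component (state N p k s) 3 = 0 \<and>
     (block_bit N (component (state N p k s) 2) (component (state N p k s) 3 - 1) \<longleftrightarrow> b))"

lemma pr_block_length [pr_intros]: "pr t \<Longrightarrow> pr (\<lambda>p e. block_length TYPE('n::finite) (t p e))"
  unfolding block_length_def by (intro pr_intros)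

lemma dec_block_bit [pr_intros]:
  "pr t \<Longrightarrow> pr x \<Longrightarrow> dec (\<lambda>p e. block_bit TYPE('n::finite) (t p e) (x p e))"
  unfolding block_bit_def by (intro pr_intros finite_lessThan)

lemma pr_next_state [pr_intros]:
  "pr k \<Longrightarrow> pr h \<Longrightarrow> pr (\<lambda>p e. next_state TYPE('n::{finite,linorder}) p (k p e) (h p e))"
  unfolding next_state_def enc.simps by (intro pr_intros)

lemma pr_state: "pr (\<lambda>p e. state TYPE('n::{finite,linorder}) p (e 0) (e 1))"
  unfolding state_def
  by (rule pr_rec[where st = "\<lambda>p e k. next_state TYPE('n) p (e 0)"]) (intro pr_intros)+

lemma pr_emit: "pr (\<lambda>p e. emit b TYPE('n::{finite,linorder}) p (e 0) (e 1))"
  unfolding emit_def by (intro pr_intros pr_state)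

lemma component_enc4:
  "component (enc [a, b, c, d]) 0 = a" "component (enc [a, b, c, d]) (Suc 0) = b"
  "component (enc [a, b, c, d]) 2 = c" "component (enc [a, b, c, d]) 3 = d"
  by (simp_all add: component_enc del: enc.simps)

lemma state_0: "state N p k 0 = enc [0, 0, 0, 0]"
  and state_Suc: "state N p k (Suc s) = next_state N p k (state N p k s)"
  by (simp_all add: state_def)

definition emitted :: "'n::{finite,linorder} itself \<Rightarrow> inf_word \<Rightarrow> nat \<Rightarrow> nat \<Rightarrow> bool list" where
  "emitted N p k = emission (emit False N p k) (emit True N p k)"

lemma emitted_Suc:
  "emitted N p k (Suc s) = emitted N p k s @
     (if component (state N p k s) 3 = 0 then []
      else [block_bit N (component (state N p k s) 2) (component (state N p k s) 3 - 1)])"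
  by (simp add: emitted_def emission_def emit_def)

section \<open>Runs of the search and output phases\<close>

lemma search_phase:
  assumes st: "state N p k s = enc [j, t', 0, 0]" and ex: "\<exists>t. admissible N p k j t' t"
  shows "\<exists>s' t. state N p k s' = enc [j, t', t, 1] \<and> admissible N p k j t' t \<and> emitted N p k s' = emitted N p k s"
proof -
  define t where "t = (LEAST t. admissible N p k j t' t)"
  have t: "admissible N p k j t' t" unfolding t_def using ex by (rule LeastI_ex)
  have "state N p k (s + n) = enc [j, t', n, 0] \<and> emitted N p k (s + n) = emitted N p k s" if "n \<le> t" for n
    using that
  proof (induction n)
    case 0
    then show ?case using st by (simp del: enc.simps)
  next
    case (Suc n)
    then have "\<not> admissible N p k j t' n" using not_less_Least unfolding t_def by (metis Suc_le_lessD)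
    with Suc show ?case
      by (simp add: state_Suc emitted_Suc next_state_def component_enc4 del: enc.simps)
  qed
  from this[of t] have "state N p k (Suc (s + t)) = enc [j, t', t, 1] \<and> emitted N p k (Suc (s + t)) = emitted N p k s"
    using t by (simp add: state_Suc emitted_Suc next_state_def component_enc4 del: enc.simps)
  with t show ?thesis by blast
qed

lemma output_phase:
  assumes st: "state N p k s = enc [j, t', t, 1]"
  shows "\<exists>s'. state N p k s' = enc [Suc j, t, 0, 0] \<and>
    emitted N p k s' = emitted N p k s @ map (block_bit N t) [0..<block_length N t]"
proof -
  have pos: "block_length N t > 0" by (simp add: block_length_def)
  have *: "state N p k (s + n) = enc [j, t', t, Suc n] \<and>
      emitted N p k (s + n) = emitted N p k s @ map (block_bit N t) [0..<n]" if "n < block_length N t" for n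
    using that
  proof (induction n)
    case 0
    then show ?case using st by (simp del: enc.simps)
  next
    case (Suc n)
    then show ?case
      by (simp add: state_Suc emitted_Suc next_state_def component_enc4 del: enc.simps)
  qed
  \<comment> \<open>The last bit is emitted in the state whose counter equals
    \<open>block_length N t\<close>; the state after it already opens the next round.\<close>
  obtain m where m: "block_length N t = Suc m" using pos by (cases "block_length N t") auto
  have "state N p k (Suc (s + m)) = enc [Suc j, t, 0, 0]"
    using *[of m] m by (simp add: state_Suc next_state_def component_enc4 del: enc.simps)
  moreover have "emitted N p k (Suc (s + m)) = emitted N p k s @ map (block_bit N t) [0..<block_length N t]"
    using *[of m] m by (simp add: emitted_Suc component_enc4 del: enc.simps)
  ultimately show ?thesis by blast
qed

lemma rounds:
  fixes A :: "'n::{finite,linorder} sq_matrix"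
  assumes A: "sym_matrix_rep p A" "card (spectrum A) = k"
  shows "\<exists>S T. admissible TYPE('n) p k 0 0 (T 0) \<and> (\<forall>j. admissible TYPE('n) p k (Suc j) (T j) (T (Suc j))) \<and>
    emitted TYPE('n) p k (S 0) = [] \<and>
    (\<forall>j. emitted TYPE('n) p k (S (Suc j)) =
       emitted TYPE('n) p k (S j) @ map (block_bit TYPE('n) (T j)) [0..<block_length TYPE('n) (T j)])"
proof -
  let ?N = "TYPE('n)"
  \<comment> \<open>A pair consists of a stage number and the previous candidate. The invariant
    carries solvability of the next search, which \<open>admissible_exists_Suc\<close>
    renews.\<close>
  define I where "I j st \<longleftrightarrow> state ?N p k (fst st) = enc [j, snd st, 0, 0] \<and> (\<exists>t. admissible ?N p k j (snd st) t) \<and>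
      (j = 0 \<longrightarrow> st = (0, 0))" for j st
  define Q where "Q j st st' \<longleftrightarrow> admissible ?N p k j (snd st) (snd st') \<and>
      emitted ?N p k (fst st') = emitted ?N p k (fst st) @ map (block_bit ?N (snd st')) [0..<block_length ?N (snd st')]" for j st st'
  have "\<exists>f. \<forall>j. I j (f j) \<and> Q j (f j) (f (Suc j))"
  proof (rule dependent_nat_choice)
    show "\<exists>st. I 0 st"
      using admissible_exists_0[OF A] by (intro exI[of _ "(0, 0)"]) (simp add: I_def state_0 del: enc.simps)
  next
    fix st j assume I: "I j st"
    then obtain s1 t where s1: "state ?N p k s1 = enc [j, snd st, t, 1]" "admissible ?N p k j (snd st) t"
        "emitted ?N p k s1 = emitted ?N p k (fst st)"
      using search_phase[of ?N p k "fst st" j "snd st"] unfolding I_def by blast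
    obtain s2 where "state ?N p k s2 = enc [Suc j, t, 0, 0]"
        "emitted ?N p k s2 = emitted ?N p k s1 @ map (block_bit ?N t) [0..<block_length ?N t]"
      using output_phase[OF s1(1)] by blast
    with s1 admissible_exists_Suc[OF A s1(2)] show "\<exists>st'. I (Suc j) st' \<and> Q j st st'"
      by (intro exI[of _ "(s2, t)"]) (simp add: I_def Q_def del: enc.simps)
  qed
  then obtain f where f: "\<And>j. I j (f j)" "\<And>j. Q j (f j) (f (Suc j))" by blast
  have "f 0 = (0, 0)" using f(1)[of 0] by (simp add: I_def)
  moreover have e0: "emitted ?N p k 0 = []" by (simp add: emitted_def emission_def)
  moreover have ad: "admissible ?N p k j (snd (f j)) (snd (f (Suc j)))" for j
    using f(2)[of j] by (simp add: Q_def)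
  moreover have em: "emitted ?N p k (fst (f (Suc j))) = emitted ?N p k (fst (f j)) @
      map (block_bit ?N (snd (f (Suc j)))) [0..<block_length ?N (snd (f (Suc j)))]" for j
    using f(2)[of j] unfolding Q_def by blast
  ultimately show ?thesis
    using ad[of 0] ad
    by (intro exI[of _ "\<lambda>j. fst (f j)"] exI[of _ "\<lambda>j. snd (f (Suc j))"] conjI allI em) simp_all
qed

text \<open>A block contributes equally many letters to each interleaved stream, so after separating
  the streams, block \<open>j\<close> is exactly the code of the rational number \<open>j\<close> in
  each of them.\<close>

lemma name_from_blocks:
  fixes T :: "nat \<Rightarrow> nat" and q :: inf_word
  assumes blocks: "\<And>j x. x < block_length TYPE('n::{finite,linorder}) (T j) \<Longrightarrow>
      q ((\<Sum>i<j. block_length TYPE('n) (T i)) + x) = block_bit TYPE('n) (T j) x"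
    and le: "\<And>j (i::'n) l. cand_num (T j) i l \<le> component (T j) 0"
    and close: "\<And>j (i::'n) l. \<bar>w $ i $ l - cand_entry (T j) i l\<bar> \<le> 1 / 2 ^ j"
  shows "tuple_rep q w"
proof -
  let ?d = "CARD('n)"
  have d0: "?d * ?d > 0" by simp
  have "rho (\<lambda>m. q (?d * ?d * m + (?d * rank_of i + rank_of l))) (w $ i $ l)" for i l :: 'n
  proof -
    let ?i = "?d * rank_of i + rank_of l"
    define r where "r = (\<lambda>m. q (?d * ?d * m + ?i))"
    define a where "a j = cand_num (T j) i l" for j
    define K where "K j = component (T j) 0" for j
    define c where "c j = component (T j) 1" for j
    \<comment> \<open>The position at which the rational number \<open>j\<close> starts, the same in
      all streams.\<close>
    define st where "st j = (\<Sum>h<j. K h + c h + 3)" for j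
    have i: "?i < ?d * ?d" by (rule tuple_index_less)
    have aK: "a j \<le> K j" for j using le by (simp add: a_def K_def)
    have r: "r (st j + y) \<longleftrightarrow> y \<noteq> a j \<and> y \<noteq> K j + 1 \<and> y \<noteq> K j + c j + 2" if y: "y < K j + c j + 3" for j y
    proof -
      let ?x = "?d * ?d * y + ?i"
      have "?x < ?d * ?d * Suc y" using i by simp
      also have "\<dots> \<le> ?d * ?d * (K j + c j + 3)" using y by (intro mult_le_mono2) simp
      finally have x: "?x < block_length TYPE('n) (T j)" by (simp add: block_length_def K_def c_def)
      have "(\<Sum>h<j. block_length TYPE('n) (T h)) = ?d * ?d * st j"
        by (simp add: block_length_def st_def K_def c_def sum_distrib_left)
      then have "r (st j + y) = block_bit TYPE('n) (T j) ?x"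
        using blocks[OF x] by (simp add: r_def distrib_left add.assoc)
      moreover have "?x div (?d * ?d) = y" "?x mod (?d * ?d) = ?i" using i d0 by (auto simp: div_mult_self4)
      ultimately show ?thesis
        using i by (auto simp: block_bit_def a_def K_def c_def cand_num_def)
    qed
    define n where "n m = (if m mod 3 = 0 then a (m div 3) else if m mod 3 = 1 then K (m div 3) - a (m div 3) else c (m div 3))" for m :: nat
    have m0: "(3 * j) mod 3 = 0" "(3 * j) div 3 = j" for j :: nat by simp_all
    have m1: "(3 * j + 1) mod 3 = (1::nat)" "(3 * j + 1) div 3 = j" for j :: nat by presburger+
    have m2: "(3 * j + 2) mod 3 = (2::nat)" "(3 * j + 2) div 3 = j" for j :: nat by presburger+
    have n: "n (3 * j) = a j" "n (3 * j + 1) = K j - a j" "n (3 * j + 2) = c j" for j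
      unfolding n_def m0 m1 m2 by simp_all
    have n': "n (Suc (3 * j)) = K j - a j" "n (Suc (Suc (3 * j))) = c j" for j
      using n(2,3)[of j] by simp_all
    have s0: "(\<Sum>h<3 * j. Suc (n h)) = st j" for j
    proof (induction j)
      case (Suc j)
      have "(\<Sum>h<3 * Suc j. Suc (n h)) = (\<Sum>h<3 * j. Suc (n h)) + Suc (n (3 * j)) + Suc (n (3 * j + 1)) + Suc (n (3 * j + 2))"
        by (simp add: numeral_3_eq_3)
      then show ?case using Suc aK[of j] by (simp add: n n' st_def)
    qed (simp add: st_def)
    have s1: "(\<Sum>h<3 * j + 1. Suc (n h)) = st j + a j + 1" for j using s0[of j] n(1)[of j] by simp
    have s2: "(\<Sum>h<3 * j + 2. Suc (n h)) = st j + K j + 2" for j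
      using s1[of j] n(2)[of j] aK[of j] by (simp add: numeral_2_eq_2)
    have "encodes_seq r n"
      unfolding encodes_seq_def
    proof
      fix m :: nat
      define j where "j = m div 3"
      have "m = 3 * j \<or> m = 3 * j + 1 \<or> m = 3 * j + 2" unfolding j_def by presburger
      then show "(\<forall>i<n m. r ((\<Sum>j<m. Suc (n j)) + i)) \<and> \<not> r ((\<Sum>j<m. Suc (n j)) + n m)"
      proof (elim disjE)
        assume m: "m = 3 * j"
        show ?thesis unfolding m s0 n using r[of _ j] aK[of j] by simp
      next
        assume m: "m = 3 * j + 1"
        have "r (st j + a j + 1 + i)" if "i < K j - a j" for i
        proof -
          have y: "a j + 1 + i < K j + c j + 3" "a j + 1 + i \<noteq> a j" "a j + 1 + i \<noteq> K j + 1"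
              "a j + 1 + i \<noteq> K j + c j + 2"
            using that by linarith+
          have "st j + a j + 1 + i = st j + (a j + 1 + i)" by simp
          then show ?thesis using r[OF y(1)] y(2-4) by metis
        qed
        moreover have "\<not> r (st j + a j + 1 + (K j - a j))"
          using r[of "K j + 1" j] aK[of j] by (simp add: add.assoc)
        ultimately show ?thesis unfolding m s1 n by blast
      next
        assume m: "m = 3 * j + 2"
        have "r (st j + K j + 2 + i)" if "i < c j" for i
        proof -
          have y: "K j + 2 + i < K j + c j + 3" "K j + 2 + i \<noteq> a j" "K j + 2 + i \<noteq> K j + 1"
              "K j + 2 + i \<noteq> K j + c j + 2"
            using that aK[of j] by linarith+
          have "st j + K j + 2 + i = st j + (K j + 2 + i)" by simp
          then show ?thesis using r[OF y(1)] y(2-4) by metis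
        qed
        moreover have "\<not> r (st j + K j + 2 + c j)"
          using r[of "K j + c j + 2" j] by (simp add: add_ac)
        ultimately show ?thesis unfolding m s2 n by blast
      qed
    qed
    moreover have "of_rat (rat_of_triple (n (3 * j)) (n (3 * j + 1)) (n (3 * j + 2))) = cand_entry (T j) i l" for j
      unfolding n by (simp add: rat_of_triple_def cand_entry_def a_def K_def c_def of_rat_divide of_rat_diff of_rat_add add.commute)
    ultimately have "rho r (w $ i $ l)" unfolding rho_def using close by metis
    then show ?thesis by (simp add: r_def)
  qed
  note rho = this
  let ?r = "inv (rank_of :: 'n \<Rightarrow> nat)"
  define x where "x m = w $ ?r (m div ?d) $ ?r (m mod ?d)" for m
  have "rho (\<lambda>m. q (?d * ?d * m + i)) (x i)" if "i < ?d * ?d" for i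
  proof -
    have "i div ?d < ?d" "i mod ?d < ?d" using that by (simp_all add: less_mult_imp_div_less)
    then have "rank_of (?r (i div ?d)) = i div ?d" "rank_of (?r (i mod ?d)) = i mod ?d"
      using bij_betw_imp_surj_on[OF rank_of_bij[where 'n = 'n]] by (auto intro!: f_inv_into_f)
    then have "?d * rank_of (?r (i div ?d)) + rank_of (?r (i mod ?d)) = i" by simp
    with rho[of "?r (i div ?d)" "?r (i mod ?d)"] show ?thesis by (simp add: x_def)
  qed
  then have "rho_pow (?d * ?d) q x" by (simp add: rho_pow_def)
  moreover have "w $ i $ l = x (?d * rank_of i + rank_of l)" for i l
    using rank_of_less[of l] by (simp add: x_def inv_rank_of)
  ultimately show ?thesis unfolding tuple_rep_def by blast
qed

lemma ex_limit_word:
  fixes E :: "nat \<Rightarrow> bool list"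
  assumes "\<And>s. \<exists>u. E (Suc s) = E s @ u"
  shows "\<exists>q. \<forall>s. \<forall>i<length (E s). E s ! i = q i"
proof -
  have pre: "\<exists>u. E (s + n) = E s @ u" for s n
  proof (induction n)
    case (Suc n)
    then show ?case using assms[of "s + n"] by auto
  qed simp
  have eq: "E s ! i = E s' ! i" if "i < length (E s)" "i < length (E s')" for s s' i
  proof -
    obtain u where u: "E (s + s') = E s @ u" using pre by blast
    obtain v where v: "E (s' + s) = E s' @ v" using pre by blast
    have "E s @ u = E s' @ v" using u v by (simp add: add.commute)
    then show ?thesis using that by (metis nth_append)
  qed
  show ?thesis
    by (rule exI[of _ "\<lambda>i. E (SOME s. i < length (E s)) ! i"]) (metis (mono_tags, lifting) eq someI_ex)
qed

section \<open>The partition by the number of eigenvalues and the two cardinals\<close>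

text \<open>The advice enters only through its length, so one machine serves all numbers of
  eigenvalues.\<close>

lemma diagonalization_machine:
  "\<exists>M. \<forall>(A :: 'n::{finite,linorder} sq_matrix) p w. sym_matrix_rep p A \<and> card (spectrum A) = length w \<longrightarrow>
     (\<exists>q. outputs M p w q \<and> (\<exists>b\<in>Diag A. tuple_rep q b))"
proof -
  let ?N = "TYPE('n)"
  obtain G0 where G0: "\<And>p e. eval G0 p e = emit False ?N p (e 0) (e 1)" using pr_emit unfolding pr_def by blast
  obtain G1 where G1: "\<And>p e. eval G1 p e = emit True ?N p (e 0) (e 1)" using pr_emit unfolding pr_def by blast
  have "\<exists>q. outputs (stage_machine G0 G1) p w q \<and> (\<exists>b\<in>Diag A. tuple_rep q b)"
    if A: "sym_matrix_rep p A" "card (spectrum A) = length w" for A :: "'n sq_matrix" and p w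
  proof -
    let ?E = "emitted ?N p (length w)" and ?B = "\<lambda>t. map (block_bit ?N t) [0..<block_length ?N t]"
    obtain S T where ST: "admissible ?N p (length w) 0 0 (T 0)"
        "\<And>j. admissible ?N p (length w) (Suc j) (T j) (T (Suc j))" "?E (S 0) = []"
        "\<And>j. ?E (S (Suc j)) = ?E (S j) @ ?B (T j)"
      using rounds[OF A] by blast
    obtain b where b: "b \<in> Diag A" "\<And>j i l. \<bar>b $ i $ l - cand_entry (T j) i l\<bar> \<le> 1 / 2 ^ j"
      using admissible_limit[OF A ST(1,2)] by blast
    obtain q where q: "\<And>s i. i < length (?E s) \<Longrightarrow> ?E s ! i = q i"
      using ex_limit_word[of ?E] emitted_Suc by blast
    have len: "length (?E (S j)) = (\<Sum>i<j. block_length ?N (T i))" for j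
      by (induction j) (simp_all add: ST(3,4))
    have out: "outputs (stage_machine G0 G1) p w q"
    proof (rule stage_machine_outputs)
      show "eval G0 p (case_nat (length w) (\<lambda>_. s)) = emit False ?N p (length w) s" for s by (simp add: G0)
      show "eval G1 p (case_nat (length w) (\<lambda>_. s)) = emit True ?N p (length w) s" for s by (simp add: G1)
      fix s i
      assume "i < length (emission (emit False ?N p (length w)) (emit True ?N p (length w)) s)"
      then show "emission (emit False ?N p (length w)) (emit True ?N p (length w)) s ! i = q i"
        using q[of i s] by (simp add: emitted_def)
    next
      fix m
      have "m \<le> length (?E (S m))"
      proof -
        have "(\<Sum>i<m. 1) \<le> (\<Sum>i<m. block_length ?N (T i))"
          by (intro sum_mono) (simp add: block_length_def Suc_le_eq)
        then show ?thesis by (simp add: len)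
      qed
      then show "\<exists>s. m \<le> length (emission (emit False ?N p (length w)) (emit True ?N p (length w)) s)"
        unfolding emitted_def by blast
    qed
    have "tuple_rep q b"
    proof (rule name_from_blocks)
      fix j x assume x: "x < block_length ?N (T j)"
      let ?l = "\<Sum>i<j. block_length ?N (T i)"
      have "?E (S (Suc j)) ! (?l + x) = block_bit ?N (T j) x"
        using x by (simp add: ST(4) len nth_append)
      moreover have "?l + x < length (?E (S (Suc j)))" using x by (simp add: len)
      ultimately show "q (?l + x) = block_bit ?N (T j) x" using q by metis
    next
      fix j and i l :: 'n
      obtain t' where "admissible ?N p (length w) j t' (T j)"
        using ST(1,2) by (cases j) auto
      then show "cand_num (T j) i l \<le> component (T j) 0"
        by (simp add: admissible_def)
    qed (rule b(2))
    with b(1) out show ?thesis by blast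
  qed
  then show ?thesis by (intro exI[of _ "stage_machine G0 G1"]) blast
qed

lemma computable_by_number_of_eigenvalues:
  defines "D \<equiv> \<lambda>k. {A :: 'n::{finite,linorder} sq_matrix. transpose A = A \<and> card (spectrum A) = k}"
  shows "computable_with_advice (Diag :: ('n sq_matrix, 'n vec_tuple) multimap) sym_matrix_rep tuple_rep
    (range D - {{}})"
proof -
  obtain M where M: "\<And>(A :: 'n sq_matrix) p w. sym_matrix_rep p A \<Longrightarrow> card (spectrum A) = length w \<Longrightarrow>
     (\<exists>q. outputs M p w q \<and> (\<exists>b\<in>Diag A. tuple_rep q b))"
    using diagonalization_machine[where 'n = 'n] by blast
  \<comment> \<open>Every word of length \<open>k\<close> names the class of matrices with
    \<open>k\<close> eigenvalues; it is meaningless if this class is empty, since a partition has no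
    empty member.\<close>
  define \<delta> :: "bool list \<rightharpoonup> 'n sq_matrix set" where
    "\<delta> w = (if D (length w) = {} then None else Some (D (length w)))" for w
  have "ran \<delta> = range D - {{}}"
  proof (intro equalityI subsetI)
    fix X assume "X \<in> ran \<delta>"
    then show "X \<in> range D - {{}}" by (auto simp: ran_def \<delta>_def split: if_splits)
  next
    fix X assume "X \<in> range D - {{}}"
    then obtain k where "X = D k" "D k \<noteq> {}" by blast
    then have "\<delta> (replicate k True) = Some X" by (simp add: \<delta>_def)
    then show "X \<in> ran \<delta>" by (auto simp: ran_def)
  qed
  moreover have "\<exists>q. outputs M p w q \<and> (\<exists>b\<in>Diag A. tuple_rep q b)"
    if "A \<in> X" "sym_matrix_rep p A" "\<delta> w = Some X" for A X p w
  proof (rule M[OF that(2)])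
    show "card (spectrum A) = length w"
      using that(1,3) by (auto simp: \<delta>_def D_def split: if_splits)
  qed
  ultimately show ?thesis
    unfolding computable_with_advice_def by (intro exI[of _ \<delta>] exI[of _ M]) auto
qed

theorem theorem2:
  shows "Ct (Diag :: ('n::{finite,linorder} sq_matrix, 'n vec_tuple) multimap) = enat CARD('n) \<and>
         Cc (Diag :: ('n sq_matrix, 'n vec_tuple) multimap) sym_matrix_rep tuple_rep = enat CARD('n)"
proof -
  let ?f = "Diag :: ('n sq_matrix, 'n vec_tuple) multimap"
  let ?ct = "{\<Delta>. partition_on (mdom ?f) \<Delta> \<and> (\<forall>D\<in>\<Delta>. mcontinuous (mrestrict ?f D))}"
  let ?cc = "{\<Delta>. partition_on (mdom ?f) \<Delta> \<and> countable \<Delta> \<and> computable_with_advice ?f sym_matrix_rep tuple_rep \<Delta>}"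
  have lower: "enat CARD('n) \<le> Ct ?f"
    unfolding Ct_def
  proof (rule INF_greatest)
    fix \<Delta> assume "\<Delta> \<in> ?ct"
    then show "enat CARD('n) \<le> ecard \<Delta>"
      using partition_card_ge[of \<Delta>] by (simp add: ecard_def mdom_Diag)
  qed
  \<comment> \<open>The infimum defining \<open>Cc\<close> ranges over a subfamily of the partitions
    for \<open>Ct\<close>, which gives \<open>Ct ?f\<close> \<le>
    \<open>Cc ?f sym_matrix_rep tuple_rep\<close>.\<close>
  have "?cc \<subseteq> ?ct"
  proof
    fix \<Delta> assume \<Delta>: "\<Delta> \<in> ?cc"
    have "mcontinuous (mrestrict ?f D)" if D: "D \<in> \<Delta>" for D
    proof (rule computable_imp_mcontinuous[of ?f sym_matrix_rep tuple_rep \<Delta> D])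
      show "computable_with_advice ?f sym_matrix_rep tuple_rep \<Delta>" "D \<in> \<Delta>" using \<Delta> D by auto
      fix A assume "A \<in> D"
      then have "transpose A = A" using \<Delta> D by (auto simp: partition_on_def mdom_Diag)
      then show "\<exists>p. sym_matrix_rep p A \<and> (\<forall>n. \<exists>U. open U \<and> A \<in> U \<and>
          (\<forall>z\<in>U \<inter> mdom ?f. \<exists>p'. sym_matrix_rep p' z \<and> (\<forall>i<n. p' i = p i)))"
        unfolding mdom_Diag by (rule sym_matrix_rep_extendable_name)
    qed (rule tuple_rep_prefix_determines)
    with \<Delta> show "\<Delta> \<in> ?ct" by blast
  qed
  then have mono: "Ct ?f \<le> Cc ?f sym_matrix_rep tuple_rep"
    unfolding Ct_def Cc_def by (rule INF_superset_mono) simp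
  define D where "D = (\<lambda>k. {A :: 'n sq_matrix. transpose A = A \<and> card (spectrum A) = k})"
  let ?\<Delta> = "range D - {{}}"
  have sub: "?\<Delta> \<subseteq> D ` {1..CARD('n)}"
  proof
    fix X assume "X \<in> ?\<Delta>"
    then obtain k A where X: "X = D k" "A \<in> D k" by blast
    then have "transpose A = A" "card (spectrum A) = k" by (simp_all add: D_def)
    with finite_spectrum[of A] have "k \<in> {1..CARD('n)}"
      by (metis One_nat_def Suc_le_eq atLeastAtMost_iff card_gt_0_iff)
    with X(1) show "X \<in> D ` {1..CARD('n)}" by blast
  qed
  then have fin: "finite ?\<Delta>" by (rule finite_subset) simp
  have "card ?\<Delta> \<le> CARD('n)"
    using card_mono[OF _ sub] card_image_le[of "{1..CARD('n)}" D] by simp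
  moreover have "partition_on (mdom ?f) ?\<Delta>"
    unfolding mdom_Diag by (rule partition_onI) (auto simp: D_def disjnt_def)
  moreover have "computable_with_advice ?f sym_matrix_rep tuple_rep ?\<Delta>"
    unfolding D_def by (rule computable_by_number_of_eigenvalues)
  ultimately have "Cc ?f sym_matrix_rep tuple_rep \<le> enat CARD('n)"
    unfolding Cc_def using fin
    by (intro INF_lower2[of ?\<Delta>]) (auto simp: ecard_def countable_finite)
  with lower mono show ?thesis by (meson order_antisym order_trans)
qed

end
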